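(* Consider the augmented Lagrange algorithm described in the context and let $(y_n^+,u_n^+,p_n^+,\mu_n^+)_n$ be the sequence of iterates recorded at its successful steps. Assume that in step (1) the solutions are chosen such that $\frac1{\rho_k}\|(\mu_k+\rho_k(\bar y_k-\psi))_+\|^2_{L^2(\Omega)}$ is uniformly bounded in $k$. Let $u^*$ be a weak limit point in $L^2(\Omega)$ of $(u_n^+)_n$, say $u_{n'}^+\rightharpoonup u^*$. Then $y^*=S(u^* )$ is feasible, i.e. $y^*\le\psi$, and $\lim_{n'\to\infty}(\mu_{n'}^+,\psi-y_{n'}^+)_+=0$.
   Context: Setting. Let $\Omega\subset\mathbb{R}^N$, $N\in\{2,3\}$, be a bounded domain with $C^{1,1}$ boundary $\Gamma$, or a bounded convex domain with polygonal boundary $\Gamma$. Let $y_d\in L^2(\Omega)$, $\psi\in C(\bar\Omega)$, $\alpha>0$, $u_a,u_b\in L^\infty(\Omega)$ with $u_a\le u_b$, $U_{ad}=\{u\in L^\infty(\Omega): u_a\le u\le u_b\text{ a.e.}\}$. Let $Ay=-\sum_{i,j=1}^N\partial_{x_j}(a_{ij}\partial_{x_i}y)+a_0y$ with $a_{ij}\in C^{0,1}(\bar\Omega)$, $a_0\in L^\infty(\Omega)$, $a_0\ge0$ a.e., $a_0\not\equiv0$, uniformly elliptic with constant $\delta>0$; $\partial_{\nu_A}y=\sum a_{ij}\partial_{x_i}y\,\nu_j$; $A^*$ the formal adjoint with conormal derivative $\partial_{\nu_{A^*}}$. The function $d:\Omega\times\mathbb{R}\to\mathbb{R}$ is measurable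 in $x$, $C^2$ in $y$ for a.e. $x$, $\|d(\cdot,0)\|_\infty+\|d_y(\cdot,0)\|_\infty+\|d_{yy}(\cdot,0)\|_\infty<\infty$, $d_y\ge0$, $d_{yy}$ Lipschitz in $y$ on bounded sets uniformly in $x$, and $d_y>0$ on $E_\Omega\times\mathbb{R}$ for some $E_\Omega$ of positive measure. $S(u)\in H^1(\Omega)\cap C(\bar\Omega)$ is the weak solution of $Ay+d(x,y)=u$ in $\Omega$, $\partial_{\nu_A}y=0$ on $\Gamma$. $f(u)=\frac12\|S(u)-y_d\|_{L^2}^2+\frac\alpha2\|u\|_{L^2}^2$. $(\cdot)_+=\max(0,\cdot)$ pointwise; $(a,b)_+:=\int_\Omega\max(0,a(x)b(x))dx$. Optimality system of the augmented Lagrange sub-problem ($\rho>0$, $0\le\mu\in L^2$): $(\bar y,\bar u,\bar p)$ with $\bar u\in U_{ad}$, $\bar y=S(\bar u)$, $\bar p\in H^1(\Omega)$ weak solution of $A^*\bar p+d_y(x,\bar y)\bar p=\bar y-y_d+(\mu+\rho(\bar y-\psi))_+$, $\partial_{\nu_{A^*}}\bar p=0$, and $(\bar p+\alpha\bar u,u-\bar u)\ge0$ for all $u\in U_{ad}$. Algorithm: choose $\rho_1>0$, $0\le\mu_1\in L^2(\Omega)$, $\theta>1$, $\tau\in(0,1)$, $R_0^+>0$; $k=n=1$. Iteration $k$: (1) choose a solution $(\bar y_k,\bar u_k,\bar p_k)$ of the optimality system with $\mu=\mu_k,\rho=\rho_k$; (2) $\bar\mu_k:=(\mu_k+\rho_k(\bar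 y_k-\psi))_+$; (3) $R_k:=\|(\bar y_k-\psi)_+\|_{C(\bar\Omega)}+(\bar\mu_k,\psi-\bar y_k)_+$; (4) if $R_k\le\tau R^+_{n-1}$ the step is successful: $\mu_{k+1}:=\bar\mu_k$, $\rho_{k+1}:=\rho_k$, record $(y_n^+,u_n^+,p_n^+):=(\bar y_k,\bar u_k,\bar p_k)$, $\mu_n^+:=\bar\mu_k$, $R_n^+:=R_k$, $n:=n+1$; (5) otherwise $\mu_{k+1}:=\mu_k$, $\rho_{k+1}:=\theta\rho_k$; then $k:=k+1$ and repeat indefinitely. *)

theory Defs
  imports "HOL-Analysis.Analysis"
begin

definition L2 :: "(real^'n) set \<Rightarrow> (real^'n \<Rightarrow> real) \<Rightarrow> bool" where
  "L2 \<Omega> f \<longleftrightarrow> f \<in> borel_measurable (lebesgue_on \<Omega>) \<and> integrable (lebesgue_on \<Omega>) (\<lambda>x. (f x)\<^sup>2)"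

definition Linf :: "(real^'n) set \<Rightarrow> (real^'n \<Rightarrow> real) \<Rightarrow> bool" where
  "Linf \<Omega> f \<longleftrightarrow> f \<in> borel_measurable (lebesgue_on \<Omega>) \<and> (\<exists>C. AE x in lebesgue_on \<Omega>. \<bar>f x\<bar> \<le> C)"

definition ip :: "(real^'n) set \<Rightarrow> (real^'n \<Rightarrow> real) \<Rightarrow> (real^'n \<Rightarrow> real) \<Rightarrow> real" where
  "ip \<Omega> f g = (\<integral>x. f x * g x \<partial>lebesgue_on \<Omega>)"

definition ip_plus :: "(real^'n) set \<Rightarrow> (real^'n \<Rightarrow> real) \<Rightarrow> (real^'n \<Rightarrow> real) \<Rightarrow> real" where
  "ip_plus \<Omega> f g = (\<integral>x. max 0 (f x * g x) \<partial>lebesgue_on \<Omega>)"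

definition weak_conv_L2 :: "(real^'n) set \<Rightarrow> (nat \<Rightarrow> real^'n \<Rightarrow> real) \<Rightarrow> (real^'n \<Rightarrow> real) \<Rightarrow> bool" where
  "weak_conv_L2 \<Omega> u v \<longleftrightarrow> L2 \<Omega> v \<and> (\<forall>j. L2 \<Omega> (u j)) \<and>
     (\<forall>g. L2 \<Omega> g \<longrightarrow> (\<lambda>j. ip \<Omega> (u j) g) \<longlonglongrightarrow> ip \<Omega> v g)"

definition partial :: "'n \<Rightarrow> (real^'n \<Rightarrow> real) \<Rightarrow> real^'n \<Rightarrow> real" where
  "partial i f x = frechet_derivative f (at x) (axis i 1)"

fun pdi :: "'n list \<Rightarrow> (real^'n \<Rightarrow> real) \<Rightarrow> real^'n \<Rightarrow> real" where
  "pdi [] f = f"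
| "pdi (i # is) f = partial i (pdi is f)"

definition smooth :: "(real^'n \<Rightarrow> real) \<Rightarrow> bool" where
  "smooth f \<longleftrightarrow> (\<forall>is. (\<forall>x. pdi is f differentiable (at x)) \<and> continuous_on UNIV (pdi is f))"

definition test_fun :: "(real^'n) set \<Rightarrow> (real^'n \<Rightarrow> real) \<Rightarrow> bool" where
  "test_fun \<Omega> \<phi> \<longleftrightarrow> smooth \<phi> \<and> compact (closure {x. \<phi> x \<noteq> 0}) \<and> closure {x. \<phi> x \<noteq> 0} \<subseteq> \<Omega>"

definition weak_grad :: "(real^'n) set \<Rightarrow> (real^'n \<Rightarrow> real) \<Rightarrow> (real^'n \<Rightarrow> real^'n) \<Rightarrow> bool" where
  "weak_grad \<Omega> y G \<longleftrightarrow> (\<forall>\<phi>. test_fun \<Omega> \<phi> \<longrightarrow> (\<forall>i.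
      (\<integral>x. y x * partial i \<phi> x \<partial>lebesgue_on \<Omega>) = - (\<integral>x. G x $ i * \<phi> x \<partial>lebesgue_on \<Omega>)))"

definition H1_grad :: "(real^'n) set \<Rightarrow> (real^'n \<Rightarrow> real) \<Rightarrow> (real^'n \<Rightarrow> real^'n) \<Rightarrow> bool" where
  "H1_grad \<Omega> y G \<longleftrightarrow> L2 \<Omega> y \<and> (\<forall>i. L2 \<Omega> (\<lambda>x. G x $ i)) \<and> weak_grad \<Omega> y G"

definition H1 :: "(real^'n) set \<Rightarrow> (real^'n \<Rightarrow> real) \<Rightarrow> bool" where
  "H1 \<Omega> y \<longleftrightarrow> (\<exists>G. H1_grad \<Omega> y G)"

definition C11_boundary :: "(real^'n) set \<Rightarrow> bool" where
  "C11_boundary \<Omega> \<longleftrightarrow> (\<forall>x0\<in>frontier \<Omega>. \<exists>r>0. \<exists>\<gamma> gr L.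
      (\<forall>x. (\<gamma> has_derivative (\<lambda>h. gr x \<bullet> h)) (at x)) \<and> L-lipschitz_on UNIV gr \<and>
      (\<forall>x\<in>ball x0 r. gr x \<noteq> 0) \<and>
      ball x0 r \<inter> \<Omega> = {x\<in>ball x0 r. \<gamma> x < 0})"

definition admissible_domain :: "(real^'n) set \<Rightarrow> bool" where
  "admissible_domain \<Omega> \<longleftrightarrow> (CARD('n) = 2 \<or> CARD('n) = 3) \<and>
     open \<Omega> \<and> connected \<Omega> \<and> \<Omega> \<noteq> {} \<and> bounded \<Omega> \<and>
     (C11_boundary \<Omega> \<or> (convex \<Omega> \<and> (\<exists>P. polytope P \<and> \<Omega> = interior P)))"

definition elliptic_op :: "(real^'n) set \<Rightarrow> ('n \<Rightarrow> 'n \<Rightarrow> real^'n \<Rightarrow> real) \<Rightarrow> (real^'n \<Rightarrow> real) \<Rightarrow> real \<Rightarrow> bool" where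
  "elliptic_op \<Omega> a a0 \<delta> \<longleftrightarrow> (\<forall>i j. \<exists>L. L-lipschitz_on (closure \<Omega>) (a i j)) \<and>
     Linf \<Omega> a0 \<and> (AE x in lebesgue_on \<Omega>. a0 x \<ge> 0) \<and> \<not> (AE x in lebesgue_on \<Omega>. a0 x = 0) \<and>
     \<delta> > 0 \<and> (\<forall>x\<in>\<Omega>. \<forall>\<xi>::real^'n. (\<Sum>i\<in>UNIV. \<Sum>j\<in>UNIV. a i j x * \<xi>$i * \<xi>$j) \<ge> \<delta> * (norm \<xi>)\<^sup>2)"

definition dY :: "(real^'n \<Rightarrow> real \<Rightarrow> real) \<Rightarrow> real^'n \<Rightarrow> real \<Rightarrow> real" where
  "dY d x t = deriv (d x) t"

definition dYY :: "(real^'n \<Rightarrow> real \<Rightarrow> real) \<Rightarrow> real^'n \<Rightarrow> real \<Rightarrow> real" where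
  "dYY d x t = deriv (dY d x) t"

definition nonlin_ok :: "(real^'n) set \<Rightarrow> (real^'n \<Rightarrow> real \<Rightarrow> real) \<Rightarrow> bool" where
  "nonlin_ok \<Omega> d \<longleftrightarrow>
     (\<forall>t. (\<lambda>x. d x t) \<in> borel_measurable (lebesgue_on \<Omega>)) \<and>
     (AE x in lebesgue_on \<Omega>. (\<forall>t. d x differentiable (at t)) \<and> (\<forall>t. dY d x differentiable (at t))
        \<and> continuous_on UNIV (dYY d x)) \<and>
     Linf \<Omega> (\<lambda>x. d x 0) \<and> Linf \<Omega> (\<lambda>x. dY d x 0) \<and> Linf \<Omega> (\<lambda>x. dYY d x 0) \<and>
     (AE x in lebesgue_on \<Omega>. \<forall>t. dY d x t \<ge> 0) \<and>
     (\<forall>M. \<exists>L. AE x in lebesgue_on \<Omega>. \<forall>s t. \<bar>s\<bar> \<le> M \<longrightarrow> \<bar>t\<bar> \<le> M \<longrightarrow>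
         \<bar>dYY d x s - dYY d x t\<bar> \<le> L * \<bar>s - t\<bar>) \<and>
     (\<exists>E \<in> sets (lebesgue_on \<Omega>). emeasure (lebesgue_on \<Omega>) E > 0 \<and> (\<forall>x\<in>E. \<forall>t. dY d x t > 0))"

text \<open>y is a weak solution in H^1(\<Omega>) \<inter> C(closure \<Omega>) of A y + d(x,y) = u, \<partial>_{\<nu>_A} y = 0, i.e. y = S(u)\<close>
definition state_sol :: "(real^'n) set \<Rightarrow> ('n \<Rightarrow> 'n \<Rightarrow> real^'n \<Rightarrow> real) \<Rightarrow> (real^'n \<Rightarrow> real)
    \<Rightarrow> (real^'n \<Rightarrow> real \<Rightarrow> real) \<Rightarrow> (real^'n \<Rightarrow> real) \<Rightarrow> (real^'n \<Rightarrow> real) \<Rightarrow> bool" where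
  "state_sol \<Omega> a a0 d u y \<longleftrightarrow> continuous_on (closure \<Omega>) y \<and>
     (\<exists>G. H1_grad \<Omega> y G \<and> (\<forall>v V. H1_grad \<Omega> v V \<longrightarrow>
        (\<integral>x. (\<Sum>i\<in>UNIV. \<Sum>j\<in>UNIV. a i j x * G x $ i * V x $ j) + a0 x * y x * v x + d x (y x) * v x
           \<partial>lebesgue_on \<Omega>) = (\<integral>x. u x * v x \<partial>lebesgue_on \<Omega>)))"

text \<open>p is a weak solution in H^1(\<Omega>) of A^* p + c p = f, \<partial>_{\<nu>_{A^*}} p = 0\<close>
definition adjoint_sol :: "(real^'n) set \<Rightarrow> ('n \<Rightarrow> 'n \<Rightarrow> real^'n \<Rightarrow> real) \<Rightarrow> (real^'n \<Rightarrow> real)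
    \<Rightarrow> (real^'n \<Rightarrow> real) \<Rightarrow> (real^'n \<Rightarrow> real) \<Rightarrow> (real^'n \<Rightarrow> real) \<Rightarrow> bool" where
  "adjoint_sol \<Omega> a a0 c f p \<longleftrightarrow>
     (\<exists>P. H1_grad \<Omega> p P \<and> (\<forall>v V. H1_grad \<Omega> v V \<longrightarrow>
        (\<integral>x. (\<Sum>i\<in>UNIV. \<Sum>j\<in>UNIV. a i j x * V x $ i * P x $ j) + a0 x * p x * v x + c x * p x * v x
           \<partial>lebesgue_on \<Omega>) = (\<integral>x. f x * v x \<partial>lebesgue_on \<Omega>)))"

definition Uad :: "(real^'n) set \<Rightarrow> (real^'n \<Rightarrow> real) \<Rightarrow> (real^'n \<Rightarrow> real) \<Rightarrow> (real^'n \<Rightarrow> real) set" where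
  "Uad \<Omega> ua ub = {u. Linf \<Omega> u \<and> (AE x in lebesgue_on \<Omega>. ua x \<le> u x \<and> u x \<le> ub x)}"

definition mu_bar :: "(real^'n \<Rightarrow> real) \<Rightarrow> real \<Rightarrow> (real^'n \<Rightarrow> real) \<Rightarrow> (real^'n \<Rightarrow> real) \<Rightarrow> real^'n \<Rightarrow> real" where
  "mu_bar \<mu> \<rho> \<psi> y = (\<lambda>x. max 0 (\<mu> x + \<rho> * (y x - \<psi> x)))"

definition opt_system where
  "opt_system \<Omega> a a0 d yd \<alpha> ua ub \<psi> \<mu> \<rho> y u p \<longleftrightarrow>
     u \<in> Uad \<Omega> ua ub \<and> state_sol \<Omega> a a0 d u y \<and>
     adjoint_sol \<Omega> a a0 (\<lambda>x. dY d x (y x)) (\<lambda>x. y x - yd x + mu_bar \<mu> \<rho> \<psi> y x) p \<and>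
     (\<forall>w\<in>Uad \<Omega> ua ub. ip \<Omega> (\<lambda>x. p x + \<alpha> * u x) (\<lambda>x. w x - u x) \<ge> 0)"

definition Cnorm_plus :: "(real^'n) set \<Rightarrow> (real^'n \<Rightarrow> real) \<Rightarrow> (real^'n \<Rightarrow> real) \<Rightarrow> real" where
  "Cnorm_plus \<Omega> y \<psi> = (SUP x\<in>closure \<Omega>. max 0 (y x - \<psi> x))"

definition R_val where
  "R_val \<Omega> \<psi> y m = Cnorm_plus \<Omega> y \<psi> + ip_plus \<Omega> m (\<lambda>x. \<psi> x - y x)"

text \<open>A run of the algorithm (iterations k = 1,2,...). nc k is the value of the counter n at the
 start of iteration k; Rp n = R_n^+ (Rp 0 = R_0^+); yp,up,pp,mp are the recorded iterates.\<close>
definition ALM_run where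
  "ALM_run \<Omega> a a0 d yd \<alpha> ua ub \<psi> \<theta> \<tau> \<rho> \<mu> yb ub' pb nc Rp yp up pp mp \<longleftrightarrow>
     \<rho> 1 > 0 \<and> L2 \<Omega> (\<mu> 1) \<and> (AE x in lebesgue_on \<Omega>. \<mu> 1 x \<ge> 0) \<and> \<theta> > 1 \<and> 0 < \<tau> \<and> \<tau> < 1 \<and> Rp 0 > 0 \<and> nc 1 = 1 \<and>
     (\<forall>k\<ge>1. opt_system \<Omega> a a0 d yd \<alpha> ua ub \<psi> (\<mu> k) (\<rho> k) (yb k) (ub' k) (pb k) \<and>
        (let mb = mu_bar (\<mu> k) (\<rho> k) \<psi> (yb k); Rk = R_val \<Omega> \<psi> (yb k) mb in
         if Rk \<le> \<tau> * Rp (nc k - 1) then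
           \<mu> (k+1) = mb \<and> \<rho> (k+1) = \<rho> k \<and>
           yp (nc k) = yb k \<and> up (nc k) = ub' k \<and> pp (nc k) = pb k \<and> mp (nc k) = mb \<and>
           Rp (nc k) = Rk \<and> nc (k+1) = nc k + 1
         else \<mu> (k+1) = \<mu> k \<and> \<rho> (k+1) = \<theta> * \<rho> k \<and> nc (k+1) = nc k))"

end

theory Submission
  imports Defs "HOL-Computational_Algebra.Polynomial"
begin

text \<open>
  A successful step satisfies \<open>R\<^sub>n\<^sup>+ \<le> \<tau> R\<^sub>n\<^sub>-\<^sub>1\<^sup>+\<close>, so infinitely many of them force \<open>R\<^sub>n\<^sup>+ \<rightarrow> 0\<close>. This bounds the
  complementarity term and gives \<open>y\<^sub>n\<^sup>+ \<le> \<psi> + R\<^sub>n\<^sup>+\<close>; what remains is to pass to the limit in the state equation.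

  Let \<open>w\<^sub>n = y\<^sub>n\<^sup>+ - y\<^sup>*\<close> and test the difference of the two state equations with \<open>v\<^sub>n = arctan w\<^sub>n\<close>. Monotonicity
  of \<open>d\<close> and ellipticity give \<open>\<delta> \<integral> \<bar>\<nabla>v\<^sub>n\<bar>\<^sup>2 + \<integral> a0 v\<^sub>n\<^sup>2 \<le> \<integral> (u\<^sub>n\<^sup>+ - u\<^sup>*) v\<^sub>n\<close>. Since \<open>v\<^sub>n\<close> and \<open>u\<^sub>n\<^sup>+ - u\<^sup>*\<close> are bounded,
  the gradients are bounded in \<open>L\<^sup>2\<close>, and a thin strip along the boundary contributes little to the right-hand side. In the
  interior \<open>v\<^sub>n\<close> is close in \<open>L\<^sup>1\<close> to its average over small balls, and moving the average onto \<open>u\<^sub>n\<^sup>+ - u\<^sup>*\<close>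
  turns weak into pointwise convergence. So the right-hand side vanishes in the limit, then \<open>\<nabla>v\<^sub>n \<rightarrow> 0\<close> and
  \<open>\<integral> a0 v\<^sub>n\<^sup>2 \<rightarrow> 0\<close>, and as \<open>\<Omega>\<close> is connected and \<open>a0\<close> does not vanish, \<open>v\<^sub>n \<rightarrow> 0\<close> locally in \<open>L\<^sup>1\<close>.
\<close>

section \<open>Smooth bump functions\<close>

text \<open>Two obstacles shape the development. First, \<open>arctan w\<close> may be used as a
  test function only once its weak gradient is known, and weak gradients are defined by smooth test
  functions alone, whereas the natural weight \<open>\<phi> x * T' (w x)\<close> of the chain rule
  is merely continuous. The chain rule is therefore read off difference quotients: a translation of
  \<open>w\<close> is expressed through its gradient, first against smooth functions and then, by
  mollification, against continuous ones of compact support. Second, some compactness is needed. In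
  place of an embedding theorem stands an interior L^1 bound of \<open>w (x + z) - w x\<close> by
  \<open>norm z\<close> times the mass of the gradient, uniform along the sequence. The arctangent
  fits the quadratic form because the gradient of \<open>w\<close> is 1 + w^2 times that of
  \<open>arctan w\<close>, and this factor is at least 1. Local L^1 convergence suffices in the end:
  a violated constraint would, by continuity, persist with a fixed size on a ball, and there
  \<open>arctan\<close> stays away from 0.\<close>

lemma smooth_of_closed_class:
  assumes f: "f \<in> S"
    and diff: "\<And>g x. g \<in> S \<Longrightarrow> g differentiable (at x)"
    and part: "\<And>g i. g \<in> S \<Longrightarrow> partial i g \<in> S"
  shows "smooth f"
proof -
  have "pdi is f \<in> S" for "is"
    by (induction "is") (auto simp: f part)
  then show ?thesis
    unfolding smooth_def
    by (meson diff differentiable_imp_continuous_on differentiable_on_def differentiable_at_withinI)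
qed

lemma partial_eqI: "(f has_derivative f') (at x) \<Longrightarrow> partial i f x = f' (axis i 1)"
  unfolding partial_def by (metis frechet_derivative_at)

text \<open>For \<open>p = 1\<close> this is the classical flat function. With the polynomial as a
  parameter the family is closed under differentiation, so that derivatives of all orders are
  treated at once.\<close>

definition flat_exp :: "real poly \<Rightarrow> real \<Rightarrow> real" where
  "flat_exp p t = (if t > 0 then poly p (1 / t) * exp (- (1 / t)) else 0)"


lemma poly_times_exp_minus_tendsto_0: "((\<lambda>s. poly p s * exp (- s)) \<longlongrightarrow> 0) at_top" for p :: "real poly"
proof -
  have "((\<lambda>s. \<Sum>i\<le>degree p. coeff p i * (s ^ i / exp s)) \<longlongrightarrow> (\<Sum>i\<le>degree p. coeff p i * 0)) at_top"
    by (intro tendsto_intros tendsto_power_div_exp_0)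
  then show ?thesis
    by (simp add: poly_altdef exp_minus field_simps sum_divide_distrib sum_distrib_right)
qed

lemma flat_exp_tendsto_0: "(flat_exp p \<longlongrightarrow> 0) (at_right 0)"
proof -
  have "((\<lambda>t. poly p (inverse t) * exp (- inverse t)) \<longlongrightarrow> 0) (at_right (0::real))"
    using filterlim_compose[OF poly_times_exp_minus_tendsto_0 filterlim_inverse_at_top_right] .
  moreover have "\<forall>\<^sub>F t in at_right 0. poly p (inverse t) * exp (- inverse t) = flat_exp p t"
    by (simp add: eventually_at_right_less flat_exp_def inverse_eq_divide eventually_mono[OF eventually_at_right_less])
  ultimately show ?thesis
    by (rule Lim_transform_eventually)
qed

text \<open>With s = 1/t one has d/dt = - s^2 d/ds, so p(s) exp(-s) has derivative s^2 (p - p')(s)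
  exp(-s); the factor \<open>[:0, 0, 1:]\<close> is s^2.\<close>

lemma has_real_derivative_flat_exp:
  "(flat_exp p has_real_derivative flat_exp ([:0, 0, 1:] * (p - pderiv p)) t) (at t)"
proof -
  consider "t > 0" | "t < 0" | "t = 0" by linarith
  then show ?thesis
  proof cases
    case 1
    have "((\<lambda>t. poly p (1 / t) * exp (- (1 / t))) has_real_derivative
        poly ([:0, 0, 1:] * (p - pderiv p)) (1 / t) * exp (- (1 / t))) (at t)"
      using 1 by (auto intro!: derivative_eq_intros simp: field_simps power2_eq_square)
    then have "(flat_exp p has_real_derivative
        poly ([:0, 0, 1:] * (p - pderiv p)) (1 / t) * exp (- (1 / t))) (at t)"
      by (rule has_field_derivative_transform_within_open[where S = "{0<..}"])
        (use 1 in \<open>auto simp: flat_exp_def\<close>)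
    then show ?thesis using 1 by (simp add: flat_exp_def)
  next
    case 2
    have "((\<lambda>_. 0) has_real_derivative 0) (at t)" by simp
    then have "(flat_exp p has_real_derivative 0) (at t)"
      by (rule has_field_derivative_transform_within_open[where S = "{..<0}"])
        (use 2 in \<open>auto simp: flat_exp_def\<close>)
    then show ?thesis using 2 by (simp add: flat_exp_def)
  next
    case 3
    \<comment> \<open>From the right, the difference quotient at 0 is s p(s) exp(-s) with s = 1/h.
      It belongs to the same family and hence tends to 0.\<close>
    have "((\<lambda>h. (flat_exp p h - flat_exp p 0) / h) \<longlongrightarrow> 0) (at_right 0)"
    proof (rule Lim_transform_eventually[OF flat_exp_tendsto_0[of "[:0, 1:] * p"]])
      show "\<forall>\<^sub>F h in at_right 0. flat_exp ([:0, 1:] * p) h = (flat_exp p h - flat_exp p 0) / h"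
        by (rule eventually_mono[OF eventually_at_right_less]) (simp add: flat_exp_def)
    qed
    moreover have "((\<lambda>h. (flat_exp p h - flat_exp p 0) / h) \<longlongrightarrow> 0) (at_left 0)"
    proof (rule Lim_transform_eventually[OF tendsto_const])
      show "\<forall>\<^sub>F h in at_left 0. 0 = (flat_exp p h - flat_exp p 0) / h"
        by (auto simp: eventually_at_filter flat_exp_def)
    qed
    ultimately have "((\<lambda>h. (flat_exp p h - flat_exp p 0) / h) \<longlongrightarrow> 0) (at 0)"
      by (simp add: filterlim_at_split)
    then show ?thesis
      using 3 by (simp add: has_field_derivative_iff flat_exp_def)
  qed
qed

text \<open>Partial derivatives of products of one-coordinate flat functions are sums of such
  products with changed polynomials; closure under sums and products captures them all. The two
  signs of \<open>\<sigma>\<close> together confine a coordinate to an interval.\<close>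

inductive_set bump_class :: "(real^'n \<Rightarrow> real) set" where
  const: "(\<lambda>_. c) \<in> bump_class"
| flat: "(\<lambda>x. flat_exp p (\<sigma> * x $ i + e)) \<in> bump_class"
| add: "f \<in> bump_class \<Longrightarrow> g \<in> bump_class \<Longrightarrow> (\<lambda>x. f x + g x) \<in> bump_class"
| mult: "f \<in> bump_class \<Longrightarrow> g \<in> bump_class \<Longrightarrow> (\<lambda>x. f x * g x) \<in> bump_class"

lemma bump_class_deriv:
  fixes f :: "real^'n \<Rightarrow> real"
  assumes "f \<in> bump_class"
  shows "(\<forall>x. f differentiable (at x)) \<and> (\<forall>j. partial j f \<in> bump_class)"
  using assms
proof induction
  case (const c)
  have "partial j (\<lambda>_::real^'n. c) = (\<lambda>_. 0)" for j :: 'n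
    by (rule ext, subst partial_eqI[where f' = "\<lambda>_. 0"]) auto
  then show ?case by (auto intro: bump_class.const)
next
  case (flat p \<sigma> i e)
  let ?q = "[:0, 0, 1:] * (p - pderiv p)"
  have d: "((\<lambda>x. flat_exp p (\<sigma> * x $ i + e)) has_derivative
      (\<lambda>h. flat_exp ?q (\<sigma> * x $ i + e) * (\<sigma> * h $ i))) (at x)" for x :: "real^'n"
  proof -
    have "((\<lambda>x::real^'n. \<sigma> * x $ i + e) has_derivative (\<lambda>h. \<sigma> * h $ i)) (at x)"
      using has_derivative_add[OF has_derivative_mult_right[OF bounded_linear_imp_has_derivative[OF
            bounded_linear_vec_nth[of i]], of \<sigma>] has_derivative_const[of e]]
      by simp
    from has_derivative_compose[OF this has_real_derivative_flat_exp[of p, unfolded has_field_derivative_def]]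
    show ?thesis by simp
  qed
  have "partial j (\<lambda>x::real^'n. flat_exp p (\<sigma> * x $ i + e)) =
     (\<lambda>x. (\<sigma> * axis j 1 $ i) * flat_exp ?q (\<sigma> * x $ i + e))" for j
    by (rule ext, subst partial_eqI[OF d]) simp
  then show ?case using d by (auto simp: differentiable_def intro!: bump_class.intros)
next
  case (add f g)
  have "partial j (\<lambda>x. f x + g x) = (\<lambda>x. partial j f x + partial j g x)" for j
  proof (rule ext)
    fix x
    have "f differentiable at x" "g differentiable at x" using add by auto
    then show "partial j (\<lambda>x. f x + g x) x = partial j f x + partial j g x"
      unfolding frechet_derivative_works
      by (subst partial_eqI[OF has_derivative_add]) (auto simp: partial_def)
  qed
  then show ?case using add by (auto intro!: bump_class.add)
next
  case (mult f g)
  have "partial j (\<lambda>x. f x * g x) = (\<lambda>x. f x * partial j g x + partial j f x * g x)" for j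
  proof (rule ext)
    fix x
    have "f differentiable at x" "g differentiable at x" using mult by auto
    then show "partial j (\<lambda>x. f x * g x) x = f x * partial j g x + partial j f x * g x"
      unfolding frechet_derivative_works
      by (subst partial_eqI[OF has_derivative_mult]) (auto simp: partial_def)
  qed
  then show ?case using mult by (auto intro!: bump_class.intros)
qed

lemma smooth_bump_class: "f \<in> bump_class \<Longrightarrow> smooth f"
  using smooth_of_closed_class bump_class_deriv by metis

lemma smooth_continuous: "smooth f \<Longrightarrow> continuous_on UNIV f"
  unfolding smooth_def by (metis pdi.simps(1))

lemma exists_bump:
  assumes "e > 0"
  shows "\<exists>\<eta> :: real^'n \<Rightarrow> real. smooth \<eta> \<and> (\<forall>x. 0 \<le> \<eta> x) \<and> (\<forall>x. \<eta> x \<noteq> 0 \<longrightarrow> norm x \<le> e) \<and>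
           integrable lborel \<eta> \<and> integral\<^sup>L lborel \<eta> = 1"
proof -
  \<comment> \<open>The norm is at most the sum of the absolute coordinates, so a cube of this half
    width fits into the ball of radius \<open>e\<close>.\<close>
  define r where "r = e / CARD('n)"
  have r: "r > 0" using assms by (simp add: r_def)
  define \<beta> :: "real^'n \<Rightarrow> real" where
    "\<beta> x = (\<Prod>i\<in>UNIV. flat_exp 1 (1 * x $ i + r) * flat_exp 1 (-1 * x $ i + r))" for x
  have "(\<lambda>x::real^'n. \<Prod>i\<in>I. flat_exp 1 (1 * x $ i + r) * flat_exp 1 (-1 * x $ i + r)) \<in> bump_class"
    if "finite I" for I
    using that
  proof induction
    case empty
    show ?case using bump_class.const[of 1] by simp
  next
    case (insert i I)
    show ?case
      unfolding prod.insert[OF insert.hyps(1,2)]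
      by (intro bump_class.mult bump_class.flat insert.IH)
  qed
  then have \<beta>P: "\<beta> \<in> bump_class" unfolding \<beta>_def by (auto simp: fun_eq_iff)
  have cont: "continuous_on UNIV \<beta>" by (intro smooth_continuous smooth_bump_class \<beta>P)
  have nonneg: "0 \<le> \<beta> x" for x
    by (auto simp: \<beta>_def flat_exp_def intro!: prod_nonneg)
  have pos: "\<beta> 0 > 0"
    using r by (auto simp: \<beta>_def flat_exp_def intro!: prod_pos)
  have supp: "norm x \<le> e" if "\<beta> x \<noteq> 0" for x
  proof -
    have "\<bar>x $ i\<bar> \<le> r" for i
    proof -
      have "flat_exp 1 (1 * x $ i + r) * flat_exp 1 (-1 * x $ i + r) \<noteq> 0"
        using that unfolding \<beta>_def by (metis UNIV_I finite prod_zero_iff)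
      then show ?thesis by (auto simp: flat_exp_def split: if_splits)
    qed
    then have "norm x \<le> (\<Sum>i\<in>(UNIV::'n set). r)"
      by (intro order_trans[OF norm_le_l1_cart] sum_mono) auto
    then show ?thesis by (simp add: r_def)
  qed
  have eq: "\<beta> = (\<lambda>x. indicator (cball 0 e) x *\<^sub>R \<beta> x)"
    using supp by (auto simp: fun_eq_iff indicator_def)
  have int: "integrable lborel \<beta>"
    by (subst eq, rule borel_integrable_compact[OF compact_cball])
      (use cont continuous_on_subset in blast)
  have "integral\<^sup>L lborel \<beta> > 0"
  proof -
    have "integral\<^sup>L lborel \<beta> \<noteq> 0"
    proof
      assume "integral\<^sup>L lborel \<beta> = 0"
      \<comment> \<open>The zero set of \<open>\<beta>\<close> is closed and of full measure, hence
        the whole space; this contradicts \<open>\<beta> 0 > 0\<close>.\<close>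
      then have "AE x in lborel. \<beta> x = 0"
        using integral_nonneg_eq_0_iff_AE[OF int] nonneg by auto
      then have "AE x in lborel. x \<in> {x. \<beta> x = 0}" by simp
      moreover have "closed {x. \<beta> x = 0}"
        using continuous_closed_preimage_constant[OF cont closed_UNIV, of 0] by simp
      ultimately have "0 \<in> {x. \<beta> x = 0}"
        by (intro mem_closed_if_AE_lebesgue AE_completion)
      then show False using pos by simp
    qed
    then show ?thesis using integral_nonneg_AE[where M = lborel and f = \<beta>] nonneg by fastforce
  qed
  then have I: "integral\<^sup>L lborel \<beta> > 0" .
  define \<eta> where "\<eta> x = inverse (integral\<^sup>L lborel \<beta>) * \<beta> x" for x
  have "smooth \<eta>" unfolding \<eta>_def by (intro smooth_bump_class bump_class.mult bump_class.const \<beta>P)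
  moreover have "\<forall>x. 0 \<le> \<eta> x" using I nonneg by (auto simp: \<eta>_def)
  moreover have "\<forall>x. \<eta> x \<noteq> 0 \<longrightarrow> norm x \<le> e" using supp by (auto simp: \<eta>_def)
  moreover have "integrable lborel \<eta>" "integral\<^sup>L lborel \<eta> = 1"
    using int I by (simp_all add: \<eta>_def[abs_def])
  ultimately show ?thesis by blast
qed

section \<open>Mollification\<close>

lemma smooth_partial: "smooth f \<Longrightarrow> smooth (partial i f)"
proof -
  have "pdi is (partial i f) = pdi (is @ [i]) f" for "is"
    by (induction "is") auto
  then show "smooth f \<Longrightarrow> smooth (partial i f)"
    unfolding smooth_def by metis
qed

lemma smooth_differentiable: "smooth f \<Longrightarrow> f differentiable (at x)"
  unfolding smooth_def by (metis pdi.simps(1))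

lemma has_derivative_partial:
  fixes f :: "real^'n \<Rightarrow> real"
  assumes "smooth f"
  shows "(f has_derivative (\<lambda>h. \<Sum>i\<in>UNIV. partial i f x * h $ i)) (at x)"
proof -
  have d: "(f has_derivative frechet_derivative f (at x)) (at x)"
    using smooth_differentiable[OF assms] frechet_derivative_works by blast
  then have l: "linear (frechet_derivative f (at x))"
    by (rule has_derivative_linear)
  have "frechet_derivative f (at x) h = (\<Sum>i\<in>UNIV. partial i f x * h $ i)" for h
  proof -
    have "frechet_derivative f (at x) h = frechet_derivative f (at x) (\<Sum>i\<in>UNIV. h $ i *\<^sub>R axis i 1)"
      by (simp add: basis_expansion scalar_mult_eq_scaleR[symmetric])
    also have "\<dots> = (\<Sum>i\<in>UNIV. partial i f x * h $ i)"
      by (simp add: linear_sum[OF l] linear_cmul[OF l] partial_def mult.commute)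
    finally show ?thesis .
  qed
  then show ?thesis using d by presburger
qed

text \<open>Both mollification (\<open>c y = y\<close>) and averaging over a segment (\<open>c s = s *\<^sub>R z\<close>) are instances.\<close>
definition pconv :: "'b::euclidean_space \<Rightarrow> 'b \<Rightarrow> ('b \<Rightarrow> real) \<Rightarrow> ('b \<Rightarrow> real^'n)
    \<Rightarrow> (real^'n \<Rightarrow> real) \<Rightarrow> real^'n \<Rightarrow> real" where
  "pconv a b k c \<psi> x = integral (cbox a b) (\<lambda>y. k y * \<psi> (x - c y))"

lemma has_derivative_pconv:
  fixes \<psi> :: "real^'n \<Rightarrow> real"
  assumes \<psi>: "smooth \<psi>" and k: "continuous_on (cbox a b) k" and c: "continuous_on (cbox a b) c"
  shows "(pconv a b k c \<psi> has_derivative (\<lambda>h. \<Sum>i\<in>UNIV. pconv a b k c (partial i \<psi>) x * h $ i)) (at x)"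
proof -
  \<comment> \<open>The Leibniz rule asks for the derivative as a bounded linear map that depends
    continuously on both variables; the gradient is packed into a combination of the coordinate
    functionals.\<close>
  let ?F = "\<lambda>x y. \<Sum>i\<in>UNIV. (k y * partial i \<psi> (x - c y)) *\<^sub>R blinfun_inner_right (axis i 1 :: real^'n)"
  have cp: "continuous_on UNIV (partial i \<psi>)" for i
    by (intro smooth_continuous smooth_partial \<psi>)
  have cont: "continuous_on (UNIV \<times> cbox a b) (\<lambda>(x, y). f (x - c y))"
    if "continuous_on UNIV f" for f :: "real^'n \<Rightarrow> real"
    unfolding split_beta
    by (rule continuous_on_compose2[OF that])
      (auto intro!: continuous_intros continuous_on_compose2[OF c])
  have cont1: "continuous_on (cbox a b) (\<lambda>y. k y * f (x - c y))"
    if "continuous_on UNIV f" for f :: "real^'n \<Rightarrow> real" and x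
    by (intro continuous_intros k continuous_on_compose2[OF that] c) auto
  have D: "((\<lambda>x. integral (cbox a b) (\<lambda>y. k y * \<psi> (x - c y))) has_derivative integral (cbox a b) (?F x)) (at x within UNIV)"
  proof (rule leibniz_rule)
    fix x y
    have "((\<lambda>x. x - c y) has_derivative (\<lambda>h. h)) (at x)"
      by (auto intro!: derivative_eq_intros)
    from has_derivative_compose[OF this has_derivative_partial[OF \<psi>]]
    have "((\<lambda>x. k y * \<psi> (x - c y)) has_derivative (\<lambda>h. k y * (\<Sum>i\<in>UNIV. partial i \<psi> (x - c y) * h $ i))) (at x)"
      by (rule has_derivative_mult_right)
    then show "((\<lambda>x. k y * \<psi> (x - c y)) has_derivative blinfun_apply (?F x y)) (at x within UNIV)"
      by (rule has_derivative_eq_rhs)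
        (simp add: fun_eq_iff blinfun.sum_left blinfun.scaleR_left inner_axis' sum_distrib_left mult.assoc)
  next
    show "(\<lambda>y. k y * \<psi> (x - c y)) integrable_on cbox a b" for x
      by (intro integrable_continuous cont1 smooth_continuous \<psi>)
  next
    show "continuous_on (UNIV \<times> cbox a b) (\<lambda>(x, t). ?F x t)"
      unfolding split_beta
      by (intro continuous_intros continuous_on_compose2[OF k] cont[OF cp, unfolded split_beta]) auto
  qed auto
  have "blinfun_apply (integral (cbox a b) (?F x)) h = (\<Sum>i\<in>UNIV. pconv a b k c (partial i \<psi>) x * h $ i)" for h
  proof -
    have int: "?F x integrable_on cbox a b"
      by (intro integrable_continuous continuous_intros cont1 cp)
    have "blinfun_apply (integral (cbox a b) (?F x)) h = integral (cbox a b) (\<lambda>y. blinfun_apply (?F x y) h)"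
      using integral_linear[OF int blinfun.bounded_linear_left, of h] by (simp add: o_def)
    also have "\<dots> = integral (cbox a b) (\<lambda>y. \<Sum>i\<in>UNIV. (k y * partial i \<psi> (x - c y)) * h $ i)"
      by (simp add: blinfun.sum_left blinfun.scaleR_left inner_axis')
    also have "\<dots> = (\<Sum>i\<in>UNIV. integral (cbox a b) (\<lambda>y. (k y * partial i \<psi> (x - c y)) * h $ i))"
      by (intro integral_sum integrable_continuous continuous_intros cont1 cp) auto
    also have "\<dots> = (\<Sum>i\<in>UNIV. pconv a b k c (partial i \<psi>) x * h $ i)"
      unfolding pconv_def by simp
    finally show ?thesis .
  qed
  then have "blinfun_apply (integral (cbox a b) (?F x)) = (\<lambda>h. \<Sum>i\<in>UNIV. pconv a b k c (partial i \<psi>) x * h $ i)"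
    by blast
  moreover have "pconv a b k c \<psi> = (\<lambda>x. integral (cbox a b) (\<lambda>y. k y * \<psi> (x - c y)))"
    by (simp add: fun_eq_iff pconv_def)
  ultimately show ?thesis using D by simp
qed

lemma partial_pconv:
  assumes "smooth \<psi>" "continuous_on (cbox a b) k" "continuous_on (cbox a b) c"
  shows "partial i (pconv a b k c \<psi>) = pconv a b k c (partial i \<psi>)"
proof
  fix x
  have "partial i (pconv a b k c \<psi>) x = (\<Sum>j\<in>UNIV. pconv a b k c (partial j \<psi>) x * axis i 1 $ j)"
    by (rule partial_eqI[OF has_derivative_pconv[OF assms]])
  also have "\<dots> = (\<Sum>j\<in>UNIV. if j = i then pconv a b k c (partial j \<psi>) x else 0)"
    by (intro sum.cong) (auto simp: axis_def)
  finally show "partial i (pconv a b k c \<psi>) x = pconv a b k c (partial i \<psi>) x" by simp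
qed

text \<open>All derivatives fall on \<open>\<psi>\<close>, so the image of the smooth functions
  under \<open>pconv a b k c\<close> is a class of the kind required by
  \<open>smooth_of_closed_class\<close>. Continuity of \<open>k\<close> and \<open>c\<close> is
  enough for this.\<close>

lemma smooth_pconv:
  assumes "smooth \<psi>" "continuous_on (cbox a b) k" "continuous_on (cbox a b) c"
  shows "smooth (pconv a b k c \<psi>)"
proof (rule smooth_of_closed_class)
  let ?S = "pconv a b k c ` Collect smooth"
  show "pconv a b k c \<psi> \<in> ?S" using assms by auto
  show "g differentiable (at x)" if "g \<in> ?S" for g x
    using that has_derivative_pconv[OF _ assms(2,3)] by (auto simp: differentiable_def)
  show "partial i g \<in> ?S" if g: "g \<in> ?S" for g i
  proof -
    obtain \<phi> where \<phi>: "g = pconv a b k c \<phi>" "smooth \<phi>" using g by blast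
    then have "partial i g = pconv a b k c (partial i \<phi>)"
      using partial_pconv[OF _ assms(2,3)] by simp
    then show ?thesis using smooth_partial[OF \<phi>(2)] by blast
  qed
qed

lemma test_funI:
  assumes "smooth f" "compact K" "K \<subseteq> \<Omega>" "\<And>x. x \<notin> K \<Longrightarrow> f x = 0"
  shows "test_fun \<Omega> f"
proof -
  have "closure {x. f x \<noteq> 0} \<subseteq> K"
    by (rule closure_minimal) (use assms compact_imp_closed in auto)
  then show ?thesis
    using assms bounded_subset[OF compact_imp_bounded[OF assms(2)], of "closure {x. f x \<noteq> 0}"]
    unfolding test_fun_def by (auto simp: compact_eq_bounded_closed)
qed

section \<open>Translation invariance and uniform approximation by smooth functions\<close>

lemma lborel_translate: "distr lborel borel (\<lambda>x. z + x) = (lborel :: 'a::euclidean_space measure)"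
  using lborel_affine[of 1 z] by (simp add: density_1)

lemma lborel_reflect: "distr lborel borel (\<lambda>x. z - x) = (lborel :: 'a::euclidean_space measure)"
  using lborel_affine[of "-1" z] by (simp add: density_1)

lemma lebesgue_translate: "distr lebesgue lebesgue (\<lambda>x. z + x) = (lebesgue :: 'a::euclidean_space measure)"
  and measurable_lebesgue_translate: "(\<lambda>x. z + x) \<in> lebesgue \<rightarrow>\<^sub>M lebesgue" for z :: "'a::euclidean_space"
  using lebesgue_affine_euclidean[of "\<lambda>_::'a. 1" z] lebesgue_affine_measurable[of "\<lambda>_::'a. 1" z]
  by (simp_all add: euclidean_representation density_1)

lemma integral_lebesgue_translate:
  fixes f :: "'a::euclidean_space \<Rightarrow> real"
  assumes "f \<in> borel_measurable lebesgue"
  shows "(\<integral>x. f (z + x) \<partial>lebesgue) = integral\<^sup>L lebesgue f"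
  by (subst (2) lebesgue_translate[of z, symmetric])
    (rule integral_distr[symmetric, OF measurable_lebesgue_translate assms])

lemma integrable_lebesgue_translate:
  fixes f :: "'a::euclidean_space \<Rightarrow> real"
  assumes "integrable lebesgue f"
  shows "integrable lebesgue (\<lambda>x. f (z + x))"
  using assms integrable_distr[OF measurable_lebesgue_translate, of z f] by (simp add: lebesgue_translate)

lemma uniform_continuity_compact_support:
  fixes g :: "'a::euclidean_space \<Rightarrow> real"
  assumes g: "continuous_on UNIV g" and K: "compact K" and g0: "\<And>x. x \<notin> K \<Longrightarrow> g x = 0" and e: "e > 0"
  shows "\<exists>r>0. \<forall>x y. dist x y < r \<longrightarrow> \<bar>g x - g y\<bar> < e"
proof -
  obtain R where R: "K \<subseteq> ball 0 R"
    using bounded_subset_ballD[OF compact_imp_bounded[OF K]] by metis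
  have "uniformly_continuous_on (cball 0 (R + 1)) g"
    by (intro compact_uniformly_continuous continuous_on_subset[OF g]) auto
  then obtain r where r: "r > 0" and
    u: "\<And>x y. x \<in> cball 0 (R + 1) \<Longrightarrow> y \<in> cball 0 (R + 1) \<Longrightarrow> dist x y < r \<Longrightarrow> \<bar>g x - g y\<bar> < e"
    unfolding uniformly_continuous_on_def using e by (metis dist_real_def dist_commute)
  have "\<bar>g x - g y\<bar> < e" if d: "dist x y < min r 1" for x y
  proof (cases "x \<in> cball 0 (R + 1) \<and> y \<in> cball 0 (R + 1)")
    case True
    then show ?thesis using u d by auto
  next
    case False
    \<comment> \<open>If one of the points lies outside the ball of radius R + 1 and the distance is
      below 1, both lie outside the ball of radius R, where \<open>g\<close> vanishes.\<close>
    have "norm x \<le> norm y + dist x y" "norm y \<le> norm x + dist x y"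
      by (metis add.commute dist_norm norm_triangle_sub) (metis add.commute dist_norm dist_commute norm_triangle_sub)
    then have "x \<notin> ball 0 R \<and> y \<notin> ball 0 R" using False d by auto
    then have "g x = 0" "g y = 0" using R g0 by blast+
    then show ?thesis using e by simp
  qed
  then show ?thesis using r by (intro exI[of _ "min r 1"]) auto
qed

text \<open>Mollification with exchanged roles: \<open>g\<close> is the weight and the bump is the
  function that gets differentiated, so \<open>smooth_pconv\<close> applies although
  \<open>g\<close> is only continuous.\<close>

lemma smooth_approximation:
  fixes g :: "real^'n \<Rightarrow> real"
  assumes g: "continuous_on UNIV g" and K: "compact K" and g0: "\<And>x. x \<notin> K \<Longrightarrow> g x = 0" and e: "e > 0"
  shows "\<exists>f. smooth f \<and> (\<forall>x. f x \<noteq> 0 \<longrightarrow> (\<exists>y\<in>K. dist x y \<le> e)) \<and> (\<forall>x. \<bar>f x - g x\<bar> \<le> e)"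
proof -
  obtain r where r: "r > 0" and u: "\<And>x y. dist x y < r \<Longrightarrow> \<bar>g x - g y\<bar> < e"
    using uniform_continuity_compact_support[OF assms] by blast
  \<comment> \<open>The bound by \<open>e\<close> keeps the new support within distance
    \<open>e\<close> of \<open>K\<close>; being below \<open>r\<close> is what uniform continuity
    needs.\<close>
  define s where "s = min e (r / 2)"
  have s: "s > 0" "s \<le> e" "s < r" using e r by (auto simp: s_def)
  obtain \<eta> :: "real^'n \<Rightarrow> real" where \<eta>: "smooth \<eta>" "\<And>x. 0 \<le> \<eta> x" "\<And>x. \<eta> x \<noteq> 0 \<Longrightarrow> norm x \<le> s"
      "integrable lborel \<eta>" "integral\<^sup>L lborel \<eta> = 1"
    using exists_bump[OF s(1)] by blast
  obtain a b where ab: "K \<subseteq> cbox a b"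
    using K compact_imp_bounded bounded_subset_cbox_symmetric by metis
  define f where "f = pconv a b g (\<lambda>y. y) \<eta>"
  have cont: "continuous_on UNIV (\<lambda>y. g y * \<eta> (x - y))" for x
    by (intro continuous_intros g continuous_on_compose2[OF smooth_continuous[OF \<eta>(1)]]) auto
  have sm: "smooth f" unfolding f_def
    by (intro smooth_pconv \<eta> continuous_intros continuous_on_subset[OF g]) auto
  have int\<eta>: "integrable lborel (\<lambda>y. \<eta> (x - y))" and one: "(\<integral>y. \<eta> (x - y) \<partial>lborel) = 1" for x
    using \<eta>(4,5) integrable_distr[of "\<lambda>y. x - y" lborel borel \<eta>] integral_distr[of "\<lambda>y. x - y" lborel borel \<eta>]
    by (auto simp: lborel_reflect)
  have eq: "(\<lambda>y. indicator (cbox a b) y *\<^sub>R (g y * \<eta> (x - y))) = (\<lambda>y. g y * \<eta> (x - y))" for x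
    using g0 ab by (fastforce simp: indicator_def fun_eq_iff)
  have intg: "integrable lborel (\<lambda>y. g y * \<eta> (x - y))" for x
    using borel_integrable_compact[OF compact_cbox continuous_on_subset[OF cont subset_UNIV], of a b x]
    unfolding eq .
  have f_eq: "f x = (\<integral>y. g y * \<eta> (x - y) \<partial>lborel)" for x
  proof -
    have "set_lebesgue_integral lborel (cbox a b) (\<lambda>y. g y * \<eta> (x - y)) = integral (cbox a b) (\<lambda>y. g y * \<eta> (x - y))"
      by (intro set_borel_integral_eq_integral) (unfold set_integrable_def eq, rule intg)
    then show ?thesis by (simp only: f_def pconv_def set_lebesgue_integral_def eq)
  qed
  have "\<bar>f x - g x\<bar> \<le> e" for x
  proof -
    have "f x - g x = (\<integral>y. g y * \<eta> (x - y) \<partial>lborel) - (\<integral>y. g x * \<eta> (x - y) \<partial>lborel)"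
      using f_eq one by simp
    also have "\<dots> = (\<integral>y. (g y - g x) * \<eta> (x - y) \<partial>lborel)"
      by (subst Bochner_Integration.integral_diff[symmetric]) (auto intro!: intg int\<eta> simp: algebra_simps)
    also have "\<bar>\<dots>\<bar> \<le> (\<integral>y. e * \<eta> (x - y) \<partial>lborel)"
    proof (rule integral_abs_bound_integral)
      show "integrable lborel (\<lambda>y. (g y - g x) * \<eta> (x - y))"
        using Bochner_Integration.integrable_diff[OF intg[of x] integrable_mult_right[OF int\<eta>[of x], of "g x"]]
        by (simp add: algebra_simps)
      show "\<bar>(g y - g x) * \<eta> (x - y)\<bar> \<le> e * \<eta> (x - y)" for y
      proof (cases "\<eta> (x - y) = 0")
        case False
        then have "dist y x < r" using \<eta>(3) s(3) by (fastforce simp: dist_norm norm_minus_commute)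
        then have "\<bar>g y - g x\<bar> \<le> e" using u by (meson less_imp_le)
        then show ?thesis using \<eta>(2) by (simp add: abs_mult mult_right_mono)
      qed simp
    qed (intro integrable_mult_right int\<eta>)
    also have "\<dots> = e" using one by simp
    finally show ?thesis .
  qed
  moreover have "\<exists>y\<in>K. dist x y \<le> e" if "f x \<noteq> 0" for x
  proof (rule ccontr)
    assume "\<not> ?thesis"
    then have "g y * \<eta> (x - y) = 0" for y
      using g0[of y] \<eta>(3)[of "x - y"] s(2) by (cases "y \<in> K") (auto simp: dist_norm)
    then have "(\<lambda>y. g y * \<eta> (x - y)) = (\<lambda>_. 0)" by blast
    then have "f x = 0" using f_eq[of x] by simp
    then show False using that by simp
  qed
  ultimately show ?thesis using sm by blast
qed

section \<open>Translations and weak gradients\<close>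

text \<open>\<open>K\<close> is any compact set off which \<open>g\<close> vanishes, not the exact
  support, so that products and derivatives can keep the same \<open>K\<close>.\<close>

definition csupp :: "'a::euclidean_space set \<Rightarrow> ('a \<Rightarrow> real) \<Rightarrow> bool" where
  "csupp K g \<longleftrightarrow> compact K \<and> continuous_on UNIV g \<and> (\<forall>x. x \<notin> K \<longrightarrow> g x = 0)"

lemma csupp_bounded:
  assumes "csupp K g"
  shows "\<exists>C>0. \<forall>x. \<bar>g x\<bar> \<le> C"
proof -
  have "compact (g ` K)"
    using assms unfolding csupp_def by (meson compact_continuous_image continuous_on_subset subset_UNIV)
  then obtain C where "C > 0" "\<forall>x\<in>g ` K. norm x \<le> C"
    using compact_imp_bounded bounded_pos by metis
  then show ?thesis
    using assms unfolding csupp_def by (metis abs_zero image_eqI less_imp_le real_norm_def)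
qed

lemma continuous_UNIV_measurable_lebesgue_on:
  fixes g :: "'a::euclidean_space \<Rightarrow> real"
  shows "continuous_on UNIV g \<Longrightarrow> g \<in> borel_measurable (lebesgue_on S)"
  by (intro measurable_restrict_space1 measurable_completion) (simp add: borel_measurable_continuous_onI)

lemma integrable_mult_bounded:
  fixes f g :: "'a \<Rightarrow> real"
  assumes f: "integrable M f" and g: "g \<in> borel_measurable M" and C: "AE x in M. \<bar>g x\<bar> \<le> C"
  shows "integrable M (\<lambda>x. f x * g x)"
proof (rule Bochner_Integration.integrable_bound)
  show "integrable M (\<lambda>x. C * f x)" using f by simp
  show "(\<lambda>x. f x * g x) \<in> borel_measurable M"
    using borel_measurable_integrable[OF f] g by simp
  show "AE x in M. norm (f x * g x) \<le> norm (C * f x)"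
    using C by (rule eventually_mono) (auto simp: abs_mult mult.commute[of C] intro!: mult_left_mono)
qed

lemma csupp_integrable:
  fixes g :: "'a::euclidean_space \<Rightarrow> real"
  assumes "csupp K g" "S \<in> sets lebesgue"
  shows "integrable (lebesgue_on S) g"
proof -
  have "integrable lborel (\<lambda>x. indicator K x *\<^sub>R g x)"
    using assms unfolding csupp_def
    by (intro borel_integrable_compact) (auto intro: continuous_on_subset)
  moreover have "(\<lambda>x. indicator K x *\<^sub>R g x) = g"
    using assms unfolding csupp_def by (auto simp: fun_eq_iff indicator_def)
  ultimately have "integrable lebesgue g"
    by (metis borel_measurable_integrable integrable_completion)
  then show ?thesis
    using integrable_mult_indicator[OF assms(2), of g] assms(2) by (subst integrable_restrict_space) simp_all
qed

lemma integrable_mult_csupp: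
  fixes g :: "'a::euclidean_space \<Rightarrow> real"
  assumes "integrable (lebesgue_on S) f" "csupp K g"
  shows "integrable (lebesgue_on S) (\<lambda>x. f x * g x)"
proof -
  obtain C where "\<forall>x. \<bar>g x\<bar> \<le> C" using csupp_bounded[OF assms(2)] by blast
  then show ?thesis
    using assms by (intro integrable_mult_bounded[where C = C] continuous_UNIV_measurable_lebesgue_on) (auto simp: csupp_def)
qed

lemma csupp_partial:
  assumes f: "smooth f" and K: "csupp K f"
  shows "csupp K (partial i f)"
proof -
  have "partial i f x = 0" if x: "x \<notin> K" for x
  proof (rule partial_eqI[where f' = "\<lambda>_. 0"])
    show "(f has_derivative (\<lambda>_. 0)) (at x)"
    proof (rule has_derivative_transform_within_open[where s = "- K" and f = "\<lambda>_. 0"])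
      show "open (- K)" using K by (simp add: csupp_def compact_imp_closed open_Compl)
      show "x \<in> - K" using x by simp
      show "0 = f y" if "y \<in> - K" for y using that K by (simp add: csupp_def)
    qed (rule has_derivative_const)
  qed
  then show ?thesis
    using K smooth_continuous[OF smooth_partial[OF f]] unfolding csupp_def by blast
qed

lemma csupp_test_fun:
  assumes "test_fun \<Omega> \<phi>"
  shows "csupp (closure {x. \<phi> x \<noteq> 0}) \<phi>"
proof -
  have "\<phi> x = 0" if "x \<notin> closure {x. \<phi> x \<noteq> 0}" for x
    using that closure_subset[of "{x. \<phi> x \<noteq> 0}"] by auto
  then show ?thesis
    using assms smooth_continuous unfolding csupp_def test_fun_def by blast
qed

text \<open>The continuous function \<open>g\<close> is averaged over the segment from \<open>x - z\<close> to \<open>x\<close>, so that the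
  directional derivative of the average along \<open>z\<close> is \<open>g x - g (x - z)\<close>.\<close>
definition segment_avg :: "'a::euclidean_space \<Rightarrow> ('a \<Rightarrow> real) \<Rightarrow> 'a \<Rightarrow> real" where
  "segment_avg z g x = integral {0..1} (\<lambda>s. g (x - s *\<^sub>R z))"

text \<open>This set carries the segment average of a function that vanishes off \<open>K\<close>.
  The recurring condition \<open>sweep z K \<subseteq> \<Omega>\<close> says that \<open>K\<close>
  stays in the domain during the whole translation by \<open>z\<close>, not only at its end.\<close>

definition sweep :: "'a::euclidean_space \<Rightarrow> 'a set \<Rightarrow> 'a set" where
  "sweep z K = (\<lambda>(x, s). x + s *\<^sub>R z) ` (K \<times> {0..1})"

lemma compact_sweep: "compact K \<Longrightarrow> compact (sweep z K)"
  unfolding sweep_def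
  by (intro compact_continuous_image compact_Times) (auto simp: split_beta intro!: continuous_intros)

lemma subset_sweep: "K \<subseteq> sweep z K" "(\<lambda>x. x + z) ` K \<subseteq> sweep z K"
proof -
  have "x + s *\<^sub>R z \<in> sweep z K" if "x \<in> K" "s \<in> {0..1}" for x s
    using imageI[of "(x, s)" "K \<times> {0..1}" "\<lambda>(x, s). x + s *\<^sub>R z"] that by (simp add: sweep_def)
  from this[of _ 0] this[of _ 1] show "K \<subseteq> sweep z K" "(\<lambda>x. x + z) ` K \<subseteq> sweep z K"
    by auto
qed

lemma csupp_segment_avg:
  assumes "csupp K g"
  shows "csupp (sweep z K) (segment_avg z g)"
proof -
  have g: "continuous_on UNIV g" using assms by (simp add: csupp_def)
  have "continuous_on UNIV (segment_avg z g)"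
    unfolding segment_avg_def[abs_def] interval_cbox
    by (intro integral_continuous_on_param)
      (auto simp: split_beta intro!: continuous_intros continuous_on_compose2[OF g])
  moreover have "segment_avg z g x = 0" if "x \<notin> sweep z K" for x
  proof -
    have "g (x - s *\<^sub>R z) = 0" if "s \<in> {0..1}" for s
    proof -
      have "x - s *\<^sub>R z \<notin> K"
      proof
        assume "x - s *\<^sub>R z \<in> K"
        then have "(\<lambda>(x, s). x + s *\<^sub>R z) (x - s *\<^sub>R z, s) \<in> sweep z K"
          unfolding sweep_def using that by blast
        then show False using \<open>x \<notin> sweep z K\<close> by simp
      qed
      then show ?thesis using assms by (simp add: csupp_def)
    qed
    then show ?thesis unfolding segment_avg_def by (subst Henstock_Kurzweil_Integration.integral_cong[where g = "\<lambda>_. 0"]) auto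
  qed
  ultimately show ?thesis
    using assms compact_sweep by (auto simp: csupp_def)
qed

text \<open>Two functions and two base points are allowed, so that the same estimate serves for
  uniform approximation, for convergence as \<open>z\<close> shrinks and, with one function zero,
  for plain bounds.\<close>

lemma segment_avg_diff_bound:
  assumes "continuous_on UNIV f" "continuous_on UNIV g" "\<And>s. s \<in> {0..1} \<Longrightarrow> \<bar>f (x - s *\<^sub>R z) - g (y - s *\<^sub>R z)\<bar> \<le> e"
  shows "\<bar>segment_avg z f x - segment_avg z g y\<bar> \<le> e"
proof -
  have int: "(\<lambda>s. h (x - s *\<^sub>R z)) integrable_on {0..1::real}" if "continuous_on UNIV h" for h :: "'a \<Rightarrow> real" and x
    by (intro integrable_continuous_real continuous_on_compose2[OF that]) (auto intro!: continuous_intros)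
  have "segment_avg z f x - segment_avg z g y = integral {0..1} (\<lambda>s. f (x - s *\<^sub>R z) - g (y - s *\<^sub>R z))"
    unfolding segment_avg_def by (intro integral_diff[symmetric] int assms)
  also have "norm \<dots> \<le> integral {0..1::real} (\<lambda>_. e)"
    by (intro integral_norm_bound_integral integrable_diff int assms) (use assms(3) in auto)
  finally show ?thesis by simp
qed

lemma segment_avg_bound:
  assumes "continuous_on UNIV g" "\<And>x. \<bar>g x\<bar> \<le> M"
  shows "\<bar>segment_avg z g x\<bar> \<le> M"
  using segment_avg_diff_bound[OF assms(1) continuous_on_const[of _ 0], where x = x and y = x and z = z and e = M] assms(2)
  by (simp add: segment_avg_def[of z "\<lambda>_. 0"])

text \<open>The map s to \<open>- f (x - s *\<^sub>R z)\<close> has the derivative of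
  \<open>f\<close> along \<open>z\<close> as its derivative, so integration over [0, 1] leaves the
  difference of end values. It is stated with the partials outside and inside the average: the first
  form is paired with a weak gradient, the second passes to the limit as \<open>z\<close> tends to
  0.\<close>

lemma smooth_segment_avg:
  fixes f :: "real^'n \<Rightarrow> real"
  assumes f: "smooth f"
  shows "smooth (segment_avg z f)"
    and "(\<Sum>i\<in>UNIV. z $ i * partial i (segment_avg z f) x) = f x - f (x - z)"
    and "(\<Sum>i\<in>UNIV. z $ i * segment_avg z (partial i f) x) = f x - f (x - z)"
proof -
  have eq: "segment_avg z \<psi> = pconv 0 1 (\<lambda>_. 1) (\<lambda>s. s *\<^sub>R z) \<psi>" for \<psi> :: "real^'n \<Rightarrow> real"
    by (simp add: fun_eq_iff segment_avg_def pconv_def)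
  show "smooth (segment_avg z f)"
    unfolding eq by (intro smooth_pconv f continuous_intros)
  have part: "partial i (segment_avg z f) x = segment_avg z (partial i f) x" for i
    unfolding eq by (subst partial_pconv[OF f]) (auto intro!: continuous_intros)
  have cp: "continuous_on UNIV (partial i f)" for i
    by (intro smooth_continuous smooth_partial f)
  have int: "(\<lambda>s. partial i f (x - s *\<^sub>R z)) integrable_on {0..1::real}" for i
    by (intro integrable_continuous_real continuous_on_compose2[OF cp]) (auto intro!: continuous_intros)
  have "((\<lambda>s. - f (x - s *\<^sub>R z)) has_vector_derivative (\<Sum>i\<in>UNIV. z $ i * partial i f (x - s *\<^sub>R z))) (at s within {0..1})" for s
  proof -
    have "((\<lambda>s. x - s *\<^sub>R z) has_derivative (\<lambda>h. - (h *\<^sub>R z))) (at s within {0..1})"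
      by (auto intro!: derivative_eq_intros)
    from has_derivative_minus[OF has_derivative_compose[OF this has_derivative_partial[OF f]]]
    show ?thesis
      unfolding has_vector_derivative_def
      by (rule has_derivative_eq_rhs) (simp add: fun_eq_iff sum_distrib_left sum_negf mult_ac)
  qed
  then have "((\<lambda>s. \<Sum>i\<in>UNIV. z $ i * partial i f (x - s *\<^sub>R z)) has_integral (- f (x - 1 *\<^sub>R z) - - f (x - 0 *\<^sub>R z))) {0..1}"
    by (intro fundamental_theorem_of_calculus) auto
  then have "integral {0..1} (\<lambda>s. \<Sum>i\<in>UNIV. z $ i * partial i f (x - s *\<^sub>R z)) = f x - f (x - z)"
    by (simp add: integral_unique)
  moreover have "integral {0..1} (\<lambda>s. \<Sum>i\<in>UNIV. z $ i * partial i f (x - s *\<^sub>R z)) = (\<Sum>i\<in>UNIV. z $ i * segment_avg z (partial i f) x)"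
    unfolding segment_avg_def
    by (subst integral_sum) (auto intro!: integrable_on_mult_right int)
  ultimately show "(\<Sum>i\<in>UNIV. z $ i * segment_avg z (partial i f) x) = f x - f (x - z)"
    by simp
  then show "(\<Sum>i\<in>UNIV. z $ i * partial i (segment_avg z f) x) = f x - f (x - z)"
    by (simp add: part)
qed

text \<open>The setting is L^1: the translation estimates see only the total mass of the gradient.
  Functions of H^1 on a bounded domain enter through \<open>L2_integrable\<close>.\<close>

locale weak_diff =
  fixes \<Omega> :: "(real^'n) set" and w :: "real^'n \<Rightarrow> real" and G :: "real^'n \<Rightarrow> real^'n"
  assumes open_\<Omega>: "open \<Omega>"
    and int_w: "integrable (lebesgue_on \<Omega>) w"
    and int_G: "\<And>i. integrable (lebesgue_on \<Omega>) (\<lambda>x. G x $ i)"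
    and wg: "weak_grad \<Omega> w G"
begin

lemma \<Omega>_sets: "\<Omega> \<in> sets lebesgue" "\<Omega> \<inter> space lebesgue \<in> sets lebesgue"
  using open_\<Omega> by auto

text \<open>The segment average of \<open>f\<close> is a test function whose derivative along
  \<open>z\<close> is \<open>f x - f (x - z)\<close>; this is inserted into the definition of the
  weak gradient.\<close>

lemma translate_smooth:
  assumes f: "smooth f" "csupp K f" and K: "sweep z K \<subseteq> \<Omega>"
  shows "(\<integral>x. w x * (f (x - z) - f x) \<partial>lebesgue_on \<Omega>) = (\<Sum>i\<in>UNIV. z $ i * (\<integral>x. G x $ i * segment_avg z f x \<partial>lebesgue_on \<Omega>))"
proof -
  let ?\<Phi> = "segment_avg z f"
  have cs: "csupp (sweep z K) ?\<Phi>" by (rule csupp_segment_avg[OF f(2)])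
  have sm: "smooth ?\<Phi>" by (rule smooth_segment_avg[OF f(1)])
  have tf: "test_fun \<Omega> ?\<Phi>"
    using cs K sm by (auto simp: csupp_def intro: test_funI)
  note int = integrable_mult_csupp[OF int_w csupp_partial[OF sm cs]]
  have "(\<integral>x. w x * (f (x - z) - f x) \<partial>lebesgue_on \<Omega>) =
      (\<integral>x. (\<Sum>i\<in>UNIV. - z $ i * (w x * partial i ?\<Phi> x)) \<partial>lebesgue_on \<Omega>)"
  proof (rule Bochner_Integration.integral_cong[OF refl])
    fix x
    have "w x * (f (x - z) - f x) = - w x * (\<Sum>i\<in>UNIV. z $ i * partial i ?\<Phi> x)"
      unfolding smooth_segment_avg(2)[OF f(1)] by (simp add: algebra_simps)
    then show "w x * (f (x - z) - f x) = (\<Sum>i\<in>UNIV. - z $ i * (w x * partial i ?\<Phi> x))"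
      by (simp add: sum_distrib_left sum_negf mult_ac)
  qed
  also have "\<dots> = (\<Sum>i\<in>UNIV. - z $ i * (\<integral>x. w x * partial i ?\<Phi> x \<partial>lebesgue_on \<Omega>))"
    using int by (subst Bochner_Integration.integral_sum) auto
  also have "\<dots> = (\<Sum>i\<in>UNIV. z $ i * (\<integral>x. G x $ i * ?\<Phi> x \<partial>lebesgue_on \<Omega>))"
    using wg tf unfolding weak_grad_def by (intro sum.cong) auto
  finally show ?thesis .
qed

text \<open>Both sides are continuous under uniform convergence of \<open>g\<close> with supports in
  one compact set, so smooth approximations with slightly larger support carry the identity
  over.\<close>

lemma translate:
  assumes g: "csupp K g" and K: "sweep z K \<subseteq> \<Omega>"
  shows "(\<integral>x. w x * (g (x - z) - g x) \<partial>lebesgue_on \<Omega>) = (\<Sum>i\<in>UNIV. z $ i * (\<integral>x. G x $ i * segment_avg z g x \<partial>lebesgue_on \<Omega>))"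
proof -
  have cK: "compact K" and cg: "continuous_on UNIV g" and g0: "\<And>x. x \<notin> K \<Longrightarrow> g x = 0"
    using g by (auto simp: csupp_def)
  obtain e0 where e0: "e0 > 0" "(\<Union>x\<in>sweep z K. cball x e0) \<subseteq> \<Omega>"
    using compact_subset_open_imp_cball_epsilon_subset[OF compact_sweep[OF cK] open_\<Omega> K] by blast
  \<comment> \<open>The three bounds have separate uses: \<open>e0\<close> keeps the swept supports
    inside the domain, 1 gives the common bound \<open>M + 1\<close> for dominated convergence, and
    the last one tends to 0.\<close>
  define e where "e n = min (min e0 1) (inverse (real (Suc n)))" for n
  have e: "e n > 0" "e n \<le> e0" "e n \<le> inverse (real (Suc n))" "e n \<le> 1" for n using e0 by (auto simp: e_def)
  have e_lim: "e \<longlonglongrightarrow> 0"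
    by (rule tendsto_sandwich[OF always_eventually always_eventually tendsto_const LIMSEQ_inverse_real_of_nat])
      (simp_all only: e less_imp_le simp_thms)
  have "\<forall>n. \<exists>f. smooth f \<and> (\<forall>x. f x \<noteq> 0 \<longrightarrow> (\<exists>y\<in>K. dist x y \<le> e n)) \<and> (\<forall>x. \<bar>f x - g x\<bar> \<le> e n)"
    by (intro allI smooth_approximation[OF cg cK g0 e(1)])
  from choice[OF this] obtain f where f: "\<And>n. smooth (f n)" "\<And>n x. f n x \<noteq> 0 \<Longrightarrow> \<exists>y\<in>K. dist x y \<le> e n" "\<And>n x. \<bar>f n x - g x\<bar> \<le> e n"
    by blast
  \<comment> \<open>The closed neighbourhood of \<open>K\<close> of radius \<open>e0\<close>
    contains all the approximating supports, and its sweep is the same neighbourhood of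
    \<open>sweep z K\<close>.\<close>
  define K' where "K' = (\<lambda>(x, y). x + y) ` (K \<times> cball 0 e0)"
  have cK': "compact K'" unfolding K'_def
    by (intro compact_continuous_image compact_Times cK) (auto simp: split_beta intro!: continuous_intros)
  have K': "sweep z K' \<subseteq> \<Omega>"
  proof
    fix p assume "p \<in> sweep z K'"
    then obtain x y s where "x \<in> K" "norm y \<le> e0" "s \<in> {0..1}" "p = (x + s *\<^sub>R z) + y"
      unfolding sweep_def K'_def by (auto simp: algebra_simps)
    moreover from this have "x + s *\<^sub>R z \<in> sweep z K" unfolding sweep_def by force
    ultimately show "p \<in> \<Omega>" using e0(2) by (force simp: dist_norm)
  qed
  have csf: "csupp K' (f n)" for n
  proof -
    have "f n x = 0" if "x \<notin> K'" for x
    proof (rule ccontr)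
      assume "f n x \<noteq> 0"
      then obtain y where "y \<in> K" "dist x y \<le> e0" using f(2) e(2) by (meson order_trans)
      then have "(\<lambda>(x, y). x + y) (y, x - y) \<in> K'" unfolding K'_def
        by (intro imageI) (auto simp: dist_norm norm_minus_commute)
      then show False using that by simp
    qed
    then show ?thesis using cK' smooth_continuous[OF f(1), of n] unfolding csupp_def by blast
  qed
  obtain M where M: "\<And>x. \<bar>g x\<bar> \<le> M" using csupp_bounded[OF g] by metis
  have fM: "\<bar>f n x\<bar> \<le> M + 1" for n x using f(3)[of n x] M[of x] e(4)[of n] by linarith
  have cf: "continuous_on UNIV (f n)" for n by (rule smooth_continuous[OF f(1)])
  have de: "dist (e n) 0 = e n" for n using e(1)[of n] by simp
  have lim: "(\<lambda>n. f n x) \<longlonglongrightarrow> g x" for x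
    by (rule metric_tendsto_imp_tendsto[OF e_lim], rule always_eventually) (simp only: de, simp add: dist_real_def f(3))
  have lim2: "(\<lambda>n. segment_avg z (f n) x) \<longlonglongrightarrow> segment_avg z g x" for x
  proof (rule metric_tendsto_imp_tendsto[OF e_lim], rule always_eventually, rule allI)
    fix n
    have "\<bar>segment_avg z (f n) x - segment_avg z g x\<bar> \<le> e n"
      by (rule segment_avg_diff_bound[OF cf cg f(3)])
    then show "dist (segment_avg z (f n) x) (segment_avg z g x) \<le> dist (e n) 0"
      by (simp only: de dist_real_def)
  qed
  have shift: "continuous_on UNIV (\<lambda>x. h (x - z) - h x)" if "continuous_on UNIV h" for h :: "real^'n \<Rightarrow> real"
    by (intro continuous_intros that continuous_on_compose2[OF that]) auto
  have meas_w: "w \<in> borel_measurable (lebesgue_on \<Omega>)" and meas_G: "(\<lambda>x. G x $ i) \<in> borel_measurable (lebesgue_on \<Omega>)" for i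
    by (intro borel_measurable_integrable int_w int_G)+
  have "(\<lambda>n. \<integral>x. w x * (f n (x - z) - f n x) \<partial>lebesgue_on \<Omega>) \<longlonglongrightarrow> (\<integral>x. w x * (g (x - z) - g x) \<partial>lebesgue_on \<Omega>)"
  proof (rule integral_dominated_convergence[where w = "\<lambda>x. \<bar>w x\<bar> * ((M + 1) + (M + 1))"])
    show "AE x in lebesgue_on \<Omega>. norm (w x * (f n (x - z) - f n x)) \<le> \<bar>w x\<bar> * ((M + 1) + (M + 1))" for n
    proof (intro always_eventually allI)
      fix x
      have "\<bar>f n (x - z) - f n x\<bar> \<le> (M + 1) + (M + 1)"
        by (rule order_trans[OF abs_triangle_ineq4]) (intro add_mono fM)
      then show "norm (w x * (f n (x - z) - f n x)) \<le> \<bar>w x\<bar> * ((M + 1) + (M + 1))"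
        by (simp add: abs_mult mult_left_mono)
    qed
    show "integrable (lebesgue_on \<Omega>) (\<lambda>x. \<bar>w x\<bar> * ((M + 1) + (M + 1)))"
      by (intro integrable_mult_left integrable_abs int_w)
    show "AE x in lebesgue_on \<Omega>. (\<lambda>n. w x * (f n (x - z) - f n x)) \<longlonglongrightarrow> w x * (g (x - z) - g x)"
      by (intro always_eventually allI tendsto_mult tendsto_diff tendsto_const lim)
  qed (intro borel_measurable_times meas_w continuous_UNIV_measurable_lebesgue_on shift cf cg)+
  moreover have "(\<lambda>n. \<integral>x. G x $ i * segment_avg z (f n) x \<partial>lebesgue_on \<Omega>) \<longlonglongrightarrow> (\<integral>x. G x $ i * segment_avg z g x \<partial>lebesgue_on \<Omega>)" for i
  proof (rule integral_dominated_convergence[where w = "\<lambda>x. \<bar>G x $ i\<bar> * (M + 1)"])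
    have c: "continuous_on UNIV (segment_avg z (f n))" "continuous_on UNIV (segment_avg z g)" for n
      using csupp_segment_avg[OF csf] csupp_segment_avg[OF g] unfolding csupp_def by blast+
    show "(\<lambda>x. G x $ i * segment_avg z g x) \<in> borel_measurable (lebesgue_on \<Omega>)"
      "\<And>n. (\<lambda>x. G x $ i * segment_avg z (f n) x) \<in> borel_measurable (lebesgue_on \<Omega>)"
      by (intro borel_measurable_times meas_G continuous_UNIV_measurable_lebesgue_on c)+
    show "AE x in lebesgue_on \<Omega>. norm (G x $ i * segment_avg z (f n) x) \<le> \<bar>G x $ i\<bar> * (M + 1)" for n
      by (intro always_eventually allI) (simp add: abs_mult mult_left_mono segment_avg_bound[OF cf fM])
    show "integrable (lebesgue_on \<Omega>) (\<lambda>x. \<bar>G x $ i\<bar> * (M + 1))"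
      by (intro integrable_mult_left integrable_abs int_G)
    show "AE x in lebesgue_on \<Omega>. (\<lambda>n. G x $ i * segment_avg z (f n) x) \<longlonglongrightarrow> G x $ i * segment_avg z g x"
      by (intro always_eventually allI tendsto_mult tendsto_const lim2)
  qed
  then have "(\<lambda>n. \<Sum>i\<in>UNIV. z $ i * (\<integral>x. G x $ i * segment_avg z (f n) x \<partial>lebesgue_on \<Omega>)) \<longlonglongrightarrow>
     (\<Sum>i\<in>UNIV. z $ i * (\<integral>x. G x $ i * segment_avg z g x \<partial>lebesgue_on \<Omega>))"
    by (intro tendsto_intros)
  ultimately show ?thesis
    unfolding translate_smooth[OF f(1) csf K'] by (rule LIMSEQ_unique)
qed

end

text \<open>Off \<open>U\<close> the function \<open>h\<close> may be arbitrary: the product is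
  continuous on \<open>U\<close> and zero on the open complement of \<open>K\<close>, and these two
  open sets cover the space.\<close>

lemma csupp_mult:
  fixes h :: "'a::euclidean_space \<Rightarrow> real"
  assumes \<phi>: "csupp K \<phi>" and U: "open U" "K \<subseteq> U" and h: "continuous_on U h"
  shows "csupp K (\<lambda>x. \<phi> x * h x)"
proof -
  have "continuous_on U (\<lambda>x. \<phi> x * h x)"
    using \<phi> unfolding csupp_def by (intro continuous_on_mult h) (auto intro: continuous_on_subset)
  moreover have "continuous_on (- K) (\<lambda>x. \<phi> x * h x)"
    using \<phi> unfolding csupp_def by (subst continuous_on_cong[OF refl, of _ _ "\<lambda>_. 0"]) auto
  moreover have "open (- K)" using \<phi> unfolding csupp_def by (auto simp: compact_imp_closed)
  ultimately have "continuous_on (U \<union> - K) (\<lambda>x. \<phi> x * h x)"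
    using U by (intro continuous_on_open_Un)
  moreover have "U \<union> - K = UNIV" using U by auto
  ultimately show ?thesis using \<phi> by (auto simp: csupp_def)
qed

text \<open>This covers every integrand below that is built from \<open>w (x + z)\<close> and
  \<open>w x\<close>. Both are continuous near \<open>K\<close>, because the sweep contains
  \<open>K\<close> and its translate.\<close>

lemma csupp_mult_diff:
  fixes w :: "'a::euclidean_space \<Rightarrow> real"
  assumes \<phi>: "csupp K \<phi>" and \<Omega>: "open \<Omega>" "sweep z K \<subseteq> \<Omega>" and w: "continuous_on \<Omega> w"
    and h: "continuous_on UNIV (\<lambda>p. h (fst p) (snd p))"
  shows "csupp K (\<lambda>x. \<phi> x * h (w (x + z)) (w x))"
proof (rule csupp_mult[OF \<phi>])
  let ?U = "\<Omega> \<inter> (\<lambda>x. x + z) -` \<Omega>"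
  have "open ((\<lambda>x. x + z) -` \<Omega>)"
    by (rule open_vimage[OF \<Omega>(1)]) (auto intro!: continuous_intros)
  then show "open ?U" using \<Omega>(1) by (rule open_Int[rotated])
  show "K \<subseteq> ?U" using subset_sweep[where K = K and z = z] \<Omega>(2) by blast
  have "continuous_on ?U (\<lambda>x. w (x + z))"
    by (rule continuous_on_compose2[OF w]) (auto intro!: continuous_intros)
  moreover have "continuous_on ?U w" by (rule continuous_on_subset[OF w]) auto
  ultimately have "continuous_on ?U (\<lambda>x. (w (x + z), w x))"
    by (rule continuous_on_Pair)
  from continuous_on_compose2[OF h this] show "continuous_on ?U (\<lambda>x. h (w (x + z)) (w x))"
    by simp
qed

lemma tendsto_integral_segment_avg:
  fixes g :: "'a::euclidean_space \<Rightarrow> real"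
  assumes h: "integrable (lebesgue_on S) h" and g: "csupp K g" and z: "z \<longlonglongrightarrow> 0"
  shows "(\<lambda>n. \<integral>x. h x * segment_avg (z n) g x \<partial>lebesgue_on S) \<longlonglongrightarrow> (\<integral>x. h x * g x \<partial>lebesgue_on S)"
proof -
  have cg: "continuous_on UNIV g" using g by (simp add: csupp_def)
  obtain M where M: "\<And>x. \<bar>g x\<bar> \<le> M" using csupp_bounded[OF g] by metis
  have lim: "(\<lambda>n. segment_avg (z n) g x) \<longlonglongrightarrow> g x" for x
  proof (rule tendstoI)
    fix e :: real assume "e > 0"
    then have "e / 2 > 0" by simp
    moreover have "continuous (at x) g" using cg by (simp add: continuous_on_eq_continuous_at)
    ultimately obtain r where r: "r > 0" "\<And>y. dist y x < r \<Longrightarrow> \<bar>g y - g x\<bar> < e / 2"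
      unfolding continuous_at_eps_delta dist_real_def by metis
    have "\<forall>\<^sub>F n in sequentially. norm (z n) < r"
      using tendstoD[OF z r(1)] by simp
    then show "\<forall>\<^sub>F n in sequentially. dist (segment_avg (z n) g x) (g x) < e"
    proof (rule eventually_mono)
      fix n assume n: "norm (z n) < r"
      have "\<bar>segment_avg (z n) g x - segment_avg (z n) (\<lambda>_. g x) x\<bar> \<le> e / 2"
      proof (rule segment_avg_diff_bound[OF cg continuous_on_const])
        fix s :: real assume s: "s \<in> {0..1}"
        have "norm (s *\<^sub>R z n) \<le> 1 * norm (z n)" unfolding norm_scaleR by (intro mult_right_mono) (use s in auto)
        then have "dist (x - s *\<^sub>R z n) x < r" using n by (simp add: dist_norm)
        from r(2)[OF this] show "\<bar>g (x - s *\<^sub>R z n) - g x\<bar> \<le> e / 2" by simp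
      qed
      moreover have "segment_avg (z n) (\<lambda>_. g x) x = g x" by (simp add: segment_avg_def)
      ultimately show "dist (segment_avg (z n) g x) (g x) < e" using \<open>e > 0\<close> by (simp add: dist_real_def)
    qed
  qed
  have c: "continuous_on UNIV (segment_avg (z n) g)" for n
    using csupp_segment_avg[OF g] unfolding csupp_def by blast
  show ?thesis
  proof (rule integral_dominated_convergence[where w = "\<lambda>x. \<bar>h x\<bar> * M"])
    show "integrable (lebesgue_on S) (\<lambda>x. \<bar>h x\<bar> * M)"
      by (intro integrable_mult_left integrable_abs h)
    show "AE x in lebesgue_on S. (\<lambda>n. h x * segment_avg (z n) g x) \<longlonglongrightarrow> h x * g x"
      by (intro always_eventually allI tendsto_mult tendsto_const lim)
    show "AE x in lebesgue_on S. norm (h x * segment_avg (z n) g x) \<le> \<bar>h x\<bar> * M" for n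
      by (intro always_eventually allI) (simp add: abs_mult mult_left_mono segment_avg_bound[OF cg M])
  qed (intro borel_measurable_times borel_measurable_integrable[OF h] continuous_UNIV_measurable_lebesgue_on c cg)+
qed

text \<open>A change of variables on the whole space after extending \<open>w\<close> by zero. As
  \<open>K\<close> and its translate both lie in the domain, \<open>g\<close> never meets the
  extended values.\<close>

lemma integral_translate_csupp:
  fixes w :: "'a::euclidean_space \<Rightarrow> real"
  assumes \<Omega>: "\<Omega> \<in> sets lebesgue" and w: "integrable (lebesgue_on \<Omega>) w"
    and g: "csupp K g" and K: "K \<subseteq> \<Omega>" "(\<lambda>x. x + z) ` K \<subseteq> \<Omega>"
  shows "integrable (lebesgue_on \<Omega>) (\<lambda>x. g x * w (x + z))"
    and "(\<integral>x. w x * g (x - z) \<partial>lebesgue_on \<Omega>) = (\<integral>x. g x * w (x + z) \<partial>lebesgue_on \<Omega>)"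
proof -
  let ?F = "\<lambda>x. if x \<in> \<Omega> then w x * g (x - z) else 0"
  have g': "csupp ((\<lambda>x. x + z) ` K) (\<lambda>x. g (x - z))"
  proof -
    have cg: "continuous_on UNIV g" using g by (simp add: csupp_def)
    have "g (x - z) = 0" if "x \<notin> (\<lambda>x. x + z) ` K" for x
    proof -
      have "x - z \<notin> K" using that by (metis diff_add_cancel image_eqI)
      then show ?thesis using g by (simp add: csupp_def)
    qed
    moreover have "compact ((\<lambda>x. x + z) ` K)"
      using g unfolding csupp_def by (intro compact_continuous_image) (auto intro!: continuous_intros)
    moreover have "continuous_on UNIV (\<lambda>x. g (x - z))"
      by (rule continuous_on_compose2[OF cg]) (auto intro!: continuous_intros)
    ultimately show ?thesis by (simp add: csupp_def)
  qed
  have F: "integrable lebesgue ?F"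
    unfolding Lebesgue_Measure.integrable_restrict_UNIV[OF \<Omega>] by (rule integrable_mult_csupp[OF w g'])
  have eq: "(\<lambda>x. ?F (z + x)) = (\<lambda>x. if x \<in> \<Omega> then g x * w (x + z) else 0)"
  proof
    fix x
    show "?F (z + x) = (if x \<in> \<Omega> then g x * w (x + z) else 0)"
    proof (cases "x \<in> K")
      case True
      then show ?thesis using K by (auto simp: add.commute)
    next
      case False
      then show ?thesis using g by (simp add: csupp_def)
    qed
  qed
  from integrable_lebesgue_translate[OF F, of z]
  show "integrable (lebesgue_on \<Omega>) (\<lambda>x. g x * w (x + z))"
    unfolding eq Lebesgue_Measure.integrable_restrict_UNIV[OF \<Omega>] .
  show "(\<integral>x. w x * g (x - z) \<partial>lebesgue_on \<Omega>) = (\<integral>x. g x * w (x + z) \<partial>lebesgue_on \<Omega>)"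
    using integral_lebesgue_translate[OF borel_measurable_integrable[OF F], of z]
    unfolding eq Lebesgue_Measure.integral_restrict_UNIV[OF \<Omega>] by (rule sym)
qed

text \<open>This is the L^1 norm of the vector field, with the sum of absolute components as vector
  norm.\<close>

definition grad_mass :: "(real^'n) set \<Rightarrow> (real^'n \<Rightarrow> real^'n) \<Rightarrow> real" where
  "grad_mass \<Omega> G = (\<Sum>i\<in>UNIV. \<integral>x. \<bar>G x $ i\<bar> \<partial>lebesgue_on \<Omega>)"

lemma grad_mass_nonneg: "grad_mass \<Omega> G \<ge> 0"
  unfolding grad_mass_def by (intro sum_nonneg Bochner_Integration.integral_nonneg) auto

context weak_diff
begin

lemma integral_diff_translate:
  assumes g: "csupp K g" and K: "sweep z K \<subseteq> \<Omega>"
  shows "(\<integral>x. g x * (w (x + z) - w x) \<partial>lebesgue_on \<Omega>) = (\<Sum>i\<in>UNIV. z $ i * (\<integral>x. G x $ i * segment_avg z g x \<partial>lebesgue_on \<Omega>))"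
    and "integrable (lebesgue_on \<Omega>) (\<lambda>x. g x * (w (x + z) - w x))"
proof -
  have K': "K \<subseteq> \<Omega>" "(\<lambda>x. x + z) ` K \<subseteq> \<Omega>" using subset_sweep[where K = K and z = z] K by blast+
  note t = integral_translate_csupp[OF \<Omega>_sets(1) int_w g K']
  have i1: "integrable (lebesgue_on \<Omega>) (\<lambda>x. w x * g x)" by (rule integrable_mult_csupp[OF int_w g])
  then have i2: "integrable (lebesgue_on \<Omega>) (\<lambda>x. g x * w x)" by (simp add: mult.commute)
  show "integrable (lebesgue_on \<Omega>) (\<lambda>x. g x * (w (x + z) - w x))"
    unfolding right_diff_distrib by (intro Bochner_Integration.integrable_diff t(1) i2)
  have i3: "integrable (lebesgue_on \<Omega>) (\<lambda>x. w x * g (x - z))"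
  proof -
    have cg: "continuous_on UNIV g" using g by (simp add: csupp_def)
    obtain M where M: "\<And>x. \<bar>g x\<bar> \<le> M" using csupp_bounded[OF g] by metis
    show ?thesis
      by (rule integrable_mult_bounded[OF int_w, where C = M])
        (auto intro!: continuous_UNIV_measurable_lebesgue_on continuous_on_compose2[OF cg] continuous_intros M)
  qed
  have "(\<integral>x. g x * (w (x + z) - w x) \<partial>lebesgue_on \<Omega>) = (\<integral>x. g x * w (x + z) \<partial>lebesgue_on \<Omega>) - (\<integral>x. g x * w x \<partial>lebesgue_on \<Omega>)"
    unfolding right_diff_distrib by (intro Bochner_Integration.integral_diff t(1) i2)
  also have "\<dots> = (\<integral>x. w x * g (x - z) \<partial>lebesgue_on \<Omega>) - (\<integral>x. w x * g x \<partial>lebesgue_on \<Omega>)"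
    by (simp add: t(2) mult.commute)
  also have "\<dots> = (\<integral>x. w x * (g (x - z) - g x) \<partial>lebesgue_on \<Omega>)"
    unfolding right_diff_distrib by (intro Bochner_Integration.integral_diff[symmetric] i1 i3)
  finally show "(\<integral>x. g x * (w (x + z) - w x) \<partial>lebesgue_on \<Omega>) = (\<Sum>i\<in>UNIV. z $ i * (\<integral>x. G x $ i * segment_avg z g x \<partial>lebesgue_on \<Omega>))"
    using translate[OF g K] by simp
qed

lemma abs_integral_diff_translate_le:
  assumes g: "csupp K g" and K: "sweep z K \<subseteq> \<Omega>" and M: "\<And>x. \<bar>g x\<bar> \<le> M"
  shows "\<bar>\<integral>x. g x * (w (x + z) - w x) \<partial>lebesgue_on \<Omega>\<bar> \<le> norm z * M * grad_mass \<Omega> G"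
proof -
  have cg: "continuous_on UNIV g" using g by (simp add: csupp_def)
  have "\<bar>\<integral>x. G x $ i * segment_avg z g x \<partial>lebesgue_on \<Omega>\<bar> \<le> M * (\<integral>x. \<bar>G x $ i\<bar> \<partial>lebesgue_on \<Omega>)" for i
  proof -
    have "\<bar>\<integral>x. G x $ i * segment_avg z g x \<partial>lebesgue_on \<Omega>\<bar> \<le> (\<integral>x. M * \<bar>G x $ i\<bar> \<partial>lebesgue_on \<Omega>)"
    proof (rule integral_abs_bound_integral)
      show "integrable (lebesgue_on \<Omega>) (\<lambda>x. G x $ i * segment_avg z g x)"
        by (rule integrable_mult_csupp[OF int_G csupp_segment_avg[OF g]])
      show "\<bar>G x $ i * segment_avg z g x\<bar> \<le> M * \<bar>G x $ i\<bar>" for x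
        by (simp add: abs_mult mult.commute[of M] mult_left_mono segment_avg_bound[OF cg M])
    qed (intro integrable_mult_right integrable_abs int_G)
    then show ?thesis by simp
  qed
  moreover have M0: "M \<ge> 0" using M[of 0] by linarith
  ultimately have "\<bar>\<Sum>i\<in>UNIV. z $ i * (\<integral>x. G x $ i * segment_avg z g x \<partial>lebesgue_on \<Omega>)\<bar>
      \<le> (\<Sum>i\<in>UNIV. norm z * (M * (\<integral>x. \<bar>G x $ i\<bar> \<partial>lebesgue_on \<Omega>)))"
    by (intro order_trans[OF sum_abs] sum_mono) (unfold abs_mult, intro mult_mono component_le_norm_cart, auto)
  then show ?thesis
    unfolding integral_diff_translate(1)[OF g K] grad_mass_def by (simp add: sum_distrib_left mult.assoc)
qed

text \<open>Duality: the identity for \<open>integral_diff_translate\<close> would give the bound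
  for the weight \<open>\<kappa>\<close> times the sign of the difference. The sign is
  discontinuous, so it is replaced by t / (|t| + \<eta>), which costs an arbitrarily small
  error.\<close>

lemma integral_abs_diff_translate_le:
  assumes \<kappa>: "csupp K \<kappa>" "\<And>x. 0 \<le> \<kappa> x" "\<And>x. \<kappa> x \<le> M" and K: "sweep z K \<subseteq> \<Omega>" and w: "continuous_on \<Omega> w"
  shows "(\<integral>x. \<kappa> x * \<bar>w (x + z) - w x\<bar> \<partial>lebesgue_on \<Omega>) \<le> norm z * M * grad_mass \<Omega> G"
proof (rule field_le_epsilon)
  fix e :: real assume e: "e > 0"
  define I where "I = (\<integral>x. \<kappa> x \<partial>lebesgue_on \<Omega>)"
  have I: "I \<ge> 0" unfolding I_def by (intro Bochner_Integration.integral_nonneg \<kappa>)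
  \<comment> \<open>The regularisation error is at most \<open>\<eta> * I\<close>; the added 1
    covers \<open>I = 0\<close>.\<close>
  define \<eta> where "\<eta> = e / (I + 1)"
  have \<eta>: "\<eta> > 0" "\<eta> * I \<le> e" using e I by (auto simp: \<eta>_def field_simps)
  let ?D = "\<lambda>x. w (x + z) - w x"
  let ?g = "\<lambda>x. \<kappa> x * (?D x / (\<bar>?D x\<bar> + \<eta>))"
  have pos: "\<bar>t\<bar> + \<eta> > 0" for t :: real using \<eta>(1) by linarith
  then have nz: "\<bar>t\<bar> + \<eta> \<noteq> 0" for t :: real by (metis less_irrefl)
  have g: "csupp K ?g"
    by (rule csupp_mult_diff[OF \<kappa>(1) open_\<Omega> K w, where h = "\<lambda>a b. (a - b) / (\<bar>a - b\<bar> + \<eta>)"])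
      (use nz in \<open>intro continuous_intros ballI\<close>, simp)
  have a: "csupp K (\<lambda>x. \<kappa> x * \<bar>?D x\<bar>)"
    by (rule csupp_mult_diff[OF \<kappa>(1) open_\<Omega> K w, where h = "\<lambda>a b. \<bar>a - b\<bar>"]) (intro continuous_intros)
  have gM: "\<bar>?g x\<bar> \<le> M" for x
  proof -
    have "\<bar>?D x / (\<bar>?D x\<bar> + \<eta>)\<bar> \<le> 1"
      using pos[of "?D x"] \<eta>(1) by (simp add: abs_divide)
    then have "\<bar>?g x\<bar> \<le> \<kappa> x * 1"
      using \<kappa>(2) unfolding abs_mult by (intro mult_mono) auto
    then show ?thesis using \<kappa>(3)[of x] by simp
  qed
  have "(\<integral>x. \<kappa> x * \<bar>?D x\<bar> \<partial>lebesgue_on \<Omega>) \<le> (\<integral>x. ?g x * ?D x + \<eta> * \<kappa> x \<partial>lebesgue_on \<Omega>)"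
  proof (rule integral_mono)
    show "integrable (lebesgue_on \<Omega>) (\<lambda>x. ?g x * ?D x + \<eta> * \<kappa> x)"
      by (intro Bochner_Integration.integrable_add integral_diff_translate(2)[OF g K] integrable_mult_right csupp_integrable[OF \<kappa>(1)] \<Omega>_sets)
    show "\<kappa> x * \<bar>?D x\<bar> \<le> ?g x * ?D x + \<eta> * \<kappa> x" for x
    proof -
      \<comment> \<open>The gap between |t| and t^2 / (|t| + \<eta>) is \<eta> |t| / (|t| + \<eta>),
        which is below \<eta>.\<close>
      have "\<bar>t\<bar> \<le> t / (\<bar>t\<bar> + \<eta>) * t + \<eta>" for t
        using pos[of t] \<eta>(1) by (simp add: field_simps power2_eq_square[symmetric] abs_mult_self_eq)
      from mult_left_mono[OF this[of "?D x"] \<kappa>(2)[of x]] show ?thesis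
        by (simp only: distrib_left mult_ac)
    qed
  qed (intro csupp_integrable[OF a] \<Omega>_sets)
  also have "\<dots> = (\<integral>x. ?g x * ?D x \<partial>lebesgue_on \<Omega>) + \<eta> * I"
    unfolding I_def
    by (subst Bochner_Integration.integral_add[OF integral_diff_translate(2)[OF g K]
          integrable_mult_right[OF csupp_integrable[OF \<kappa>(1) \<Omega>_sets(1)]]]) simp
  also have "\<dots> \<le> norm z * M * grad_mass \<Omega> G + e"
    using abs_integral_diff_translate_le[OF g K gM] \<eta>(2) by linarith
  finally show "(\<integral>x. \<kappa> x * \<bar>?D x\<bar> \<partial>lebesgue_on \<Omega>) \<le> norm z * M * grad_mass \<Omega> G + e" .
qed

end

section \<open>Chain rule for weak gradients\<close>

lemma sup_diff_translate_small:
  fixes w :: "'a::euclidean_space \<Rightarrow> real"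
  assumes \<Omega>: "open \<Omega>" and K: "compact K" "K \<subseteq> \<Omega>" and w: "continuous_on \<Omega> w" and e: "e > 0"
  shows "\<exists>r>0. \<forall>x\<in>K. \<forall>z. norm z < r \<longrightarrow> x + z \<in> \<Omega> \<and> \<bar>w (x + z) - w x\<bar> < e"
proof -
  obtain r0 where r0: "r0 > 0" "(\<Union>x\<in>K. cball x r0) \<subseteq> \<Omega>"
    using compact_subset_open_imp_cball_epsilon_subset[OF K(1) \<Omega> K(2)] by blast
  define K' where "K' = (\<lambda>(x, y). x + y) ` (K \<times> cball 0 r0)"
  have K'm: "x + y \<in> K'" if "x \<in> K" "norm y \<le> r0" for x y
    using imageI[of "(x, y)" "K \<times> cball 0 r0" "\<lambda>(x, y). x + y"] that by (simp add: K'_def)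
  have cK': "compact K'" unfolding K'_def
    by (intro compact_continuous_image compact_Times K) (auto simp: split_beta intro!: continuous_intros)
  have K'\<Omega>: "K' \<subseteq> \<Omega>"
    using r0(2) unfolding K'_def by (force simp: dist_norm)
  have "uniformly_continuous_on K' w"
    by (intro compact_uniformly_continuous cK' continuous_on_subset[OF w K'\<Omega>])
  then obtain d where d: "d > 0" "\<And>x y. x \<in> K' \<Longrightarrow> y \<in> K' \<Longrightarrow> dist y x < d \<Longrightarrow> dist (w y) (w x) < e"
    unfolding uniformly_continuous_on_def using e by metis
  have "x + z \<in> \<Omega> \<and> \<bar>w (x + z) - w x\<bar> < e" if "x \<in> K" "norm z < min r0 d" for x z
  proof -
    have "x + z \<in> K'" "x \<in> K'" using K'm[of x z] K'm[of x 0] that r0(1) by auto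
    then show ?thesis using d(2)[of x "x + z"] that K'\<Omega> by (auto simp: dist_norm)
  qed
  then show ?thesis using r0(1) d(1) by (intro exI[of _ "min r0 d"]) auto
qed

lemma taylor_lipschitz_deriv:
  fixes T :: "real \<Rightarrow> real"
  assumes T: "\<And>x. (T has_real_derivative T' x) (at x)" and L: "\<And>x y. \<bar>T' x - T' y\<bar> \<le> L * \<bar>x - y\<bar>"
  shows "\<bar>T b - T a - T' a * (b - a)\<bar> \<le> L * \<bar>b - a\<bar>\<^sup>2"
proof -
  have "\<exists>\<xi>. \<bar>\<xi> - a\<bar> \<le> \<bar>b - a\<bar> \<and> T b - T a = T' \<xi> * (b - a)"
  proof (cases a b rule: linorder_cases)
    case less
    then obtain \<xi> where "a < \<xi>" "\<xi> < b" "T b - T a = (b - a) * T' \<xi>"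
      using MVT2[of a b T T'] T by metis
    then show ?thesis by (intro exI[of _ \<xi>]) auto
  next
    case greater
    then obtain \<xi> where "b < \<xi>" "\<xi> < a" "T a - T b = (a - b) * T' \<xi>"
      using MVT2[of b a T T'] T by metis
    then show ?thesis by (intro exI[of _ \<xi>]) (auto simp: algebra_simps)
  qed auto
  then obtain \<xi> where \<xi>: "\<bar>\<xi> - a\<bar> \<le> \<bar>b - a\<bar>" "T b - T a = T' \<xi> * (b - a)" by blast
  have L0: "L \<ge> 0" using L[of 1 0] by simp
  have "\<bar>T b - T a - T' a * (b - a)\<bar> = \<bar>T' \<xi> - T' a\<bar> * \<bar>b - a\<bar>"
    unfolding \<xi>(2) by (simp add: abs_mult[symmetric] algebra_simps)
  also have "\<dots> \<le> (L * \<bar>b - a\<bar>) * \<bar>b - a\<bar>"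
    using L[of \<xi> a] mult_left_mono[OF \<xi>(1) L0] by (intro mult_right_mono) auto
  finally show ?thesis by (simp add: power2_eq_square mult.assoc)
qed

context weak_diff
begin

text \<open>The difference quotient of \<open>T (w x)\<close> in direction \<open>i\<close>, tested
  with \<open>\<phi>\<close>, is \<open>A n\<close>; the linearised one, with weight
  \<open>\<phi> x * T' (w x)\<close>, is \<open>B n\<close>. Moving the translation onto
  \<open>\<phi>\<close> gives the limit of \<open>A\<close>, the translation identity gives the
  limit of \<open>B\<close>, and the Taylor remainder shows that the two limits agree.\<close>

lemma weak_grad_compose:
  assumes w: "continuous_on \<Omega> w"
    and T: "\<And>x. (T has_real_derivative T' x) (at x)" and L: "\<And>x y. \<bar>T' x - T' y\<bar> \<le> L * \<bar>x - y\<bar>"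
    and int_T: "integrable (lebesgue_on \<Omega>) (\<lambda>x. T (w x))"
  shows "weak_grad \<Omega> (\<lambda>x. T (w x)) (\<lambda>x. T' (w x) *\<^sub>R G x)"
  unfolding weak_grad_def
proof (intro allI impI)
  fix \<phi> :: "real^'n \<Rightarrow> real" and i :: 'n
  assume "test_fun \<Omega> \<phi>"
  define K where "K = closure {x. \<phi> x \<noteq> 0}"
  have \<phi>: "smooth \<phi>" and cK: "compact K" and K: "K \<subseteq> \<Omega>"
    using \<open>test_fun \<Omega> \<phi>\<close> unfolding test_fun_def K_def by auto
  have cs: "csupp K \<phi>" unfolding K_def by (rule csupp_test_fun[OF \<open>test_fun \<Omega> \<phi>\<close>])
  have \<phi>0: "\<phi> x = 0" if "x \<notin> K" for x using cs that by (simp add: csupp_def)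
  have cs1: "csupp K (partial i \<phi>)" by (rule csupp_partial[OF \<phi> cs])
  have L0: "L \<ge> 0" using L[of 1 0] by simp
  have cT': "continuous_on UNIV T'"
  proof (rule continuous_onI)
    fix x e :: real assume e: "e > 0"
    show "\<exists>d>0. \<forall>x'\<in>UNIV. dist x' x < d \<longrightarrow> dist (T' x') (T' x) \<le> e"
    proof (intro exI[of _ "e / (L + 1)"] conjI ballI impI)
      fix y assume "dist y x < e / (L + 1)"
      then have "(L + 1) * \<bar>y - x\<bar> \<le> e" using L0 by (simp add: field_simps dist_real_def)
      moreover have "L * \<bar>y - x\<bar> \<le> (L + 1) * \<bar>y - x\<bar>" by (intro mult_right_mono) auto
      ultimately show "dist (T' y) (T' x) \<le> e" using L[of y x] by (simp add: dist_real_def)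
    qed (use e L0 in auto)
  qed
  have cT: "continuous_on UNIV T"
    by (intro continuous_at_imp_continuous_on ballI) (rule DERIV_isCont[OF T])
  define g where "g x = \<phi> x * T' (w x)" for x
  have g: "csupp K g" unfolding g_def[abs_def]
    by (rule csupp_mult[OF cs open_\<Omega> K]) (rule continuous_on_compose2[OF cT' w], simp)
  obtain M where M: "M > 0" "\<And>x. \<bar>\<phi> x\<bar> \<le> M" using csupp_bounded[OF cs] by metis
  define e :: "real^'n" where "e = axis i 1"
  have ne: "norm e = 1" by (simp add: e_def)
  obtain r where r: "r > 0" "\<And>x z. x \<in> K \<Longrightarrow> norm z < r \<Longrightarrow> x + z \<in> \<Omega>"
    using sup_diff_translate_small[OF open_\<Omega> cK K w zero_less_one] by metis
  \<comment> \<open>The factor 1/2 keeps every step strictly below \<open>r\<close>, so that all the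
    swept copies of \<open>K\<close> stay in the domain.\<close>
  define t where "t n = r / 2 * inverse (real (Suc n))" for n
  have t: "t n > 0" "t n < r" for n
  proof -
    show "t n > 0" using r(1) by (simp add: t_def)
    have "t n \<le> r / 2 * 1" unfolding t_def using r(1) by (intro mult_left_mono) (auto simp: field_simps)
    then show "t n < r" using r(1) by simp
  qed
  have t_lim: "t \<longlonglongrightarrow> 0"
    using tendsto_mult[OF tendsto_const[of "r / 2"] LIMSEQ_inverse_real_of_nat] by (simp add: t_def[abs_def])
  define z where "z n = t n *\<^sub>R e" for n
  have nz: "norm (z n) = t n" for n using t(1)[of n] by (simp add: z_def ne)
  have z_lim: "z \<longlonglongrightarrow> 0"
    using tendsto_scaleR[OF t_lim tendsto_const[of e]] by (simp add: z_def[abs_def])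
  have sw: "sweep (z n) K \<subseteq> \<Omega>" for n
  proof
    fix p assume "p \<in> sweep (z n) K"
    then obtain x s where "x \<in> K" "s \<in> {0..1}" and p: "p = x + s *\<^sub>R z n" unfolding sweep_def by auto
    moreover have "norm (s *\<^sub>R z n) \<le> 1 * norm (z n)"
      unfolding norm_scaleR by (intro mult_right_mono) (use \<open>s \<in> {0..1}\<close> in auto)
    ultimately show "p \<in> \<Omega>" using r(2) nz[of n] t(2)[of n] by auto
  qed
  have sum_z: "(\<Sum>j\<in>UNIV. z n $ j * f j) = t n * f i" for n and f :: "'n \<Rightarrow> real"
  proof -
    have "(\<Sum>j\<in>UNIV. z n $ j * f j) = (\<Sum>j\<in>UNIV. if j = i then t n * f i else 0)"
      by (intro sum.cong) (auto simp: z_def e_def axis_def)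
    then show ?thesis by simp
  qed
  have K'': "K \<subseteq> \<Omega>" "(\<lambda>x. x + z n) ` K \<subseteq> \<Omega>" for n
    using subset_sweep[where K = K and z = "z n"] sw[of n] by blast+
  define A where "A n = (\<integral>x. \<phi> x * (T (w (x + z n)) - T (w x)) \<partial>lebesgue_on \<Omega>) / t n" for n
  define B where "B n = (\<integral>x. g x * (w (x + z n) - w x) \<partial>lebesgue_on \<Omega>) / t n" for n
  have iA: "integrable (lebesgue_on \<Omega>) (\<lambda>x. \<phi> x * (T (w (x + z n)) - T (w x)))" for n
    by (rule csupp_integrable[OF csupp_mult_diff[OF cs open_\<Omega> sw w, where h = "\<lambda>a b. T a - T b"] \<Omega>_sets(1)])
      (intro continuous_intros continuous_on_compose2[OF cT]; simp)
  have B_eq: "B n = (\<integral>x. G x $ i * segment_avg (z n) g x \<partial>lebesgue_on \<Omega>)" for n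
    unfolding B_def integral_diff_translate(1)[OF g sw] sum_z using t(1)[of n] by simp
  have B_lim: "B \<longlonglongrightarrow> (\<integral>x. G x $ i * g x \<partial>lebesgue_on \<Omega>)"
    unfolding B_eq[abs_def] by (rule tendsto_integral_segment_avg[OF int_G g z_lim])
  have A_eq: "A n = - (\<integral>x. T (w x) * segment_avg (z n) (partial i \<phi>) x \<partial>lebesgue_on \<Omega>)" for n
  proof -
    have i1: "integrable (lebesgue_on \<Omega>) (\<lambda>x. T (w x) * \<phi> x)"
      by (rule integrable_mult_csupp[OF int_T cs])
    have i2: "integrable (lebesgue_on \<Omega>) (\<lambda>x. T (w x) * segment_avg (z n) (partial i \<phi>) x)"
      by (rule integrable_mult_csupp[OF int_T csupp_segment_avg[OF cs1]])
    have d: "\<phi> x - \<phi> (x - z n) = t n * segment_avg (z n) (partial i \<phi>) x" for x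
      using smooth_segment_avg(3)[OF \<phi>, of "z n" x] unfolding sum_z by simp
    have "(\<integral>x. \<phi> x * (T (w (x + z n)) - T (w x)) \<partial>lebesgue_on \<Omega>) =
       (\<integral>x. \<phi> x * T (w (x + z n)) \<partial>lebesgue_on \<Omega>) - (\<integral>x. \<phi> x * T (w x) \<partial>lebesgue_on \<Omega>)"
      unfolding right_diff_distrib
      by (intro Bochner_Integration.integral_diff integral_translate_csupp[OF \<Omega>_sets(1) int_T cs K''])
        (use i1 in \<open>simp add: mult.commute\<close>)
    also have "(\<integral>x. \<phi> x * T (w (x + z n)) \<partial>lebesgue_on \<Omega>) = (\<integral>x. T (w x) * \<phi> (x - z n) \<partial>lebesgue_on \<Omega>)"
      by (rule integral_translate_csupp(2)[OF \<Omega>_sets(1) int_T cs K'', symmetric])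
    also have "\<dots> = (\<integral>x. T (w x) * \<phi> x - t n * (T (w x) * segment_avg (z n) (partial i \<phi>) x) \<partial>lebesgue_on \<Omega>)"
    proof (rule Bochner_Integration.integral_cong[OF refl])
      fix x
      have eq: "\<phi> (x - z n) = \<phi> x - t n * segment_avg (z n) (partial i \<phi>) x" using d[of x] by simp
      show "T (w x) * \<phi> (x - z n) = T (w x) * \<phi> x - t n * (T (w x) * segment_avg (z n) (partial i \<phi>) x)"
        by (simp only: eq right_diff_distrib mult_ac)
    qed
    also have "\<dots> = (\<integral>x. \<phi> x * T (w x) \<partial>lebesgue_on \<Omega>) - t n * (\<integral>x. T (w x) * segment_avg (z n) (partial i \<phi>) x \<partial>lebesgue_on \<Omega>)"
      by (subst Bochner_Integration.integral_diff[OF i1 integrable_mult_right[OF i2]]) (simp add: mult.commute)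
    finally show ?thesis unfolding A_def using t(1)[of n] by simp
  qed
  have A_lim: "A \<longlonglongrightarrow> - (\<integral>x. T (w x) * partial i \<phi> x \<partial>lebesgue_on \<Omega>)"
    unfolding A_eq[abs_def] by (intro tendsto_minus tendsto_integral_segment_avg[OF int_T cs1 z_lim])
  have "(\<lambda>n. A n - B n) \<longlonglongrightarrow> 0"
  proof (rule tendsto_rabs_zero_cancel, rule order_tendstoI)
    show "\<forall>\<^sub>F n in sequentially. a < \<bar>A n - B n\<bar>" if "a < 0" for a
      using that by (intro always_eventually) (auto intro: less_le_trans)
  next
    fix \<epsilon> :: real assume \<epsilon>: "0 < \<epsilon>"
    define C where "C = M * grad_mass \<Omega> G"
    have C: "C \<ge> 0" using M(1) grad_mass_nonneg[of \<Omega> G] by (simp add: C_def)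
    \<comment> \<open>This is to bound \<open>w (x + z) - w x\<close> uniformly on \<open>K\<close>;
      the final error is \<open>L * \<eta> * C\<close>, and the added 1 also covers
      \<open>L * C = 0\<close>.\<close>
    define \<eta> where "\<eta> = \<epsilon> / (L * C + 1)"
    have \<eta>: "\<eta> > 0" "L * \<eta> * C < \<epsilon>"
    proof -
      have LC: "L * C \<ge> 0" using L0 C by simp
      show "\<eta> > 0" using LC \<epsilon> by (simp add: \<eta>_def)
      show "L * \<eta> * C < \<epsilon>" using LC \<epsilon> by (simp add: \<eta>_def field_simps)
    qed
    obtain q where q: "q > 0" "\<And>x z. x \<in> K \<Longrightarrow> norm z < q \<Longrightarrow> \<bar>w (x + z) - w x\<bar> < \<eta>"
      using sup_diff_translate_small[OF open_\<Omega> cK K w \<eta>(1)] by metis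
    have "\<forall>\<^sub>F n in sequentially. t n < q" by (rule order_tendstoD(2)[OF t_lim q(1)])
    then show "\<forall>\<^sub>F n in sequentially. \<bar>A n - B n\<bar> < \<epsilon>"
    proof (rule eventually_mono)
      fix n assume n: "t n < q"
      let ?D = "\<lambda>x. w (x + z n) - w x"
      have absphi: "csupp K (\<lambda>x. \<bar>\<phi> x\<bar>)" using cs unfolding csupp_def by (auto intro: continuous_on_rabs)
      have iD: "integrable (lebesgue_on \<Omega>) (\<lambda>x. \<bar>\<phi> x\<bar> * \<bar>?D x\<bar>)"
        by (rule csupp_integrable[OF csupp_mult_diff[OF absphi open_\<Omega> sw w, where h = "\<lambda>a b. \<bar>a - b\<bar>"] \<Omega>_sets(1)])
          (intro continuous_intros)
      have "A n - B n = (\<integral>x. \<phi> x * (T (w (x + z n)) - T (w x)) - g x * ?D x \<partial>lebesgue_on \<Omega>) / t n"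
        unfolding A_def B_def diff_divide_distrib[symmetric]
        by (subst Bochner_Integration.integral_diff[OF iA integral_diff_translate(2)[OF g sw]]) simp
      also have "\<bar>\<dots>\<bar> \<le> (\<integral>x. L * \<eta> * (\<bar>\<phi> x\<bar> * \<bar>?D x\<bar>) \<partial>lebesgue_on \<Omega>) / t n"
      proof -
        have "\<bar>\<integral>x. \<phi> x * (T (w (x + z n)) - T (w x)) - g x * ?D x \<partial>lebesgue_on \<Omega>\<bar> \<le> (\<integral>x. L * \<eta> * (\<bar>\<phi> x\<bar> * \<bar>?D x\<bar>) \<partial>lebesgue_on \<Omega>)"
        proof (rule integral_abs_bound_integral)
          show "\<bar>\<phi> x * (T (w (x + z n)) - T (w x)) - g x * ?D x\<bar> \<le> L * \<eta> * (\<bar>\<phi> x\<bar> * \<bar>?D x\<bar>)" for x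
          proof (cases "x \<in> K")
            case True
            have "\<phi> x * (T (w (x + z n)) - T (w x)) - g x * ?D x = \<phi> x * (T (w (x + z n)) - T (w x) - T' (w x) * ?D x)"
              by (simp add: g_def algebra_simps)
            also have "\<bar>\<dots>\<bar> \<le> \<bar>\<phi> x\<bar> * (L * \<bar>?D x\<bar>\<^sup>2)"
              unfolding abs_mult by (intro mult_left_mono taylor_lipschitz_deriv T L) auto
            \<comment> \<open>One factor of the squared increment is estimated uniformly by
              \<open>\<eta>\<close>. The other is kept for the L^1 translation bound, whose factor
              \<open>t n\<close> cancels the denominator of the quotient.\<close>
            also have "\<dots> \<le> \<bar>\<phi> x\<bar> * (L * (\<eta> * \<bar>?D x\<bar>))"
              unfolding power2_eq_square using q(2)[OF True, of "z n"] n nz[of n] L0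
              by (intro mult_left_mono mult_right_mono) auto
            finally show ?thesis by (simp add: mult_ac)
          next
            case False
            then show ?thesis using \<phi>0 by (simp add: g_def)
          qed
        qed (intro Bochner_Integration.integrable_diff iA integral_diff_translate(2)[OF g sw] integrable_mult_right iD)+
        then show ?thesis unfolding abs_divide using t(1)[of n] by (simp add: divide_right_mono)
      qed
      also have "\<dots> = L * \<eta> * (\<integral>x. \<bar>\<phi> x\<bar> * \<bar>?D x\<bar> \<partial>lebesgue_on \<Omega>) / t n" by simp
      also have "\<dots> \<le> L * \<eta> * (t n * C) / t n"
        using integral_abs_diff_translate_le[OF absphi _ M(2) sw w, of n] L0 \<eta>(1) t(1)[of n]
        unfolding nz C_def by (intro divide_right_mono mult_left_mono) (auto simp: mult.assoc)
      also have "\<dots> = L * \<eta> * C" using t(1)[of n] by simp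
      also have "\<dots> < \<epsilon>" by (rule \<eta>(2))
      finally show "\<bar>A n - B n\<bar> < \<epsilon>" .
    qed
  qed
  from tendsto_add[OF this B_lim] have "A \<longlonglongrightarrow> (\<integral>x. G x $ i * g x \<partial>lebesgue_on \<Omega>)" by simp
  from LIMSEQ_unique[OF A_lim this]
  have "(\<integral>x. T (w x) * partial i \<phi> x \<partial>lebesgue_on \<Omega>) = - (\<integral>x. G x $ i * g x \<partial>lebesgue_on \<Omega>)" by simp
  then show "(\<integral>x. T (w x) * partial i \<phi> x \<partial>lebesgue_on \<Omega>) = - (\<integral>x. (T' (w x) *\<^sub>R G x) $ i * \<phi> x \<partial>lebesgue_on \<Omega>)"
    by (simp add: g_def mult_ac)
qed

end

section \<open>Averaging and weak convergence\<close>

lemma integral_lborel_translate: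
  fixes f :: "'a::euclidean_space \<Rightarrow> real"
  assumes "f \<in> borel_measurable borel"
  shows "(\<integral>x. f (z + x) \<partial>lborel) = integral\<^sup>L lborel f"
  by (subst (2) lborel_translate[of z, symmetric])
    (rule integral_distr[symmetric], use assms in auto)

text \<open>The substitution t = x + z between two applications of Fubini. Before and after it the
  integrand is dominated by \<open>\<bar>q x\<bar> * B\<close> times a translate of
  \<open>\<bar>k\<bar>\<close>, which is integrable on the product.\<close>

lemma integral_correlation_lborel:
  fixes q f k :: "'a::euclidean_space \<Rightarrow> real"
  assumes q: "integrable lborel q" and k: "integrable lborel k"
    and f[measurable]: "f \<in> borel_measurable borel" and B: "\<And>x. \<bar>f x\<bar> \<le> B"
  shows "(\<integral>z. k z * (\<integral>x. q x * f (x + z) \<partial>lborel) \<partial>lborel) =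
         (\<integral>t. f t * (\<integral>x. q x * k (t - x) \<partial>lborel) \<partial>lborel)"
proof -
  have qm[measurable]: "q \<in> borel_measurable borel" and km[measurable]: "k \<in> borel_measurable borel"
    using q k by (auto dest: borel_measurable_integrable)
  have B0: "B \<ge> 0" using B[of 0] by linarith
  have k_shift: "integrable lborel (\<lambda>t. k (t - x))" for x
  proof -
    have "integrable (distr lborel borel (\<lambda>t. - x + t)) k"
      unfolding lborel_translate by (rule k)
    from integrable_distr[OF _ this] show ?thesis by simp
  qed
  have k_shift_int: "(\<integral>t. \<bar>k (t - x)\<bar> \<partial>lborel) = (\<integral>t. \<bar>k t\<bar> \<partial>lborel)" for x
    using integral_lborel_translate[of "\<lambda>t. \<bar>k t\<bar>" "- x"] by simp
  have int1: "integrable (lborel \<Otimes>\<^sub>M lborel) (\<lambda>(x, z). k z * (q x * f (x + z)))"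
  proof (rule lborel_pair.Fubini_integrable)
    have bnd: "norm (k z * (q x * f (x + z))) \<le> \<bar>q x\<bar> * B * \<bar>k z\<bar>" for x z
      using mult_left_mono[OF B[of "x + z"], of "\<bar>q x\<bar> * \<bar>k z\<bar>"] by (simp add: abs_mult mult_ac)
    have inner: "integrable lborel (\<lambda>z. k z * (q x * f (x + z)))" for x
      by (rule Bochner_Integration.integrable_bound[of _ "\<lambda>z. \<bar>q x\<bar> * B * \<bar>k z\<bar>"])
        (use k bnd B0 in \<open>auto simp: abs_mult\<close>)
    then show "AE x in lborel. integrable lborel (\<lambda>z. case (x, z) of (x, z) \<Rightarrow> k z * (q x * f (x + z)))" by simp
    have "integrable lborel (\<lambda>x. \<integral>z. norm (k z * (q x * f (x + z))) \<partial>lborel)"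
    proof (rule Bochner_Integration.integrable_bound[of _ "\<lambda>x. \<bar>q x\<bar> * (B * (\<integral>z. \<bar>k z\<bar> \<partial>lborel))"])
      have "norm (\<integral>z. norm (k z * (q x * f (x + z))) \<partial>lborel) \<le> (\<integral>z. \<bar>q x\<bar> * B * \<bar>k z\<bar> \<partial>lborel)" for x
        unfolding real_norm_def[of "integral\<^sup>L _ _"]
        by (rule integral_abs_bound_integral) (use k inner bnd in \<open>auto intro: integrable_norm\<close>)
      then show "AE x in lborel. norm (\<integral>z. norm (k z * (q x * f (x + z))) \<partial>lborel) \<le> norm (\<bar>q x\<bar> * (B * (\<integral>z. \<bar>k z\<bar> \<partial>lborel)))"
        using B0 by (auto simp: abs_mult mult.assoc Bochner_Integration.integral_nonneg)
    qed (use q in auto)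
    then show "integrable lborel (\<lambda>x. \<integral>z. norm (case (x, z) of (x, z) \<Rightarrow> k z * (q x * f (x + z))) \<partial>lborel)" by simp
  qed simp
  have int2: "integrable (lborel \<Otimes>\<^sub>M lborel) (\<lambda>(x, t). f t * (q x * k (t - x)))"
  proof (rule lborel_pair.Fubini_integrable)
    have bnd: "norm (f t * (q x * k (t - x))) \<le> \<bar>q x\<bar> * B * \<bar>k (t - x)\<bar>" for x t
      using mult_left_mono[OF B[of t], of "\<bar>q x\<bar> * \<bar>k (t - x)\<bar>"] by (simp add: abs_mult mult_ac)
    have inner: "integrable lborel (\<lambda>t. f t * (q x * k (t - x)))" for x
      by (rule Bochner_Integration.integrable_bound[of _ "\<lambda>t. \<bar>q x\<bar> * B * \<bar>k (t - x)\<bar>"])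
        (use k_shift bnd B0 in \<open>auto simp: abs_mult\<close>)
    then show "AE x in lborel. integrable lborel (\<lambda>t. case (x, t) of (x, t) \<Rightarrow> f t * (q x * k (t - x)))" by simp
    have "integrable lborel (\<lambda>x. \<integral>t. norm (f t * (q x * k (t - x))) \<partial>lborel)"
    proof (rule Bochner_Integration.integrable_bound[of _ "\<lambda>x. \<bar>q x\<bar> * (B * (\<integral>z. \<bar>k z\<bar> \<partial>lborel))"])
      have "norm (\<integral>t. norm (f t * (q x * k (t - x))) \<partial>lborel) \<le> (\<integral>t. \<bar>q x\<bar> * B * \<bar>k (t - x)\<bar> \<partial>lborel)" for x
        unfolding real_norm_def[of "integral\<^sup>L _ _"]
        by (rule integral_abs_bound_integral) (use k_shift inner bnd in \<open>auto intro: integrable_norm\<close>)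
      then show "AE x in lborel. norm (\<integral>t. norm (f t * (q x * k (t - x))) \<partial>lborel) \<le> norm (\<bar>q x\<bar> * (B * (\<integral>z. \<bar>k z\<bar> \<partial>lborel)))"
        using B0 k_shift_int by (auto simp: abs_mult mult.assoc Bochner_Integration.integral_nonneg)
    qed (use q in auto)
    then show "integrable lborel (\<lambda>x. \<integral>t. norm (case (x, t) of (x, t) \<Rightarrow> f t * (q x * k (t - x))) \<partial>lborel)" by simp
  qed simp
  have "(\<integral>z. k z * (\<integral>x. q x * f (x + z) \<partial>lborel) \<partial>lborel) = (\<integral>z. (\<integral>x. k z * (q x * f (x + z)) \<partial>lborel) \<partial>lborel)"
    by simp
  also have "\<dots> = (\<integral>x. (\<integral>z. k z * (q x * f (x + z)) \<partial>lborel) \<partial>lborel)"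
    by (rule lborel_pair.Fubini_integral[OF int1])
  also have "\<dots> = (\<integral>x. (\<integral>t. f t * (q x * k (t - x)) \<partial>lborel) \<partial>lborel)"
  proof (rule Bochner_Integration.integral_cong[OF refl])
    fix x
    show "(\<integral>z. k z * (q x * f (x + z)) \<partial>lborel) = (\<integral>t. f t * (q x * k (t - x)) \<partial>lborel)"
      using integral_lborel_translate[of "\<lambda>t. f t * (q x * k (t - x))" x] by (simp add: mult_ac)
  qed
  also have "\<dots> = (\<integral>t. (\<integral>x. f t * (q x * k (t - x)) \<partial>lborel) \<partial>lborel)"
    by (rule lborel_pair.Fubini_integral[OF int2, symmetric])
  also have "\<dots> = (\<integral>t. f t * (\<integral>x. q x * k (t - x) \<partial>lborel) \<partial>lborel)"
    by simp
  finally show ?thesis .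
qed

text \<open>Fubini is applied to products of Borel measure, while \<open>q\<close> is only Lebesgue
  measurable; a Borel function equal to \<open>q\<close> almost everywhere takes its place.\<close>

lemma integral_correlation:
  fixes q f k :: "'a::euclidean_space \<Rightarrow> real"
  assumes q: "integrable lebesgue q" and k: "integrable lborel k"
    and f[measurable]: "f \<in> borel_measurable borel" and B: "\<And>x. \<bar>f x\<bar> \<le> B"
  shows "(\<integral>z. k z * (\<integral>x. q x * f (x + z) \<partial>lebesgue) \<partial>lborel) =
         (\<integral>t. f t * (\<integral>x. q x * k (t - x) \<partial>lebesgue) \<partial>lborel)"
proof -
  obtain q' where q'[measurable]: "q' \<in> borel_measurable lborel" and eq: "AE x in lborel. q x = q' x"
    using completion_ex_borel_measurable_real[OF borel_measurable_integrable[OF q]] by blast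
  have eq': "AE x in lebesgue. q x = q' x" by (rule AE_completion[OF eq])
  have qm: "q \<in> borel_measurable lebesgue" by (rule borel_measurable_integrable[OF q])
  have [measurable]: "k \<in> borel_measurable borel" using borel_measurable_integrable[OF k] by simp
  have ql: "integrable lborel q'"
  proof -
    have "integrable lebesgue q'"
      using q by (rule integrable_cong_AE_imp) (use eq' in \<open>auto intro!: measurable_completion elim!: eventually_mono\<close>)
    then show ?thesis using integrable_completion[of q' lborel] by simp
  qed
  have tr: "(\<integral>x. q x * g x \<partial>lebesgue) = (\<integral>x. q' x * g x \<partial>lborel)" if [measurable]: "g \<in> borel_measurable borel" for g
  proof -
    have gm: "g \<in> borel_measurable lebesgue" "q' \<in> borel_measurable lebesgue" by (auto intro!: measurable_completion)
    have "(\<integral>x. q x * g x \<partial>lebesgue) = (\<integral>x. q' x * g x \<partial>lebesgue)"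
      by (rule integral_cong_AE) (use qm gm eq' in \<open>auto elim!: eventually_mono\<close>)
    also have "\<dots> = (\<integral>x. q' x * g x \<partial>lborel)" by (rule integral_completion) simp
    finally show ?thesis .
  qed
  show ?thesis
    using integral_correlation_lborel[OF ql k f B] by (simp add: tr)
qed

lemma measurable_parametric_integral:
  fixes q :: "'a::euclidean_space \<Rightarrow> real" and g :: "'b::euclidean_space \<Rightarrow> 'a \<Rightarrow> real"
  assumes q: "q \<in> borel_measurable lebesgue"
    and g[measurable]: "(\<lambda>(z, x). g z x) \<in> borel_measurable (borel \<Otimes>\<^sub>M borel)"
  shows "(\<lambda>z. \<integral>x. q x * g z x \<partial>lebesgue) \<in> borel_measurable borel"
proof -
  obtain q' where q'[measurable]: "q' \<in> borel_measurable lborel" and eq: "AE x in lborel. q x = q' x"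
    using completion_ex_borel_measurable_real[OF q] by blast
  have eq': "AE x in lebesgue. q x = q' x" by (rule AE_completion[OF eq])
  have "(\<integral>x. q x * g z x \<partial>lebesgue) = (\<integral>x. q' x * g z x \<partial>lborel)" for z
  proof -
    have gz[measurable]: "g z \<in> borel_measurable borel"
      using measurable_compose[OF measurable_Pair1' g, of z] by simp
    have gm: "g z \<in> borel_measurable lebesgue" "q' \<in> borel_measurable lebesgue" by (auto intro!: measurable_completion)
    have "(\<integral>x. q x * g z x \<partial>lebesgue) = (\<integral>x. q' x * g z x \<partial>lebesgue)"
      by (rule integral_cong_AE) (use q gm eq' in \<open>auto elim!: eventually_mono\<close>)
    also have "\<dots> = (\<integral>x. q' x * g z x \<partial>lborel)" by (rule integral_completion) simp
    finally show ?thesis .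
  qed
  then show ?thesis by simp
qed

text \<open>Truncated multiples of the distance to the complement tend to 1 at every point of the
  open set, so dominated convergence makes the uncovered part small.\<close>

lemma exists_cutoff:
  fixes \<Omega> :: "'a::euclidean_space set"
  assumes \<Omega>: "open \<Omega>" "bounded \<Omega>" and e: "e > 0"
  shows "\<exists>K \<kappa>. csupp K \<kappa> \<and> K \<subseteq> \<Omega> \<and> (\<forall>x. 0 \<le> \<kappa> x \<and> \<kappa> x \<le> 1) \<and> (\<integral>x. 1 - \<kappa> x \<partial>lebesgue_on \<Omega>) < e"
proof -
  define D where "D = - \<Omega>"
  \<comment> \<open>\<open>infdist\<close> to the empty set is 0 by convention, so the complement
    must first be known to be nonempty.\<close>
  have "\<Omega> \<noteq> UNIV" using \<Omega>(2) not_bounded_UNIV by metis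
  then have D: "closed D" "D \<noteq> {}" using \<Omega>(1) by (auto simp: D_def)
  \<comment> \<open>The cutoff is 0 up to distance 1/(n + 1) from the complement and 1 from distance
    2/(n + 1) on.\<close>
  define \<kappa> where "\<kappa> n x = max 0 (min 1 (real (Suc n) * infdist x D - 1))" for n x
  define K where "K n = {x. infdist x D \<ge> 1 / real (Suc n)}" for n
  have K\<Omega>: "K n \<subseteq> \<Omega>" for n
    using D by (auto simp: K_def D_def in_closed_iff_infdist_zero)
  have c\<kappa>: "continuous_on UNIV (\<kappa> n)" for n
    unfolding \<kappa>_def[abs_def] by (intro continuous_intros)
  have cs: "csupp (K n) (\<kappa> n)" for n
  proof -
    have "closed (K n)"
      unfolding K_def by (intro closed_Collect_le continuous_intros)
    moreover have "bounded (K n)" using bounded_subset[OF \<Omega>(2) K\<Omega>] .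
    moreover have "\<kappa> n x = 0" if "x \<notin> K n" for x
      using that unfolding K_def \<kappa>_def by (auto simp: field_simps)
    ultimately show ?thesis using c\<kappa> by (simp add: csupp_def compact_eq_bounded_closed)
  qed
  have rng: "0 \<le> \<kappa> n x" "\<kappa> n x \<le> 1" for n x by (auto simp: \<kappa>_def)
  have \<Omega>s: "\<Omega> \<in> sets lebesgue" "\<Omega> \<in> lmeasurable"
    using \<Omega> by (auto intro: bounded_set_imp_lmeasurable)
  interpret finite_measure "lebesgue_on \<Omega>"
    by (rule finite_measure_lebesgue_on[OF \<Omega>s(2)])
  have "(\<lambda>n. \<integral>x. 1 - \<kappa> n x \<partial>lebesgue_on \<Omega>) \<longlonglongrightarrow> (\<integral>x. 0 \<partial>lebesgue_on \<Omega>)"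
  proof (rule integral_dominated_convergence[where w = "\<lambda>_. 1"])
    show "AE x in lebesgue_on \<Omega>. (\<lambda>n. 1 - \<kappa> n x) \<longlonglongrightarrow> 0"
    proof (rule AE_I2)
      fix x assume "x \<in> space (lebesgue_on \<Omega>)"
      then have x: "x \<notin> D" by (simp add: D_def)
      then have pos: "infdist x D > 0"
        using D in_closed_iff_infdist_zero[of D x] infdist_nonneg[of x D] by linarith
      obtain N where N: "real N > 2 / infdist x D" using reals_Archimedean2 by blast
      have "\<kappa> n x = 1" if "n \<ge> N" for n
      proof -
        have "2 / infdist x D < real (Suc n)" using N that by linarith
        then have "2 < real (Suc n) * infdist x D" using pos by (simp add: pos_divide_less_eq)
        then show ?thesis by (simp add: \<kappa>_def)
      qed
      then have "\<forall>\<^sub>F n in sequentially. 0 = 1 - \<kappa> n x"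
        unfolding eventually_sequentially by (intro exI[of _ N]) simp
      then show "(\<lambda>n. 1 - \<kappa> n x) \<longlonglongrightarrow> 0" by (rule Lim_transform_eventually[OF tendsto_const])
    qed
    show "AE x in lebesgue_on \<Omega>. norm (1 - \<kappa> n x) \<le> 1" for n
      using rng[of n] by (intro always_eventually allI) (simp add: abs_le_iff)
  qed (auto intro!: continuous_UNIV_measurable_lebesgue_on continuous_intros c\<kappa>)
  then have "\<forall>\<^sub>F n in sequentially. (\<integral>x. 1 - \<kappa> n x \<partial>lebesgue_on \<Omega>) < e"
    using order_tendstoD(2)[of _ 0 sequentially e] e by simp
  then obtain n where "(\<integral>x. 1 - \<kappa> n x \<partial>lebesgue_on \<Omega>) < e"
    using eventually_happens'[OF sequentially_bot] by blast
  then show ?thesis using cs K\<Omega> rng by (intro exI[of _ "K n"] exI[of _ "\<kappa> n"]) simp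
qed

lemma exists_sweep_radius:
  fixes K :: "'a::euclidean_space set"
  assumes "compact K" "open \<Omega>" "K \<subseteq> \<Omega>"
  shows "\<exists>r>0. \<forall>z. norm z \<le> r \<longrightarrow> sweep z K \<subseteq> \<Omega>"
proof -
  obtain r where r: "r > 0" "(\<Union>x\<in>K. cball x r) \<subseteq> \<Omega>"
    using compact_subset_open_imp_cball_epsilon_subset[OF assms] by blast
  have "sweep z K \<subseteq> \<Omega>" if z: "norm z \<le> r" for z
  proof
    fix p assume "p \<in> sweep z K"
    then obtain x s where x: "x \<in> K" and s: "s \<in> {0..1}" and p: "p = x + s *\<^sub>R z" unfolding sweep_def by auto
    have "norm (s *\<^sub>R z) \<le> 1 * norm z"
      unfolding norm_scaleR by (intro mult_right_mono) (use s in auto)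
    then have "p \<in> cball x r" using z by (simp add: p dist_norm)
    then show "p \<in> \<Omega>" using r(2) x by blast
  qed
  then show ?thesis using r(1) by blast
qed

text \<open>Averaging \<open>w (x + z)\<close> over small shifts \<open>z\<close> replaces \<open>\<integral> q w\<close> by the integral of \<open>w\<close> against a moving
  average of \<open>q\<close>; the moving average turns weak convergence of \<open>q\<close> into pointwise convergence.\<close>
lemma averaged_pairing:
  fixes w q :: "'a::euclidean_space \<Rightarrow> real"
  assumes \<Omega>: "open \<Omega>" and w: "continuous_on \<Omega> w" "\<And>x. x \<in> \<Omega> \<Longrightarrow> \<bar>w x\<bar> \<le> B" and B: "B \<ge> 0"
    and \<kappa>: "csupp K \<kappa>" "\<And>x. 0 \<le> \<kappa> x" and q: "q \<in> borel_measurable (lebesgue_on \<Omega>)"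
    and qA: "AE x in lebesgue_on \<Omega>. \<bar>q x\<bar> \<le> A * \<kappa> x" and A: "A \<ge> 0" and r: "r > 0"
    and sw: "\<And>z. norm z \<le> r \<Longrightarrow> sweep z K \<subseteq> \<Omega>"
    and \<delta>: "\<And>z. norm z \<le> r \<Longrightarrow> (\<integral>x. \<kappa> x * \<bar>w (x + z) - w x\<bar> \<partial>lebesgue_on \<Omega>) \<le> \<delta>"
  shows "\<bar>measure lborel (cball (0::'a) r) * (\<integral>x. q x * w x \<partial>lebesgue_on \<Omega>) -
      (\<integral>t. (if t \<in> \<Omega> then w t else 0) * (\<integral>x. q x * indicator (cball 0 r) (t - x) \<partial>lebesgue_on \<Omega>) \<partial>lborel)\<bar>
      \<le> measure lborel (cball (0::'a) r) * (A * \<delta>)"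
proof -
  have \<Omega>s: "\<Omega> \<in> sets lebesgue" using \<Omega> by auto
  define q0 where "q0 x = (if x \<in> \<Omega> then q x else 0)" for x
  define f where "f x = (if x \<in> \<Omega> then w x else 0)" for x
  define k :: "'a \<Rightarrow> real" where "k = indicator (cball 0 r)"
  let ?vol = "measure lborel (cball (0::'a) r)"
  have int_q: "integrable (lebesgue_on \<Omega>) q"
    by (rule Bochner_Integration.integrable_bound[of _ "\<lambda>x. A * \<kappa> x"])
      (use q csupp_integrable[OF \<kappa>(1) \<Omega>s] qA in \<open>auto elim!: eventually_mono\<close>)
  have int_q0: "integrable lebesgue q0"
    unfolding q0_def[abs_def] Lebesgue_Measure.integrable_restrict_UNIV[OF \<Omega>s] by (rule int_q)
  have f_eq: "f = (\<lambda>x. indicator \<Omega> x *\<^sub>R w x)" by (auto simp: f_def indicator_def fun_eq_iff)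
  have fm[measurable]: "f \<in> borel_measurable borel"
    unfolding f_eq by (intro borel_measurable_continuous_on_indicator w) (use \<Omega> in auto)
  have fB: "\<bar>f x\<bar> \<le> B" for x using w(2) B by (simp add: f_def)
  have km[measurable]: "k \<in> borel_measurable borel" unfolding k_def by (intro borel_measurable_indicator) simp
  have k_fin: "emeasure lborel (cball (0::'a) r) < \<infinity>"
    using emeasure_bounded_finite[OF bounded_cball] by simp
  have int_k: "integrable lborel k" and k_int: "integral\<^sup>L lborel k = ?vol"
    using k_fin unfolding k_def by (auto intro!: integrable_real_indicator)
  have to_\<Omega>: "(\<integral>x. q0 x * g x \<partial>lebesgue) = (\<integral>x. q x * g x \<partial>lebesgue_on \<Omega>)" for g
    unfolding Lebesgue_Measure.integral_restrict_UNIV[OF \<Omega>s, symmetric]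
    by (rule Bochner_Integration.integral_cong) (auto simp: q0_def)
  define I where "I z = (\<integral>x. q0 x * f (x + z) \<partial>lebesgue)" for z
  define I0 where "I0 = (\<integral>x. q x * w x \<partial>lebesgue_on \<Omega>)"
  have Im[measurable]: "I \<in> borel_measurable borel"
    unfolding I_def[abs_def]
    by (rule measurable_parametric_integral[OF borel_measurable_integrable[OF int_q0]]) simp
  have fmz: "(\<lambda>x. f (x + z)) \<in> borel_measurable (lebesgue_on \<Omega>)" for z
    by (intro measurable_restrict_space1 measurable_completion) simp
  have wm: "w \<in> borel_measurable (lebesgue_on \<Omega>)"
    by (rule continuous_imp_measurable_on_sets_lebesgue[OF w(1) \<Omega>s])
  have wB: "AE x in lebesgue_on \<Omega>. \<bar>w x\<bar> \<le> B"
    using w(2) by (intro AE_I2) simp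
  have i0: "integrable (lebesgue_on \<Omega>) (\<lambda>x. q x * w x)"
    by (rule integrable_mult_bounded[OF int_q wm wB])
  have iz: "integrable (lebesgue_on \<Omega>) (\<lambda>x. q x * f (x + z))" for z
    by (rule integrable_mult_bounded[OF int_q fmz, where C = B]) (simp add: fB)
  \<comment> \<open>Only points of \<open>K\<close> contribute, as \<open>q\<close> is dominated by
    \<open>A * \<kappa>\<close>; at such points the zero extension \<open>f\<close> agrees with
    \<open>w\<close> after the shift.\<close>
  have I_close: "\<bar>I0 - I z\<bar> \<le> A * \<delta>" if z: "norm z \<le> r" for z
  proof -
    have K': "K \<subseteq> \<Omega>" "(\<lambda>x. x + z) ` K \<subseteq> \<Omega>"
      using subset_sweep[where K = K and z = z] sw[OF z] by blast+
    have ik: "integrable (lebesgue_on \<Omega>) (\<lambda>x. \<kappa> x * \<bar>w (x + z) - w x\<bar>)"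
      by (rule csupp_integrable[OF csupp_mult_diff[OF \<kappa>(1) \<Omega> sw[OF z] w(1), where h = "\<lambda>a b. \<bar>a - b\<bar>"] \<Omega>s])
        (intro continuous_intros)
    have "I0 - I z = (\<integral>x. q x * w x - q x * f (x + z) \<partial>lebesgue_on \<Omega>)"
      unfolding I_def I0_def to_\<Omega> by (rule Bochner_Integration.integral_diff[OF i0 iz, symmetric])
    also have "\<bar>\<dots>\<bar> \<le> (\<integral>x. \<bar>q x * w x - q x * f (x + z)\<bar> \<partial>lebesgue_on \<Omega>)"
      by (rule integral_abs_bound)
    also have "\<dots> \<le> (\<integral>x. A * (\<kappa> x * \<bar>w (x + z) - w x\<bar>) \<partial>lebesgue_on \<Omega>)"
    proof (rule integral_mono_AE)
      show "AE x in lebesgue_on \<Omega>. \<bar>q x * w x - q x * f (x + z)\<bar> \<le> A * (\<kappa> x * \<bar>w (x + z) - w x\<bar>)"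
        using qA
      proof (rule eventually_mono)
        fix x assume q: "\<bar>q x\<bar> \<le> A * \<kappa> x"
        show "\<bar>q x * w x - q x * f (x + z)\<bar> \<le> A * (\<kappa> x * \<bar>w (x + z) - w x\<bar>)"
        proof (cases "x \<in> K")
          case True
          then have "f (x + z) = w (x + z)" using K' by (auto simp: f_def)
          then have "\<bar>q x * w x - q x * f (x + z)\<bar> = \<bar>q x\<bar> * \<bar>w (x + z) - w x\<bar>"
            by (simp add: abs_mult[symmetric] right_diff_distrib[symmetric] abs_minus_commute)
          also have "\<dots> \<le> (A * \<kappa> x) * \<bar>w (x + z) - w x\<bar>" by (intro mult_right_mono q) auto
          finally show ?thesis by (simp add: mult.assoc)
        next
          case False
          then have "\<kappa> x = 0" using \<kappa>(1) by (simp add: csupp_def)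
          then show ?thesis using q by simp
        qed
      qed
    qed (intro integrable_abs Bochner_Integration.integrable_diff i0 iz integrable_mult_right ik)+
    also have "\<dots> \<le> A * \<delta>" using \<delta>[OF z] A by (simp add: mult_left_mono)
    finally show ?thesis .
  qed
  have k01: "k z = (if norm z \<le> r then 1 else 0)" for z by (simp add: k_def indicator_def)
  have ikI: "integrable lborel (\<lambda>z. k z * I z)"
  proof (rule Bochner_Integration.integrable_bound[of _ "\<lambda>z. k z * (\<bar>I0\<bar> + A * \<delta>)"])
    show "AE z in lborel. norm (k z * I z) \<le> norm (k z * (\<bar>I0\<bar> + A * \<delta>))"
    proof (rule AE_I2)
      fix z show "norm (k z * I z) \<le> norm (k z * (\<bar>I0\<bar> + A * \<delta>))"
        using I_close[of z] by (auto simp: k01)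
    qed
  qed (use int_k in auto)
  \<comment> \<open>The correlation identity turns the integral of \<open>I z\<close> over the ball
    of shifts into an integral of \<open>f\<close> against the moving average of \<open>q\<close>.
    Since \<open>k\<close> has integral \<open>?vol\<close>, closeness of \<open>I z\<close> to
    \<open>I0\<close> passes to the integral.\<close>
  have "?vol * I0 - (\<integral>t. f t * (\<integral>x. q x * k (t - x) \<partial>lebesgue_on \<Omega>) \<partial>lborel) = ?vol * I0 - (\<integral>z. k z * I z \<partial>lborel)"
    using integral_correlation[OF int_q0 int_k fm fB] unfolding I_def to_\<Omega> by simp
  also have "\<dots> = (\<integral>z. k z * I0 - k z * I z \<partial>lborel)"
    using Bochner_Integration.integral_diff[OF integrable_mult_left[OF int_k, of I0] ikI] by (simp add: k_int)
  also have "\<bar>\<dots>\<bar> \<le> (\<integral>z. k z * (A * \<delta>) \<partial>lborel)"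
  proof (rule integral_abs_bound_integral)
    show "\<bar>k z * I0 - k z * I z\<bar> \<le> k z * (A * \<delta>)" for z
      using I_close[of z] by (auto simp: k01)
  qed (use int_k ikI in auto)
  also have "\<dots> = ?vol * (A * \<delta>)" by (simp add: k_int)
  finally show ?thesis unfolding I0_def f_def k_def .
qed

lemma moving_average:
  fixes q k :: "'a::euclidean_space \<Rightarrow> real"
  assumes \<Omega>: "open \<Omega>" and q: "integrable (lebesgue_on \<Omega>) q"
    and k[measurable]: "k \<in> borel_measurable borel" and k01: "\<And>x. 0 \<le> k x" "\<And>x. k x \<le> 1"
  shows "(\<lambda>t. \<integral>x. q x * k (t - x) \<partial>lebesgue_on \<Omega>) \<in> borel_measurable borel"
    and "\<bar>\<integral>x. q x * k (t - x) \<partial>lebesgue_on \<Omega>\<bar> \<le> (\<integral>x. \<bar>q x\<bar> \<partial>lebesgue_on \<Omega>)"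
proof -
  have \<Omega>s: "\<Omega> \<in> sets lebesgue" using \<Omega> by auto
  define q0 where "q0 x = (if x \<in> \<Omega> then q x else 0)" for x
  have int_q0: "integrable lebesgue q0"
    unfolding q0_def[abs_def] Lebesgue_Measure.integrable_restrict_UNIV[OF \<Omega>s] by (rule q)
  have to_\<Omega>: "(\<integral>x. q0 x * g x \<partial>lebesgue) = (\<integral>x. q x * g x \<partial>lebesgue_on \<Omega>)" for g
    unfolding Lebesgue_Measure.integral_restrict_UNIV[OF \<Omega>s, symmetric]
    by (rule Bochner_Integration.integral_cong) (auto simp: q0_def)
  show "(\<lambda>t. \<integral>x. q x * k (t - x) \<partial>lebesgue_on \<Omega>) \<in> borel_measurable borel"
    unfolding to_\<Omega>[symmetric]
    by (rule measurable_parametric_integral[OF borel_measurable_integrable[OF int_q0]]) simp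
  have km: "(\<lambda>x. k (t - x)) \<in> borel_measurable (lebesgue_on \<Omega>)" for t
    by (intro measurable_restrict_space1 measurable_completion) simp
  have int: "integrable (lebesgue_on \<Omega>) (\<lambda>x. q x * k (t - x))" for t
    by (rule integrable_mult_bounded[OF q km, where C = 1]) (simp add: k01 abs_le_iff order_trans[OF _ k01(1)])
  show "\<bar>\<integral>x. q x * k (t - x) \<partial>lebesgue_on \<Omega>\<bar> \<le> (\<integral>x. \<bar>q x\<bar> \<partial>lebesgue_on \<Omega>)"
    by (rule integral_abs_bound_integral[OF int integrable_abs[OF q]])
      (use k01 in \<open>auto simp: abs_mult intro!: mult_left_le\<close>)
qed

text \<open>Both factors vary with \<open>n\<close>, so weak convergence of \<open>h\<close> alone
  does not suffice; the gradient bound on \<open>v\<close> supplies the missing equicontinuity in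
  L^1. The error is split into three parts of size \<open>e / 3\<close>: the boundary strip, the
  averaging, and the averaged pairing \<open>J n\<close>.\<close>

lemma pairing_tendsto_0:
  fixes v h :: "nat \<Rightarrow> real^'n \<Rightarrow> real" and V :: "nat \<Rightarrow> real^'n \<Rightarrow> real^'n"
  assumes \<Omega>: "open \<Omega>" "bounded \<Omega>" and wd: "\<And>n. weak_diff \<Omega> (v n) (V n)"
    and v: "\<And>n. continuous_on \<Omega> (v n)" "\<And>n x. x \<in> \<Omega> \<Longrightarrow> \<bar>v n x\<bar> \<le> B" and B: "B > 0"
    and C: "\<And>n. grad_mass \<Omega> (V n) \<le> C"
    and h: "\<And>n. h n \<in> borel_measurable (lebesgue_on \<Omega>)" "\<And>n. AE x in lebesgue_on \<Omega>. \<bar>h n x\<bar> \<le> H" and H: "H > 0"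
    and conv: "\<And>g. g \<in> borel_measurable (lebesgue_on \<Omega>) \<Longrightarrow> (\<And>x. \<bar>g x\<bar> \<le> 1) \<Longrightarrow>
        (\<lambda>n. \<integral>x. h n x * g x \<partial>lebesgue_on \<Omega>) \<longlonglongrightarrow> 0"
  shows "(\<lambda>n. \<integral>x. h n x * v n x \<partial>lebesgue_on \<Omega>) \<longlonglongrightarrow> 0"
proof (rule tendsto_rabs_zero_cancel, rule order_tendstoI)
  show "\<forall>\<^sub>F n in sequentially. a < \<bar>\<integral>x. h n x * v n x \<partial>lebesgue_on \<Omega>\<bar>" if "a < 0" for a
    using that by (intro always_eventually) (auto intro: less_le_trans)
next
  fix e :: real assume e: "0 < e"
  have \<Omega>s: "\<Omega> \<in> sets lebesgue" using \<Omega> by auto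
  interpret finite_measure "lebesgue_on \<Omega>"
    by (rule finite_measure_lebesgue_on[OF bounded_set_imp_lmeasurable[OF \<Omega>(2) \<Omega>s]])
  have C0: "C \<ge> 0" using C[of 0] grad_mass_nonneg[of \<Omega> "V 0"] by linarith
  \<comment> \<open>On the strip the product of \<open>h\<close> and \<open>v\<close> is bounded by
    \<open>H * B\<close>.\<close>
  have "e / (3 * H * B) > 0" using e H B by simp
  then obtain K \<kappa> where \<kappa>: "csupp K \<kappa>" "K \<subseteq> \<Omega>" "\<And>x. 0 \<le> \<kappa> x" "\<And>x. \<kappa> x \<le> 1"
    and \<kappa>e: "(\<integral>x. 1 - \<kappa> x \<partial>lebesgue_on \<Omega>) < e / (3 * H * B)"
    using exists_cutoff[OF \<Omega>] by metis
  have cK: "compact K" using \<kappa>(1) by (simp add: csupp_def)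
  obtain r0 where r0: "r0 > 0" "\<And>z. norm z \<le> r0 \<Longrightarrow> sweep z K \<subseteq> \<Omega>"
    using exists_sweep_radius[OF cK \<Omega>(1) \<kappa>(2)] by metis
  \<comment> \<open>A shift of length at most \<open>r\<close> changes the pairing by at most
    \<open>H * (r * C)\<close>; \<open>C + 1\<close> avoids division by zero.\<close>
  define r where "r = min r0 (e / (3 * H * (C + 1)))"
  have r: "r > 0" "\<And>z. norm z \<le> r \<Longrightarrow> sweep z K \<subseteq> \<Omega>" "r \<le> e / (3 * H * (C + 1))"
    using r0 e H C0 by (auto simp: r_def)
  have rC: "H * (r * C) \<le> e / 3"
  proof -
    have "r * (3 * H * (C + 1)) \<le> e" using r(3) H C0 by (subst (asm) pos_le_divide_eq) auto
    moreover have "3 * (H * (r * C)) \<le> r * (3 * H * (C + 1))" using H r(1) by (simp add: algebra_simps)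
    ultimately show ?thesis by simp
  qed
  let ?vol = "measure lborel (cball (0::real^'n) r)"
  have vol: "?vol > 0" using r(1) by (simp add: content_cball_pos)
  define q where "q n x = h n x * \<kappa> x" for n x
  define k :: "real^'n \<Rightarrow> real" where "k = indicator (cball 0 r)"
  have km[measurable]: "k \<in> borel_measurable borel" unfolding k_def by (intro borel_measurable_indicator) simp
  have k01: "0 \<le> k x" "k x \<le> 1" for x by (auto simp: k_def indicator_def)
  have \<kappa>m: "\<kappa> \<in> borel_measurable (lebesgue_on \<Omega>)"
    using \<kappa>(1) by (intro continuous_UNIV_measurable_lebesgue_on) (simp add: csupp_def)
  have int_h: "integrable (lebesgue_on \<Omega>) (h n)" for n
    by (rule integrable_const_bound[where B = H]) (use h in auto)
  have int_q: "integrable (lebesgue_on \<Omega>) (q n)" for n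
    unfolding q_def[abs_def] by (rule integrable_mult_csupp[OF int_h \<kappa>(1)])
  have qA: "AE x in lebesgue_on \<Omega>. \<bar>q n x\<bar> \<le> H * \<kappa> x" for n
    using h(2)[of n] by (rule eventually_mono) (simp add: q_def abs_mult \<kappa>(3) mult_right_mono)
  have qH: "AE x in lebesgue_on \<Omega>. \<bar>q n x\<bar> \<le> H" for n
    using qA[of n]
  proof (rule eventually_mono)
    fix x assume "\<bar>q n x\<bar> \<le> H * \<kappa> x"
    also have "\<dots> \<le> H * 1" using H \<kappa>(4) by (intro mult_left_mono) auto
    finally show "\<bar>q n x\<bar> \<le> H" by simp
  qed
  define f where "f n x = (if x \<in> \<Omega> then v n x else 0)" for n x
  define Q where "Q n t = (\<integral>x. q n x * k (t - x) \<partial>lebesgue_on \<Omega>)" for n t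
  define J where "J n = (\<integral>t. f n t * Q n t \<partial>lborel)" for n
  have f_eq: "f n = (\<lambda>x. indicator \<Omega> x *\<^sub>R v n x)" for n by (auto simp: f_def indicator_def fun_eq_iff)
  have fm[measurable]: "f n \<in> borel_measurable borel" for n
    unfolding f_eq by (intro borel_measurable_continuous_on_indicator v) (use \<Omega> in auto)
  have Qm[measurable]: "Q n \<in> borel_measurable borel" for n
    unfolding Q_def[abs_def] by (rule moving_average(1)[OF \<Omega>(1) int_q km k01])
  define m where "m = measure (lebesgue_on \<Omega>) (space (lebesgue_on \<Omega>))"
  have QB: "\<bar>Q n t\<bar> \<le> H * m" for n t
  proof -
    have "\<bar>Q n t\<bar> \<le> (\<integral>x. \<bar>q n x\<bar> \<partial>lebesgue_on \<Omega>)"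
      unfolding Q_def by (rule moving_average(2)[OF \<Omega>(1) int_q km k01])
    also have "\<dots> \<le> (\<integral>x. H \<partial>lebesgue_on \<Omega>)"
      by (rule integral_mono_AE[OF integrable_abs[OF int_q] _ qH]) simp
    finally show ?thesis by (simp add: m_def mult.commute)
  qed
  have ind_int: "integrable lborel (indicator \<Omega> :: real^'n \<Rightarrow> real)"
    using emeasure_bounded_finite[OF \<Omega>(2)] \<Omega>(1) by (intro integrable_real_indicator) auto
  have "J \<longlonglongrightarrow> (\<integral>t. 0 \<partial>(lborel :: (real^'n) measure))"
    unfolding J_def
  proof (rule integral_dominated_convergence[where w = "\<lambda>t. indicator \<Omega> t * (B * (H * m))"])
    show "AE t in lborel. (\<lambda>n. f n t * Q n t) \<longlonglongrightarrow> 0"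
    proof (rule AE_I2)
      fix t
      \<comment> \<open>For fixed \<open>t\<close> the localised kernel is one fixed bounded test
        function, so the moving averages \<open>Q n t\<close> tend to 0 at every point. Their common
        bound \<open>H * m\<close> then allows dominated convergence.\<close>
      have "(\<lambda>n. \<integral>x. h n x * (\<kappa> x * k (t - x)) \<partial>lebesgue_on \<Omega>) \<longlonglongrightarrow> 0"
      proof (rule conv)
        have "(\<lambda>x. k (t - x)) \<in> borel_measurable (lebesgue_on \<Omega>)"
          by (intro measurable_restrict_space1 measurable_completion) simp
        then show "(\<lambda>x. \<kappa> x * k (t - x)) \<in> borel_measurable (lebesgue_on \<Omega>)" using \<kappa>m by simp
        show "\<bar>\<kappa> x * k (t - x)\<bar> \<le> 1" for x
          using \<kappa>(3,4) k01 by (simp add: abs_mult mult_le_one)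
      qed
      then have Q0: "(\<lambda>n. Q n t) \<longlonglongrightarrow> 0" by (simp add: Q_def q_def mult.assoc)
      show "(\<lambda>n. f n t * Q n t) \<longlonglongrightarrow> 0"
      proof (rule Lim_null_comparison[OF always_eventually])
        show "\<forall>n. norm (f n t * Q n t) \<le> B * \<bar>Q n t\<bar>"
          using v(2) B by (auto simp: f_def abs_mult intro!: mult_right_mono)
        show "(\<lambda>n. B * \<bar>Q n t\<bar>) \<longlonglongrightarrow> 0"
          using tendsto_mult[OF tendsto_const[of B] tendsto_rabs_zero[OF Q0]] by simp
      qed
    qed
    show "AE t in lborel. norm (f n t * Q n t) \<le> indicator \<Omega> t * (B * (H * m))" for n
    proof (rule AE_I2)
      fix t show "norm (f n t * Q n t) \<le> indicator \<Omega> t * (B * (H * m))"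
        using v(2)[of t n] B QB[of n t] by (auto simp: f_def abs_mult intro!: mult_mono)
    qed
  qed (use ind_int in auto)
  then have "J \<longlonglongrightarrow> 0" by simp
  from tendsto_rabs_zero[OF this] have "\<forall>\<^sub>F n in sequentially. \<bar>J n\<bar> < ?vol * (e / 3)"
    by (rule order_tendstoD(2)) (use vol e in simp)
  then show "\<forall>\<^sub>F n in sequentially. \<bar>\<integral>x. h n x * v n x \<partial>lebesgue_on \<Omega>\<bar> < e"
  proof (rule eventually_mono)
    fix n assume Jn: "\<bar>J n\<bar> < ?vol * (e / 3)"
    interpret weak_diff \<Omega> "v n" "V n" by (rule wd)
    let ?q = "\<integral>x. q n x * v n x \<partial>lebesgue_on \<Omega>"
    have vm: "v n \<in> borel_measurable (lebesgue_on \<Omega>)"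
      by (rule continuous_imp_measurable_on_sets_lebesgue[OF v(1) \<Omega>s])
    have vB: "AE x in lebesgue_on \<Omega>. \<bar>v n x\<bar> \<le> B" using v(2) by (intro AE_I2) simp
    have "\<bar>?vol * ?q - J n\<bar> \<le> ?vol * (H * (r * C))"
      unfolding J_def f_def Q_def k_def
    proof (rule averaged_pairing[OF \<Omega>(1) v(1) v(2) _ \<kappa>(1,3) borel_measurable_integrable[OF int_q] qA _ r(1,2)])
      fix z :: "real^'n" assume z: "norm z \<le> r"
      have "(\<integral>x. \<kappa> x * \<bar>v n (x + z) - v n x\<bar> \<partial>lebesgue_on \<Omega>) \<le> norm z * 1 * grad_mass \<Omega> (V n)"
        by (rule integral_abs_diff_translate_le[OF \<kappa>(1,3,4) r(2)[OF z] v(1)])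
      also have "\<dots> \<le> r * C"
        using z C[of n] r(1) grad_mass_nonneg[of \<Omega> "V n"] by (intro mult_mono) auto
      finally show "(\<integral>x. \<kappa> x * \<bar>v n (x + z) - v n x\<bar> \<partial>lebesgue_on \<Omega>) \<le> r * C" .
    qed (use B H in auto)
    then have "\<bar>?vol * ?q\<bar> < ?vol * (e / 3) + ?vol * (H * (r * C))" using Jn by linarith
    also have "\<dots> \<le> ?vol * (e / 3) + ?vol * (e / 3)" using rC vol by simp
    also have "\<dots> = ?vol * (2 * e / 3)" by (simp add: algebra_simps)
    finally have "?vol * \<bar>?q\<bar> < ?vol * (2 * e / 3)" using vol by (simp add: abs_mult)
    then have q_small: "\<bar>?q\<bar> < 2 * e / 3" using vol mult_less_cancel_left_pos by blast
    have i1: "integrable (lebesgue_on \<Omega>) (\<lambda>x. h n x * v n x)"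
      by (rule integrable_mult_bounded[OF int_h vm vB])
    have i2: "integrable (lebesgue_on \<Omega>) (\<lambda>x. q n x * v n x)"
      by (rule integrable_mult_bounded[OF int_q vm vB])
    have "\<bar>(\<integral>x. h n x * v n x \<partial>lebesgue_on \<Omega>) - ?q\<bar> = \<bar>\<integral>x. h n x * v n x - q n x * v n x \<partial>lebesgue_on \<Omega>\<bar>"
      by (simp add: Bochner_Integration.integral_diff[OF i1 i2])
    also have "\<dots> \<le> (\<integral>x. \<bar>h n x * v n x - q n x * v n x\<bar> \<partial>lebesgue_on \<Omega>)"
      by (rule integral_abs_bound)
    also have "\<dots> \<le> (\<integral>x. (H * B) * (1 - \<kappa> x) \<partial>lebesgue_on \<Omega>)"
    proof (rule integral_mono_AE)
      show "AE x in lebesgue_on \<Omega>. \<bar>h n x * v n x - q n x * v n x\<bar> \<le> (H * B) * (1 - \<kappa> x)"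
        using h(2)[of n] vB
      proof eventually_elim
        case (elim x)
        have "h n x * v n x - q n x * v n x = h n x * v n x * (1 - \<kappa> x)" by (simp add: q_def algebra_simps)
        also have "\<bar>\<dots>\<bar> = \<bar>h n x\<bar> * \<bar>v n x\<bar> * (1 - \<kappa> x)" using \<kappa>(4)[of x] by (simp add: abs_mult)
        also have "\<dots> \<le> (H * B) * (1 - \<kappa> x)"
          using elim \<kappa>(4)[of x] H by (intro mult_right_mono mult_mono) auto
        finally show ?case .
      qed
      show "integrable (lebesgue_on \<Omega>) (\<lambda>x. (H * B) * (1 - \<kappa> x))"
        by (intro integrable_mult_right Bochner_Integration.integrable_diff csupp_integrable[OF \<kappa>(1) \<Omega>s]) simp
    qed (intro integrable_abs Bochner_Integration.integrable_diff i1 i2)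
    also have "\<dots> = (H * B) * (\<integral>x. 1 - \<kappa> x \<partial>lebesgue_on \<Omega>)" by simp
    also have "\<dots> < (H * B) * (e / (3 * H * B))"
      using \<kappa>e H B by (intro mult_strict_left_mono) auto
    also have "\<dots> = e / 3" using H B by simp
    finally show "\<bar>\<integral>x. h n x * v n x \<partial>lebesgue_on \<Omega>\<bar> < e" using q_small by linarith
  qed
qed

section \<open>Functions with vanishing gradient\<close>

text \<open>Tents play the part of indicators of balls; they are continuous, as the translation
  estimates require of a weight.\<close>

definition tent :: "'a::euclidean_space \<Rightarrow> real \<Rightarrow> 'a \<Rightarrow> real" where
  "tent a r x = max 0 (1 - dist a x / r)"

lemma tent_nonneg: "0 \<le> tent a r x" by (simp add: tent_def)

lemma tent_le_1: "r > 0 \<Longrightarrow> tent a r x \<le> 1" by (simp add: tent_def)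

lemma tent_pos: "r > 0 \<Longrightarrow> dist a x < r \<Longrightarrow> 0 < tent a r x"
  by (simp add: tent_def less_max_iff_disj)

lemma csupp_tent: "r > 0 \<Longrightarrow> csupp (cball a r) (tent a r)"
  unfolding csupp_def tent_def[abs_def] by (auto intro!: continuous_intros)

lemma tent_mono: "0 < r \<Longrightarrow> r \<le> r' \<Longrightarrow> tent a r x \<le> tent a r' x"
  unfolding tent_def by (intro max.mono diff_left_mono divide_left_mono) auto

lemma tent_shift: "tent b r x = tent a r (x - (b - a))"
  by (simp add: tent_def dist_norm algebra_simps)

lemma csupp_mult_on:
  assumes "csupp K \<phi>" "open U" "K \<subseteq> U" "continuous_on U (h :: 'a::euclidean_space \<Rightarrow> real)" "S \<in> sets lebesgue"
  shows "integrable (lebesgue_on S) (\<lambda>x. \<phi> x * h x)"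
  by (rule csupp_integrable[OF csupp_mult[OF assms(1-4)] assms(5)])

text \<open>The tent at \<open>b\<close> is a translate of the tent at \<open>a\<close>. After a
  change of variables the triangle inequality leaves only the increment of \<open>w\<close>, which
  the gradient mass controls.\<close>

lemma (in weak_diff) tent_integral_shift:
  assumes w: "continuous_on \<Omega> w" and r: "r > 0" and sw: "sweep (b - a) (cball a r) \<subseteq> \<Omega>"
  shows "(\<integral>x. tent b r x * \<bar>w x\<bar> \<partial>lebesgue_on \<Omega>) \<le> (\<integral>x. tent a r x * \<bar>w x\<bar> \<partial>lebesgue_on \<Omega>) + norm (b - a) * grad_mass \<Omega> G"
proof -
  let ?z = "b - a"
  have K: "cball a r \<subseteq> \<Omega>" "(\<lambda>x. x + ?z) ` cball a r \<subseteq> \<Omega>"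
    using subset_sweep[where K = "cball a r" and z = ?z] sw by blast+
  note cs = csupp_tent[OF r, of a]
  have i1: "integrable (lebesgue_on \<Omega>) (\<lambda>x. tent a r x * \<bar>w x\<bar>)"
    by (rule csupp_mult_on[OF cs open_\<Omega> K(1) _ \<Omega>_sets(1)]) (intro continuous_intros w)
  have i2: "integrable (lebesgue_on \<Omega>) (\<lambda>x. tent a r x * \<bar>w (x + ?z) - w x\<bar>)"
    by (rule csupp_integrable[OF csupp_mult_diff[OF cs open_\<Omega> sw w, where h = "\<lambda>a b. \<bar>a - b\<bar>"] \<Omega>_sets(1)])
      (intro continuous_intros)
  have "(\<integral>x. tent b r x * \<bar>w x\<bar> \<partial>lebesgue_on \<Omega>) = (\<integral>x. \<bar>w x\<bar> * tent a r (x - ?z) \<partial>lebesgue_on \<Omega>)"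
    using tent_shift[of b r _ a] by (simp add: mult.commute)
  also have "\<dots> = (\<integral>x. tent a r x * \<bar>w (x + ?z)\<bar> \<partial>lebesgue_on \<Omega>)"
    by (rule integral_translate_csupp(2)[OF \<Omega>_sets(1) integrable_abs[OF int_w] cs K])
  also have "\<dots> \<le> (\<integral>x. tent a r x * \<bar>w x\<bar> + tent a r x * \<bar>w (x + ?z) - w x\<bar> \<partial>lebesgue_on \<Omega>)"
  proof (rule integral_mono)
    show "integrable (lebesgue_on \<Omega>) (\<lambda>x. tent a r x * \<bar>w (x + ?z)\<bar>)"
      by (rule integral_translate_csupp(1)[OF \<Omega>_sets(1) integrable_abs[OF int_w] cs K])
    show "tent a r x * \<bar>w (x + ?z)\<bar> \<le> tent a r x * \<bar>w x\<bar> + tent a r x * \<bar>w (x + ?z) - w x\<bar>" for x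
      unfolding distrib_left[symmetric] by (intro mult_left_mono tent_nonneg) simp
  qed (intro Bochner_Integration.integrable_add i1 i2)
  also have "\<dots> = (\<integral>x. tent a r x * \<bar>w x\<bar> \<partial>lebesgue_on \<Omega>) + (\<integral>x. tent a r x * \<bar>w (x + ?z) - w x\<bar> \<partial>lebesgue_on \<Omega>)"
    by (rule Bochner_Integration.integral_add[OF i1 i2])
  also have "(\<integral>x. tent a r x * \<bar>w (x + ?z) - w x\<bar> \<partial>lebesgue_on \<Omega>) \<le> norm ?z * 1 * grad_mass \<Omega> G"
    by (rule integral_abs_diff_translate_le[OF cs tent_nonneg tent_le_1[OF r] sw w])
  finally show ?thesis by simp
qed

lemma negligible_of_AE:
  assumes "AE x in lebesgue_on S. P x" "S \<in> sets lebesgue"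
  shows "negligible {x \<in> S. \<not> P x}"
proof -
  have "AE x in lebesgue. x \<in> S \<longrightarrow> P x" using assms by (simp add: AE_restrict_space_iff)
  from AE_E[OF this] obtain N
    where N: "{x \<in> space lebesgue. \<not> (x \<in> S \<longrightarrow> P x)} \<subseteq> N" "emeasure lebesgue N = 0" "N \<in> sets lebesgue" .
  have "negligible N" using N(2,3) by (simp add: negligible_iff_null_sets null_sets_def)
  then show ?thesis by (rule negligible_subset) (use N(1) in auto)
qed

lemma AE_of_negligible:
  assumes "negligible {x \<in> S. \<not> P x}" "S \<in> sets lebesgue"
  shows "AE x in lebesgue_on S. P x"
proof -
  have "AE x in lebesgue. x \<notin> {x \<in> S. \<not> P x}"
    by (rule AE_not_in) (use assms(1) in \<open>simp add: negligible_iff_null_sets\<close>)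
  then have "AE x in lebesgue. x \<in> S \<longrightarrow> P x" by (rule eventually_mono) auto
  then show ?thesis using assms by (simp add: AE_restrict_space_iff)
qed

text \<open>If all these integrals were zero, \<open>a\<close> would vanish almost everywhere near
  each point, and a locally negligible set is negligible.\<close>

lemma exists_tent_integral_pos:
  fixes \<Omega> :: "'a::euclidean_space set"
  assumes \<Omega>: "open \<Omega>" and am: "a \<in> borel_measurable (lebesgue_on \<Omega>)"
    and a: "AE x in lebesgue_on \<Omega>. 0 \<le> a x" "AE x in lebesgue_on \<Omega>. a x \<le> A"
    and nz: "\<not> (AE x in lebesgue_on \<Omega>. a x = 0)"
  shows "\<exists>x r. r > 0 \<and> cball x (3 * r) \<subseteq> \<Omega> \<and> (\<integral>y. tent x r y * a y \<partial>lebesgue_on \<Omega>) > 0"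
proof (rule ccontr)
  assume neg: "\<not> ?thesis"
  have \<Omega>s: "\<Omega> \<in> sets lebesgue" using \<Omega> by auto
  have aA: "AE x in lebesgue_on \<Omega>. \<bar>a x\<bar> \<le> A" using a by eventually_elim simp
  have "negligible {x \<in> \<Omega>. \<not> a x = 0}"
  proof (rule locally_negligible_alt[THEN iffD2], rule ballI)
    fix x assume x: "x \<in> {x \<in> \<Omega>. \<not> a x = 0}"
    then have "x \<in> \<Omega>" by simp
    then obtain e where e: "e > 0" "cball x e \<subseteq> \<Omega>" using \<Omega> unfolding open_contains_cball by metis
    \<comment> \<open>The ball of radius \<open>3 * r\<close> leaves room to shift the ball of
      radius \<open>r\<close> by up to \<open>2 * r\<close>, as \<open>local_vanishing\<close>
      does.\<close>
    define r where "r = e / 3"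
    have r: "r > 0" "cball x (3 * r) \<subseteq> \<Omega>" using e by (auto simp: r_def)
    have int: "integrable (lebesgue_on \<Omega>) (\<lambda>y. tent x r y * a y)"
      by (rule integrable_mult_bounded[OF csupp_integrable[OF csupp_tent[OF r(1)] \<Omega>s] am aA])
    have nn: "AE y in lebesgue_on \<Omega>. 0 \<le> tent x r y * a y"
      using a(1) by (rule eventually_mono) (simp add: tent_nonneg)
    have "(\<integral>y. tent x r y * a y \<partial>lebesgue_on \<Omega>) = 0"
      using neg r integral_nonneg_AE[OF nn] by (metis antisym_conv2)
    then have "AE y in lebesgue_on \<Omega>. tent x r y * a y = 0"
      using integral_nonneg_eq_0_iff_AE[OF int nn] by simp
    from negligible_of_AE[OF this \<Omega>s] have n: "negligible {y \<in> \<Omega>. tent x r y * a y \<noteq> 0}" by simp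
    have "negligible ({x \<in> \<Omega>. \<not> a x = 0} \<inter> ball x r)"
    proof (rule negligible_subset[OF n], rule subsetI)
      fix y assume "y \<in> {x \<in> \<Omega>. \<not> a x = 0} \<inter> ball x r"
      then show "y \<in> {y \<in> \<Omega>. tent x r y * a y \<noteq> 0}" using tent_pos[OF r(1), of x y] by auto
    qed
    then show "\<exists>U. openin (top_of_set {x \<in> \<Omega>. \<not> a x = 0}) U \<and> x \<in> U \<and> negligible U"
      using x r(1) by (intro exI[of _ "{x \<in> \<Omega>. \<not> a x = 0} \<inter> ball x r"]) auto
  qed
  from AE_of_negligible[OF this \<Omega>s] nz show False by simp
qed

text \<open>A Poincare argument by chaining. The property \<open>P\<close>, that some tent integral
  around the point tends to 0, holds at a point near which \<open>a\<close> has positive mass. It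
  passes between nearby points because the gradient mass tends to 0, so it is locally constant and
  connectedness spreads it.\<close>

lemma local_vanishing:
  fixes v :: "nat \<Rightarrow> real^'n \<Rightarrow> real" and V :: "nat \<Rightarrow> real^'n \<Rightarrow> real^'n"
  assumes \<Omega>: "open \<Omega>" "bounded \<Omega>" "connected \<Omega>" and wd: "\<And>n. weak_diff \<Omega> (v n) (V n)"
    and v: "\<And>n. continuous_on \<Omega> (v n)" "\<And>n x. x \<in> \<Omega> \<Longrightarrow> \<bar>v n x\<bar> \<le> B" and B: "B > 0"
    and C: "(\<lambda>n. grad_mass \<Omega> (V n)) \<longlonglongrightarrow> 0"
    and am: "a \<in> borel_measurable (lebesgue_on \<Omega>)"
    and a: "AE x in lebesgue_on \<Omega>. 0 \<le> a x" "AE x in lebesgue_on \<Omega>. a x \<le> A" and A: "A \<ge> 0"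
    and nz: "\<not> (AE x in lebesgue_on \<Omega>. a x = 0)"
    and av: "(\<lambda>n. \<integral>x. a x * \<bar>v n x\<bar> \<partial>lebesgue_on \<Omega>) \<longlonglongrightarrow> 0"
    and x: "x \<in> \<Omega>"
  shows "\<exists>r>0. cball x r \<subseteq> \<Omega> \<and> (\<lambda>n. \<integral>y. tent x r y * \<bar>v n y\<bar> \<partial>lebesgue_on \<Omega>) \<longlonglongrightarrow> 0"
proof -
  have \<Omega>s: "\<Omega> \<in> sets lebesgue" using \<Omega> by auto
  define P where "P x \<longleftrightarrow> (\<exists>r>0. cball x r \<subseteq> \<Omega> \<and> (\<lambda>n. \<integral>y. tent x r y * \<bar>v n y\<bar> \<partial>lebesgue_on \<Omega>) \<longlonglongrightarrow> 0)" for x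
  have int_t: "integrable (lebesgue_on \<Omega>) (\<lambda>y. tent x r y * \<bar>v n y\<bar>)" if "r > 0" "cball x r \<subseteq> \<Omega>" for x r n
    by (rule csupp_mult_on[OF csupp_tent[OF that(1)] \<Omega>(1) that(2) _ \<Omega>s]) (intro continuous_intros v)
  have nn: "0 \<le> (\<integral>y. tent x r y * \<bar>v n y\<bar> \<partial>lebesgue_on \<Omega>)" for x r n
    by (intro Bochner_Integration.integral_nonneg mult_nonneg_nonneg tent_nonneg abs_ge_zero)
  have mono: "(\<lambda>n. \<integral>y. tent x r y * \<bar>v n y\<bar> \<partial>lebesgue_on \<Omega>) \<longlonglongrightarrow> 0"
    if r: "0 < r" "r \<le> r'" and c: "cball x r' \<subseteq> \<Omega>"
      and l: "(\<lambda>n. \<integral>y. tent x r' y * \<bar>v n y\<bar> \<partial>lebesgue_on \<Omega>) \<longlonglongrightarrow> 0" for x r r'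
  proof (rule tendsto_sandwich[OF always_eventually always_eventually tendsto_const l]; intro allI)
    fix n
    have "cball x r \<subseteq> \<Omega>" using r c by (auto intro: subset_cball[THEN subset_trans])
    then show "(\<integral>y. tent x r y * \<bar>v n y\<bar> \<partial>lebesgue_on \<Omega>) \<le> (\<integral>y. tent x r' y * \<bar>v n y\<bar> \<partial>lebesgue_on \<Omega>)"
      using r c by (intro integral_mono int_t mult_right_mono tent_mono) auto
  qed (rule nn)
  \<comment> \<open>A tent at \<open>a\<close> of radius at most \<open>\<rho>\<close> moves along
    the segment to \<open>b\<close>: the segment stays in the ball of radius \<open>\<rho>\<close>
    around \<open>c\<close>, hence all the supports stay in the ball of twice that radius.\<close>
  have step: "P b" if Pa: "P a" and ab: "a \<in> ball c \<rho>" "b \<in> ball c \<rho>" and c: "cball c (2 * \<rho>) \<subseteq> \<Omega>" for a b c \<rho>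
  proof -
    have \<rho>: "\<rho> > 0" using ab(1) by (auto intro: le_less_trans[OF zero_le_dist])
    obtain r0 where r0: "r0 > 0" "cball a r0 \<subseteq> \<Omega>" "(\<lambda>n. \<integral>y. tent a r0 y * \<bar>v n y\<bar> \<partial>lebesgue_on \<Omega>) \<longlonglongrightarrow> 0"
      using Pa unfolding P_def by blast
    define r where "r = min r0 \<rho>"
    have r: "r > 0" "r \<le> r0" "r \<le> \<rho>" using r0(1) \<rho> by (auto simp: r_def)
    have sw: "sweep (b - a) (cball a r) \<subseteq> \<Omega>"
    proof
      fix p assume "p \<in> sweep (b - a) (cball a r)"
      then obtain y s where y: "dist a y \<le> r" and s: "s \<in> {0..1}" and p: "p = y + s *\<^sub>R (b - a)"
        unfolding sweep_def by auto
      have "(1 - s) *\<^sub>R a + s *\<^sub>R b \<in> ball c \<rho>"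
        by (rule convexD_alt[OF convex_ball ab]) (use s in auto)
      then have "dist c ((1 - s) *\<^sub>R a + s *\<^sub>R b) < \<rho>" by simp
      moreover have "dist ((1 - s) *\<^sub>R a + s *\<^sub>R b) p = dist a y"
        by (simp add: p dist_norm algebra_simps)
      ultimately have "dist c p \<le> 2 * \<rho>"
        using dist_triangle[of c p "(1 - s) *\<^sub>R a + s *\<^sub>R b"] y r(3) by linarith
      then show "p \<in> \<Omega>" using c by auto
    qed
    have "(\<lambda>n. \<integral>y. tent b r y * \<bar>v n y\<bar> \<partial>lebesgue_on \<Omega>) \<longlonglongrightarrow> 0"
    proof (rule tendsto_sandwich[OF always_eventually always_eventually tendsto_const]; (intro allI)?)
      fix n
      interpret weak_diff \<Omega> "v n" "V n" by (rule wd)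
      show "(\<integral>y. tent b r y * \<bar>v n y\<bar> \<partial>lebesgue_on \<Omega>) \<le> (\<integral>y. tent a r y * \<bar>v n y\<bar> \<partial>lebesgue_on \<Omega>) + norm (b - a) * grad_mass \<Omega> (V n)"
        by (rule tent_integral_shift[OF v(1) r(1) sw])
      show "0 \<le> (\<integral>y. tent b r y * \<bar>v n y\<bar> \<partial>lebesgue_on \<Omega>)" by (rule nn)
    next
      have "(\<lambda>n. (\<integral>y. tent a r y * \<bar>v n y\<bar> \<partial>lebesgue_on \<Omega>) + norm (b - a) * grad_mass \<Omega> (V n)) \<longlonglongrightarrow> 0 + norm (b - a) * 0"
        by (intro tendsto_add tendsto_mult tendsto_const C mono[OF r(1,2) r0(2,3)])
      then show "(\<lambda>n. (\<integral>y. tent a r y * \<bar>v n y\<bar> \<partial>lebesgue_on \<Omega>) + norm (b - a) * grad_mass \<Omega> (V n)) \<longlonglongrightarrow> 0" by simp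
    qed
    moreover have "cball b r \<subseteq> \<Omega>"
    proof
      fix p assume "p \<in> cball b r"
      then have "dist c p \<le> 2 * \<rho>" using dist_triangle[of c p b] ab(2) r(3) by auto
      then show "p \<in> \<Omega>" using c by auto
    qed
    ultimately show "P b" unfolding P_def using r(1) by blast
  qed
  obtain x0 \<rho> where \<rho>: "\<rho> > 0" "cball x0 (3 * \<rho>) \<subseteq> \<Omega>" and pos: "(\<integral>y. tent x0 \<rho> y * a y \<partial>lebesgue_on \<Omega>) > 0"
    using exists_tent_integral_pos[OF \<Omega>(1) am a nz] by blast
  have b\<rho>: "cball x0 \<rho> \<subseteq> \<Omega>" using \<rho> by (auto intro: subset_cball[THEN subset_trans])
  define c where "c = (\<integral>y. tent x0 \<rho> y * a y \<partial>lebesgue_on \<Omega>)"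
  define q where "q y = tent x0 \<rho> y * a y" for y
  have aA: "AE x in lebesgue_on \<Omega>. \<bar>a x\<bar> \<le> A" using a by eventually_elim simp
  have cs: "csupp (cball x0 \<rho>) (tent x0 \<rho>)" by (rule csupp_tent[OF \<rho>(1)])
  have int_q: "integrable (lebesgue_on \<Omega>) q"
    unfolding q_def[abs_def] by (rule integrable_mult_bounded[OF csupp_integrable[OF cs \<Omega>s] am aA])
  have qA: "AE y in lebesgue_on \<Omega>. \<bar>q y\<bar> \<le> A * tent x0 \<rho> y"
    using aA by (rule eventually_mono) (simp add: q_def abs_mult tent_nonneg mult.commute mult_right_mono)
  have sw: "sweep z (cball x0 \<rho>) \<subseteq> \<Omega>" if z: "norm z \<le> 2 * \<rho>" for z
  proof
    fix p assume "p \<in> sweep z (cball x0 \<rho>)"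
    then obtain y s where y: "dist x0 y \<le> \<rho>" and s: "s \<in> {0..1}" and p: "p = y + s *\<^sub>R z"
      unfolding sweep_def by auto
    have "norm (s *\<^sub>R z) \<le> 1 * norm z" unfolding norm_scaleR by (intro mult_right_mono) (use s in auto)
    then have "dist y p \<le> 2 * \<rho>" using z by (simp add: p dist_norm)
    then have "dist x0 p \<le> 3 * \<rho>" using dist_triangle[of x0 p y] y by linarith
    then show "p \<in> \<Omega>" using \<rho>(2) by auto
  qed
  let ?vol = "measure lborel (cball (0::real^'n) (2 * \<rho>))"
  define k :: "real^'n \<Rightarrow> real" where "k = indicator (cball 0 (2 * \<rho>))"
  have km[measurable]: "k \<in> borel_measurable borel" unfolding k_def by (intro borel_measurable_indicator) simp
  have k01: "0 \<le> k x" "k x \<le> 1" for x by (auto simp: k_def indicator_def)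
  define f where "f n t = (if t \<in> \<Omega> then \<bar>v n t\<bar> else 0)" for n t
  define Q where "Q t = (\<integral>y. q y * k (t - y) \<partial>lebesgue_on \<Omega>)" for t
  define J where "J n = (\<integral>t. f n t * Q t \<partial>lborel)" for n
  have Qm[measurable]: "Q \<in> borel_measurable borel"
    unfolding Q_def[abs_def] by (rule moving_average(1)[OF \<Omega>(1) int_q km k01])
  have QB: "\<bar>Q t\<bar> \<le> (\<integral>y. \<bar>q y\<bar> \<partial>lebesgue_on \<Omega>)" for t
    unfolding Q_def by (rule moving_average(2)[OF \<Omega>(1) int_q km k01])
  have Q0: "0 \<le> Q t" for t
    unfolding Q_def
    by (rule integral_nonneg_AE) (use a(1) in \<open>auto simp: q_def tent_nonneg k01 elim!: eventually_mono\<close>)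
  \<comment> \<open>Two points of the ball of radius \<open>\<rho>\<close> are at most
    \<open>2 * \<rho>\<close> apart, so the averaging kernel of that radius sees the whole mass of
    \<open>q\<close> from any such \<open>t\<close>.\<close>
  have Qc: "Q t = c" if t: "t \<in> cball x0 \<rho>" for t
    unfolding Q_def c_def
  proof (rule Bochner_Integration.integral_cong[OF refl])
    fix y
    show "q y * k (t - y) = tent x0 \<rho> y * a y"
    proof (cases "y \<in> cball x0 \<rho>")
      case True
      then have "dist t y \<le> 2 * \<rho>" using dist_triangle[of t y x0] t by (simp add: dist_commute)
      then have "k (t - y) = 1" by (simp add: k_def dist_norm indicator_def norm_minus_commute)
      then show ?thesis by (simp add: q_def)
    next
      case False
      then show ?thesis using cs by (simp add: csupp_def q_def)
    qed
  qed
  have f_eq: "f n = (\<lambda>x. indicator \<Omega> x *\<^sub>R \<bar>v n x\<bar>)" for n by (auto simp: f_def indicator_def fun_eq_iff)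
  have fm[measurable]: "f n \<in> borel_measurable borel" for n
    unfolding f_eq by (intro borel_measurable_continuous_on_indicator continuous_intros v) (use \<Omega> in auto)
  have ind_int: "integrable lborel (indicator \<Omega> :: real^'n \<Rightarrow> real)"
    using emeasure_bounded_finite[OF \<Omega>(2)] \<Omega>(1) by (intro integrable_real_indicator) auto
  have int_f: "integrable lborel (f n)" for n
  proof (rule Bochner_Integration.integrable_bound[of _ "\<lambda>t. B * indicator \<Omega> t"])
    show "AE t in lborel. norm (f n t) \<le> norm (B * indicator \<Omega> t :: real)"
      using v(2)[of _ n] B by (intro AE_I2) (auto simp: f_def)
  qed (use ind_int in auto)
  have int_fQ: "integrable lborel (\<lambda>t. f n t * Q t)" for n
    by (rule integrable_mult_bounded[OF int_f _ AE_I2[OF QB]]) simp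
  \<comment> \<open>\<open>Q\<close> is nonnegative, and equal to \<open>c\<close> where the tent
    lives, so it dominates \<open>c\<close> times the tent. This replaces the weight
    \<open>a\<close>, which may vanish at many points, by a weight that is positive on the open
    ball.\<close>
  have tent_le: "c * (\<integral>y. tent x0 \<rho> y * \<bar>v n y\<bar> \<partial>lebesgue_on \<Omega>) \<le> J n" for n
  proof -
    have tm: "tent x0 \<rho> \<in> borel_measurable borel"
      using cs by (intro borel_measurable_continuous_onI) (simp add: csupp_def)
    have tf: "(\<integral>y. tent x0 \<rho> y * \<bar>v n y\<bar> \<partial>lebesgue_on \<Omega>) = (\<integral>t. tent x0 \<rho> t * f n t \<partial>lborel)"
    proof -
      have "(\<integral>y. tent x0 \<rho> y * \<bar>v n y\<bar> \<partial>lebesgue_on \<Omega>) = (\<integral>y. tent x0 \<rho> y * f n y \<partial>lebesgue)"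
        unfolding Lebesgue_Measure.integral_restrict_UNIV[OF \<Omega>s, symmetric]
        by (rule Bochner_Integration.integral_cong) (auto simp: f_def)
      also have "\<dots> = (\<integral>t. tent x0 \<rho> t * f n t \<partial>lborel)"
        by (rule integral_completion) (use tm fm in simp)
      finally show ?thesis .
    qed
    have "c * (\<integral>t. tent x0 \<rho> t * f n t \<partial>lborel) = (\<integral>t. c * (f n t * tent x0 \<rho> t) \<partial>lborel)" by (simp add: mult.commute)
    also have "\<dots> \<le> (\<integral>t. f n t * Q t \<partial>lborel)"
    proof (rule integral_mono)
      show "integrable lborel (\<lambda>t. c * (f n t * tent x0 \<rho> t))"
        by (rule integrable_mult_right, rule integrable_mult_bounded[OF int_f, where C = 1])
          (use tm in \<open>simp_all add: abs_of_nonneg[OF tent_nonneg] tent_le_1[OF \<rho>(1)]\<close>)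
      show "c * (f n t * tent x0 \<rho> t) \<le> f n t * Q t" for t
      proof (cases "t \<in> cball x0 \<rho>")
        case True
        have "f n t * (c * tent x0 \<rho> t) \<le> f n t * (c * 1)"
          using pos tent_le_1[OF \<rho>(1)] by (intro mult_left_mono) (auto simp: f_def c_def)
        then show ?thesis by (simp add: Qc[OF True] mult_ac)
      next
        case False
        then have "tent x0 \<rho> t = 0" using cs by (simp add: csupp_def)
        then show ?thesis using Q0[of t] by (simp add: f_def)
      qed
    qed (rule int_fQ)
    finally show ?thesis by (simp add: tf J_def)
  qed
  \<comment> \<open>Conversely \<open>J n\<close> is close to the pairing of
    \<open>\<bar>v n\<bar>\<close> with \<open>q\<close>, which is at most the pairing with
    \<open>a\<close>; shifts of length \<open>2 * \<rho>\<close> account for the gradient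
    term.\<close>
  have J_le: "J n \<le> ?vol * ((\<integral>x. a x * \<bar>v n x\<bar> \<partial>lebesgue_on \<Omega>) + A * (2 * \<rho> * grad_mass \<Omega> (V n)))" for n
  proof -
    interpret weak_diff \<Omega> "v n" "V n" by (rule wd)
    have vm: "(\<lambda>x. \<bar>v n x\<bar>) \<in> borel_measurable (lebesgue_on \<Omega>)"
      by (intro continuous_imp_measurable_on_sets_lebesgue[OF _ \<Omega>s] continuous_intros v)
    have "\<bar>?vol * (\<integral>x. q x * \<bar>v n x\<bar> \<partial>lebesgue_on \<Omega>) - J n\<bar> \<le> ?vol * (A * (2 * \<rho> * grad_mass \<Omega> (V n)))"
      unfolding J_def f_def Q_def k_def
    proof (rule averaged_pairing[OF \<Omega>(1) _ _ _ cs tent_nonneg borel_measurable_integrable[OF int_q] qA A _ sw])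
      show "continuous_on \<Omega> (\<lambda>x. \<bar>v n x\<bar>)" by (intro continuous_intros v)
      show "\<bar>\<bar>v n x\<bar>\<bar> \<le> B" if "x \<in> \<Omega>" for x using v(2)[OF that] by simp
      fix z :: "real^'n" assume z: "norm z \<le> 2 * \<rho>"
      have "(\<integral>x. tent x0 \<rho> x * \<bar>\<bar>v n (x + z)\<bar> - \<bar>v n x\<bar>\<bar> \<partial>lebesgue_on \<Omega>) \<le> (\<integral>x. tent x0 \<rho> x * \<bar>v n (x + z) - v n x\<bar> \<partial>lebesgue_on \<Omega>)"
      proof (rule integral_mono)
        show "integrable (lebesgue_on \<Omega>) (\<lambda>x. tent x0 \<rho> x * \<bar>\<bar>v n (x + z)\<bar> - \<bar>v n x\<bar>\<bar>)"
          by (rule csupp_integrable[OF csupp_mult_diff[OF cs \<Omega>(1) sw[OF z] v(1), where h = "\<lambda>a b. \<bar>\<bar>a\<bar> - \<bar>b\<bar>\<bar>"] \<Omega>s])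
            (intro continuous_intros)
        show "integrable (lebesgue_on \<Omega>) (\<lambda>x. tent x0 \<rho> x * \<bar>v n (x + z) - v n x\<bar>)"
          by (rule csupp_integrable[OF csupp_mult_diff[OF cs \<Omega>(1) sw[OF z] v(1), where h = "\<lambda>a b. \<bar>a - b\<bar>"] \<Omega>s])
            (intro continuous_intros)
        show "tent x0 \<rho> x * \<bar>\<bar>v n (x + z)\<bar> - \<bar>v n x\<bar>\<bar> \<le> tent x0 \<rho> x * \<bar>v n (x + z) - v n x\<bar>" for x
          by (intro mult_left_mono tent_nonneg abs_triangle_ineq3)
      qed
      also have "\<dots> \<le> norm z * 1 * grad_mass \<Omega> (V n)"
        by (rule integral_abs_diff_translate_le[OF cs tent_nonneg tent_le_1[OF \<rho>(1)] sw[OF z] v(1)])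
      also have "\<dots> \<le> 2 * \<rho> * grad_mass \<Omega> (V n)"
        using z grad_mass_nonneg[of \<Omega> "V n"] by (simp add: mult_right_mono)
      finally show "(\<integral>x. tent x0 \<rho> x * \<bar>\<bar>v n (x + z)\<bar> - \<bar>v n x\<bar>\<bar> \<partial>lebesgue_on \<Omega>) \<le> 2 * \<rho> * grad_mass \<Omega> (V n)" .
    qed (use B \<rho> in auto)
    moreover have "(\<integral>x. q x * \<bar>v n x\<bar> \<partial>lebesgue_on \<Omega>) \<le> (\<integral>x. a x * \<bar>v n x\<bar> \<partial>lebesgue_on \<Omega>)"
    proof (rule integral_mono_AE)
      have vB: "AE x in lebesgue_on \<Omega>. \<bar>\<bar>v n x\<bar>\<bar> \<le> B" using v(2) by (intro AE_I2) simp
      show "integrable (lebesgue_on \<Omega>) (\<lambda>x. q x * \<bar>v n x\<bar>)"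
        by (rule integrable_mult_bounded[OF int_q vm vB])
      have "integrable (lebesgue_on \<Omega>) (\<lambda>x. \<bar>v n x\<bar> * a x)"
        by (rule integrable_mult_bounded[OF integrable_abs[OF int_w] am aA])
      then show "integrable (lebesgue_on \<Omega>) (\<lambda>x. a x * \<bar>v n x\<bar>)" by (simp add: mult.commute)
      show "AE x in lebesgue_on \<Omega>. q x * \<bar>v n x\<bar> \<le> a x * \<bar>v n x\<bar>"
        using a(1)
        by (rule eventually_mono) (simp add: q_def mult_right_mono mult_left_le_one_le tent_nonneg tent_le_1[OF \<rho>(1)])
    qed
    then have "?vol * (\<integral>x. q x * \<bar>v n x\<bar> \<partial>lebesgue_on \<Omega>) \<le> ?vol * (\<integral>x. a x * \<bar>v n x\<bar> \<partial>lebesgue_on \<Omega>)"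
      by (rule mult_left_mono) simp
    ultimately show ?thesis by (simp add: distrib_left)
  qed
  have "P x0"
    unfolding P_def
  proof (intro exI[of _ \<rho>] conjI \<rho>(1) b\<rho>)
    have l: "(\<lambda>n. inverse c * (?vol * ((\<integral>x. a x * \<bar>v n x\<bar> \<partial>lebesgue_on \<Omega>) + A * (2 * \<rho> * grad_mass \<Omega> (V n))))) \<longlonglongrightarrow> inverse c * (?vol * (0 + A * (2 * \<rho> * 0)))"
      by (intro tendsto_mult tendsto_add tendsto_const av C)
    show "(\<lambda>n. \<integral>y. tent x0 \<rho> y * \<bar>v n y\<bar> \<partial>lebesgue_on \<Omega>) \<longlonglongrightarrow> 0"
    proof (rule tendsto_sandwich[OF always_eventually always_eventually tendsto_const]; (intro allI)?)
      fix n
      show "0 \<le> (\<integral>y. tent x0 \<rho> y * \<bar>v n y\<bar> \<partial>lebesgue_on \<Omega>)" by (rule nn)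
      have "c > 0" using pos by (simp add: c_def)
      moreover have "c * (\<integral>y. tent x0 \<rho> y * \<bar>v n y\<bar> \<partial>lebesgue_on \<Omega>) \<le> ?vol * ((\<integral>x. a x * \<bar>v n x\<bar> \<partial>lebesgue_on \<Omega>) + A * (2 * \<rho> * grad_mass \<Omega> (V n)))"
        using tent_le[of n] J_le[of n] by linarith
      moreover have "s \<le> inverse c * t" if "c > 0" "c * s \<le> t" for s t
        using that by (simp add: field_simps)
      ultimately show "(\<integral>y. tent x0 \<rho> y * \<bar>v n y\<bar> \<partial>lebesgue_on \<Omega>) \<le> inverse c * (?vol * ((\<integral>x. a x * \<bar>v n x\<bar> \<partial>lebesgue_on \<Omega>) + A * (2 * \<rho> * grad_mass \<Omega> (V n))))"
        by blast
    next
      show "(\<lambda>n. inverse c * (?vol * ((\<integral>x. a x * \<bar>v n x\<bar> \<partial>lebesgue_on \<Omega>) + A * (2 * \<rho> * grad_mass \<Omega> (V n))))) \<longlonglongrightarrow> 0"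
        using l by simp
    qed
  qed
  moreover have "P x0 = P x"
  proof (rule connected_local_const[OF \<Omega>(3) _ x])
    show "x0 \<in> \<Omega>" using b\<rho> \<rho>(1) by auto
    show "\<forall>a\<in>\<Omega>. \<forall>\<^sub>F b in at a within \<Omega>. P a = P b"
    proof
      fix a assume "a \<in> \<Omega>"
      then obtain e where e: "e > 0" "cball a e \<subseteq> \<Omega>" using \<Omega>(1) unfolding open_contains_cball by metis
      have "P a = P b" if "dist b a < e / 2" for b
      proof -
        \<comment> \<open>Half the radius is taken because \<open>step\<close> needs the ball of
          twice the radius inside the domain; applying it in both directions gives the
          equivalence.\<close>
        have ab: "a \<in> ball a (e / 2)" "b \<in> ball a (e / 2)" and c: "cball a (2 * (e / 2)) \<subseteq> \<Omega>"
          using e that by (auto simp: dist_commute)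
        show ?thesis using step[OF _ ab c] step[OF _ ab(2,1) c] by blast
      qed
      then show "\<forall>\<^sub>F b in at a within \<Omega>. P a = P b"
        unfolding eventually_at using e(1) by (intro exI[of _ "e / 2"]) auto
    qed
  qed
  ultimately show ?thesis by (simp add: P_def)
qed

section \<open>The state equation\<close>

text \<open>Completeness of Lebesgue measure allows a change on a null set.\<close>

lemma borel_measurable_AE_lebesgue_on:
  fixes f g :: "'a::euclidean_space \<Rightarrow> real"
  assumes f: "f \<in> borel_measurable (lebesgue_on S)" and eq: "AE x in lebesgue_on S. f x = g x"
    and S: "S \<in> sets lebesgue"
  shows "g \<in> borel_measurable (lebesgue_on S)"
proof -
  have "AE x in lebesgue. x \<in> S \<longrightarrow> f x = g x" using eq S by (simp add: AE_restrict_space_iff)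
  then have "AE x in lebesgue. (if x \<in> S then f x else 0) = (if x \<in> S then g x else 0)"
    by (rule eventually_mono) simp
  then have "(\<lambda>x. if x \<in> S then g x else 0) \<in> borel_measurable lebesgue"
    by (rule borel_measurable_AE[OF borel_measurable_if_I[OF f S]])
  then show ?thesis by (rule borel_measurable_if_D)
qed

text \<open>Measurability is given only for fixed second argument, so \<open>y\<close> is
  approximated by functions with countably many values; continuity in the second argument gives the
  limit almost everywhere.\<close>

lemma caratheodory_measurable:
  fixes y :: "'a::euclidean_space \<Rightarrow> real" and d :: "'a \<Rightarrow> real \<Rightarrow> real"
  assumes d: "\<And>t. (\<lambda>x. d x t) \<in> borel_measurable (lebesgue_on S)"
    and c: "AE x in lebesgue_on S. continuous_on UNIV (d x)"
    and y: "y \<in> borel_measurable (lebesgue_on S)" and S: "S \<in> sets lebesgue"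
  shows "(\<lambda>x. d x (y x)) \<in> borel_measurable (lebesgue_on S)"
proof (rule borel_measurable_AE_lebesgue_on[OF _ _ S])
  \<comment> \<open>\<open>y\<close> is rounded down to multiples of 1/(n + 1), so
    \<open>g n\<close> is put together from countably many of the functions
    \<open>\<lambda>x. d x t\<close>.\<close>
  define g where "g n x = d x (of_int \<lfloor>real (Suc n) * y x\<rfloor> / real (Suc n))" for n x
  have [measurable]: "g n \<in> borel_measurable (lebesgue_on S)" for n
    unfolding g_def[abs_def]
    by (rule measurable_compose_countable[where f = "\<lambda>i x. d x (of_int i / real (Suc n))", OF d])
      (use y in measurable)
  show "(\<lambda>x. lim (\<lambda>n. g n x)) \<in> borel_measurable (lebesgue_on S)" by measurable
  show "AE x in lebesgue_on S. lim (\<lambda>n. g n x) = d x (y x)"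
    using c
  proof (rule eventually_mono)
    fix x assume c: "continuous_on UNIV (d x)"
    have "(\<lambda>n. of_int \<lfloor>real (Suc n) * y x\<rfloor> / real (Suc n)) \<longlonglongrightarrow> y x"
    proof (rule tendsto_sandwich[OF always_eventually always_eventually]; (intro allI)?)
      fix n
      have "real (Suc n) * y x - 1 \<le> of_int \<lfloor>real (Suc n) * y x\<rfloor>" by linarith
      then have "(real (Suc n) * y x - 1) / real (Suc n) \<le> of_int \<lfloor>real (Suc n) * y x\<rfloor> / real (Suc n)"
        by (intro divide_right_mono) auto
      then show "y x - inverse (real (Suc n)) \<le> of_int \<lfloor>real (Suc n) * y x\<rfloor> / real (Suc n)"
        by (simp add: diff_divide_distrib inverse_eq_divide del: of_nat_Suc)
      have "of_int \<lfloor>real (Suc n) * y x\<rfloor> / real (Suc n) \<le> (real (Suc n) * y x) / real (Suc n)"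
        by (intro divide_right_mono) auto
      then show "of_int \<lfloor>real (Suc n) * y x\<rfloor> / real (Suc n) \<le> y x" by (simp del: of_nat_Suc)
    next
      show "(\<lambda>n. y x - inverse (real (Suc n))) \<longlonglongrightarrow> y x"
        using tendsto_diff[OF tendsto_const[of "y x"] LIMSEQ_inverse_real_of_nat] by simp
    qed simp
    moreover have "isCont (d x) (y x)" using c by (simp add: continuous_on_eq_continuous_at)
    ultimately have "(\<lambda>n. g n x) \<longlonglongrightarrow> d x (y x)"
      unfolding g_def by (rule isCont_tendsto_compose[rotated])
    then show "lim (\<lambda>n. g n x) = d x (y x)" by (rule limI)
  qed
qed

section \<open>Bounds and monotonicity of the nonlinearity\<close>

lemma deriv_bounded_imp_bounded:
  fixes f :: "real \<Rightarrow> real"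
  assumes f: "\<And>s. f differentiable (at s)" and D: "\<And>s. \<bar>s\<bar> \<le> M \<Longrightarrow> \<bar>deriv f s\<bar> \<le> D" and t: "\<bar>t\<bar> \<le> M"
  shows "\<bar>f t\<bar> \<le> \<bar>f 0\<bar> + D * M"
proof -
  have df: "(f has_real_derivative deriv f s) (at s)" for s
    using f by (metis DERIV_deriv_iff_real_differentiable)
  have M: "M \<ge> 0" using t by simp
  have "norm (f t - f 0) \<le> D * norm (t - 0)"
  proof (rule field_differentiable_bound[where S = "{-M..M}" and f' = "deriv f"])
    show "norm (deriv f z) \<le> D" if "z \<in> {-M..M}" for z using D[of z] that by auto
    show "(f has_real_derivative deriv f z) (at z within {-M..M})" for z
      by (rule has_field_derivative_at_within[OF df])
  qed (use t M in auto)
  moreover have "D * norm (t - 0) \<le> D * M"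
    using t D[of 0] M by (intro mult_left_mono) auto
  ultimately show ?thesis by simp
qed

text \<open>The bounds descend through the orders: the Lipschitz condition and the value at 0 bound
  the second derivative for arguments up to \<open>M\<close>, this bounds the first derivative, and
  that one bounds \<open>d x\<close> itself.\<close>

lemma nonlin_bounded:
  assumes d: "nonlin_ok \<Omega> d" and M: "M \<ge> 0"
  shows "\<exists>C. AE x in lebesgue_on \<Omega>. \<forall>t. \<bar>t\<bar> \<le> M \<longrightarrow> \<bar>d x t\<bar> \<le> C"
proof -
  obtain c0 c1 c2 where c: "AE x in lebesgue_on \<Omega>. \<bar>d x 0\<bar> \<le> c0" "AE x in lebesgue_on \<Omega>. \<bar>dY d x 0\<bar> \<le> c1"
      "AE x in lebesgue_on \<Omega>. \<bar>dYY d x 0\<bar> \<le> c2"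
    using d unfolding nonlin_ok_def Linf_def by blast
  obtain L where L: "AE x in lebesgue_on \<Omega>. \<forall>s t. \<bar>s\<bar> \<le> M \<longrightarrow> \<bar>t\<bar> \<le> M \<longrightarrow> \<bar>dYY d x s - dYY d x t\<bar> \<le> L * \<bar>s - t\<bar>"
    using d unfolding nonlin_ok_def by blast
  have df: "AE x in lebesgue_on \<Omega>. (\<forall>t. d x differentiable (at t)) \<and> (\<forall>t. dY d x differentiable (at t)) \<and> continuous_on UNIV (dYY d x)"
    using d unfolding nonlin_ok_def by blast
  \<comment> \<open>The absolute value is taken because the Lipschitz constant comes without a
    sign.\<close>
  have "AE x in lebesgue_on \<Omega>. \<forall>t. \<bar>t\<bar> \<le> M \<longrightarrow> \<bar>d x t\<bar> \<le> c0 + (c1 + (c2 + \<bar>L\<bar> * M) * M) * M"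
    using c L df
  proof eventually_elim
    case (elim x)
    have dY: "dY d x = deriv (d x)" and dYY: "dYY d x = deriv (dY d x)"
      by (simp_all add: fun_eq_iff dY_def dYY_def)
    have b2: "\<bar>deriv (dY d x) t\<bar> \<le> c2 + \<bar>L\<bar> * M" if t: "\<bar>t\<bar> \<le> M" for t
    proof -
      have "\<bar>dYY d x t - dYY d x 0\<bar> \<le> L * \<bar>t - 0\<bar>" using elim(4)[rule_format, of t 0] t M by simp
      also have "\<dots> \<le> \<bar>L\<bar> * M" using t by (intro mult_mono) auto
      finally show ?thesis using elim(3) unfolding dYY by linarith
    qed
    have b1: "\<bar>deriv (d x) t\<bar> \<le> c1 + (c2 + \<bar>L\<bar> * M) * M" if t: "\<bar>t\<bar> \<le> M" for t
    proof -
      have "\<bar>dY d x t\<bar> \<le> \<bar>dY d x 0\<bar> + (c2 + \<bar>L\<bar> * M) * M"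
        by (rule deriv_bounded_imp_bounded[OF _ b2 t]) (use elim(5) in blast)+
      then show ?thesis using elim(2) unfolding dY by linarith
    qed
    show ?case
    proof (intro allI impI)
      fix t assume t: "\<bar>t\<bar> \<le> M"
      have "\<bar>d x t\<bar> \<le> \<bar>d x 0\<bar> + (c1 + (c2 + \<bar>L\<bar> * M) * M) * M"
        by (rule deriv_bounded_imp_bounded[OF _ b1 t]) (use elim(5) in blast)+
      then show "\<bar>d x t\<bar> \<le> c0 + (c1 + (c2 + \<bar>L\<bar> * M) * M) * M" using elim(1) by linarith
    qed
  qed
  then show ?thesis by blast
qed

lemma nonlin_mono:
  assumes d: "nonlin_ok \<Omega> d"
  shows "AE x in lebesgue_on \<Omega>. continuous_on UNIV (d x) \<and> (\<forall>s t. s \<le> t \<longrightarrow> d x s \<le> d x t)"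
proof -
  have "AE x in lebesgue_on \<Omega>. (\<forall>t. d x differentiable (at t)) \<and> (\<forall>t. dY d x differentiable (at t)) \<and> continuous_on UNIV (dYY d x)"
    and "AE x in lebesgue_on \<Omega>. \<forall>t. dY d x t \<ge> 0"
    using d unfolding nonlin_ok_def by blast+
  then show ?thesis
  proof eventually_elim
    case (elim x)
    have df: "(d x has_real_derivative dY d x s) (at s)" for s
      using elim(1) unfolding dY_def by (metis DERIV_deriv_iff_real_differentiable)
    have "continuous_on UNIV (d x)"
      by (intro continuous_at_imp_continuous_on ballI) (rule DERIV_isCont[OF df])
    moreover have "d x s \<le> d x t" if "s \<le> t" for s t
      by (rule DERIV_nonneg_imp_nondecreasing[OF that]) (use df elim(2) in blast)
    ultimately show ?case by blast
  qed
qed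

text \<open>Young's inequality |f| \<le> \<eta> + f^2 / \<eta> with a small fixed \<eta>: the first
  term integrates to at most \<open>e / 2\<close>, the second is eventually below
  \<open>e / 2\<close>.\<close>

lemma weighted_L1_of_L2_tendsto_0:
  fixes f :: "nat \<Rightarrow> 'a \<Rightarrow> real"
  assumes b: "AE x in M. 0 \<le> b x" "integrable M b" and f: "\<And>n. integrable M (\<lambda>x. b x * (f n x)\<^sup>2)" "\<And>n. integrable M (\<lambda>x. b x * \<bar>f n x\<bar>)"
    and l: "(\<lambda>n. \<integral>x. b x * (f n x)\<^sup>2 \<partial>M) \<longlonglongrightarrow> 0"
  shows "(\<lambda>n. \<integral>x. b x * \<bar>f n x\<bar> \<partial>M) \<longlonglongrightarrow> 0"
proof (rule order_tendstoI)
  have nn: "0 \<le> (\<integral>x. b x * \<bar>f n x\<bar> \<partial>M)" for n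
    by (rule integral_nonneg_AE) (use b(1) in \<open>auto elim!: eventually_mono\<close>)
  show "\<forall>\<^sub>F n in sequentially. a < (\<integral>x. b x * \<bar>f n x\<bar> \<partial>M)" if "a < 0" for a
    using nn that by (intro always_eventually) (auto intro: less_le_trans)
next
  fix e :: real assume e: "0 < e"
  define I where "I = integral\<^sup>L M b"
  have I: "I \<ge> 0" unfolding I_def by (rule integral_nonneg_AE[OF b(1)])
  define \<eta> where "\<eta> = e / (2 * (I + 1))"
  have \<eta>: "\<eta> > 0" "\<eta> * I \<le> e / 2"
    using e I by (auto simp: \<eta>_def field_simps)
  have "\<forall>\<^sub>F n in sequentially. (\<integral>x. b x * (f n x)\<^sup>2 \<partial>M) < \<eta> * (e / 2)"
    by (rule order_tendstoD(2)[OF l]) (use \<eta>(1) e in simp)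
  then show "\<forall>\<^sub>F n in sequentially. (\<integral>x. b x * \<bar>f n x\<bar> \<partial>M) < e"
  proof (rule eventually_mono)
    fix n assume n: "(\<integral>x. b x * (f n x)\<^sup>2 \<partial>M) < \<eta> * (e / 2)"
    have "(\<integral>x. b x * \<bar>f n x\<bar> \<partial>M) \<le> (\<integral>x. \<eta> * b x + inverse \<eta> * (b x * (f n x)\<^sup>2) \<partial>M)"
    proof (rule integral_mono_AE)
      show "AE x in M. b x * \<bar>f n x\<bar> \<le> \<eta> * b x + inverse \<eta> * (b x * (f n x)\<^sup>2)"
        using b(1)
      proof (rule eventually_mono)
        fix x assume b0: "0 \<le> b x"
        have "0 \<le> (\<bar>f n x\<bar> - \<eta>)\<^sup>2" by simp
        then have "2 * (\<eta> * \<bar>f n x\<bar>) \<le> \<eta>\<^sup>2 + (f n x)\<^sup>2" by (simp add: power2_diff mult_ac)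
        moreover have "0 \<le> \<eta> * \<bar>f n x\<bar>" using \<eta>(1) by simp
        moreover have "\<eta> * (\<eta> + inverse \<eta> * (f n x)\<^sup>2) = \<eta>\<^sup>2 + (f n x)\<^sup>2"
          using \<eta>(1) by (simp add: distrib_left power2_eq_square mult.assoc[symmetric])
        ultimately have "\<eta> * \<bar>f n x\<bar> \<le> \<eta> * (\<eta> + inverse \<eta> * (f n x)\<^sup>2)"
          by linarith
        then have "\<bar>f n x\<bar> \<le> \<eta> + inverse \<eta> * (f n x)\<^sup>2" using \<eta>(1) by (simp only: mult_le_cancel_left_pos)
        from mult_left_mono[OF this b0] show "b x * \<bar>f n x\<bar> \<le> \<eta> * b x + inverse \<eta> * (b x * (f n x)\<^sup>2)"
          by (simp add: distrib_left mult_ac)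
      qed
    qed (intro f Bochner_Integration.integrable_add integrable_mult_right b)+
    also have "\<dots> = \<eta> * I + inverse \<eta> * (\<integral>x. b x * (f n x)\<^sup>2 \<partial>M)"
      unfolding I_def by (subst Bochner_Integration.integral_add) (auto intro!: f b)
    also have "\<dots> < e / 2 + inverse \<eta> * (\<eta> * (e / 2))"
      using \<eta> n by (intro add_le_less_mono mult_strict_left_mono) auto
    also have "\<dots> = e" using \<eta>(1) by (simp add: field_simps)
    finally show "(\<integral>x. b x * \<bar>f n x\<bar> \<partial>M) < e" .
  qed
qed

section \<open>Square integrable functions and differences in H^1\<close>

lemma L2_measurable: "L2 \<Omega> f \<Longrightarrow> f \<in> borel_measurable (lebesgue_on \<Omega>)"
  by (simp add: L2_def)

lemma L2_integrable:
  assumes f: "L2 \<Omega> f" and fin: "finite_measure (lebesgue_on \<Omega>)"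
  shows "integrable (lebesgue_on \<Omega>) f"
proof (rule Bochner_Integration.integrable_bound[of _ "\<lambda>x. 1 + (f x)\<^sup>2"])
  interpret finite_measure "lebesgue_on \<Omega>" by (rule fin)
  show "integrable (lebesgue_on \<Omega>) (\<lambda>x. 1 + (f x)\<^sup>2)"
    using f by (intro Bochner_Integration.integrable_add) (auto simp: L2_def)
  show "f \<in> borel_measurable (lebesgue_on \<Omega>)" using f by (simp add: L2_def)
  show "AE x in lebesgue_on \<Omega>. norm (f x) \<le> norm (1 + (f x)\<^sup>2)"
  proof (rule AE_I2)
    fix x
    have "0 \<le> (\<bar>f x\<bar> - 1)\<^sup>2" by simp
    then have "2 * \<bar>f x\<bar> \<le> 1 + (f x)\<^sup>2" by (simp add: power2_diff)
    then show "norm (f x) \<le> norm (1 + (f x)\<^sup>2)" by simp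
  qed
qed

lemma L2_mult_integrable:
  assumes f: "L2 \<Omega> f" and g: "L2 \<Omega> g"
  shows "integrable (lebesgue_on \<Omega>) (\<lambda>x. f x * g x)"
proof (rule Bochner_Integration.integrable_bound[of _ "\<lambda>x. (f x)\<^sup>2 + (g x)\<^sup>2"])
  show "integrable (lebesgue_on \<Omega>) (\<lambda>x. (f x)\<^sup>2 + (g x)\<^sup>2)"
    using f g by (intro Bochner_Integration.integrable_add) (auto simp: L2_def)
  show "(\<lambda>x. f x * g x) \<in> borel_measurable (lebesgue_on \<Omega>)"
    by (intro borel_measurable_times L2_measurable f g)
  show "AE x in lebesgue_on \<Omega>. norm (f x * g x) \<le> norm ((f x)\<^sup>2 + (g x)\<^sup>2)"
  proof (rule AE_I2)
    fix x
    have "0 \<le> (\<bar>f x\<bar> - \<bar>g x\<bar>)\<^sup>2" by simp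
    then have "2 * \<bar>f x * g x\<bar> \<le> (f x)\<^sup>2 + (g x)\<^sup>2" by (simp add: power2_diff abs_mult)
    then show "norm (f x * g x) \<le> norm ((f x)\<^sup>2 + (g x)\<^sup>2)" by simp
  qed
qed

lemma L2_diff:
  assumes f: "L2 \<Omega> f" and g: "L2 \<Omega> g"
  shows "L2 \<Omega> (\<lambda>x. f x - g x)"
proof -
  have "integrable (lebesgue_on \<Omega>) (\<lambda>x. (f x)\<^sup>2 + (g x)\<^sup>2 - 2 * (f x * g x))"
    using f g L2_mult_integrable[OF f g]
    by (intro Bochner_Integration.integrable_diff Bochner_Integration.integrable_add integrable_mult_right) (auto simp: L2_def)
  then have "integrable (lebesgue_on \<Omega>) (\<lambda>x. (f x - g x)\<^sup>2)" by (simp add: power2_diff mult.assoc)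
  then show ?thesis
    unfolding L2_def by (intro conjI borel_measurable_diff L2_measurable f g)
qed

lemma L2_bounded:
  assumes f: "f \<in> borel_measurable (lebesgue_on \<Omega>)" and C: "AE x in lebesgue_on \<Omega>. \<bar>f x\<bar> \<le> C"
    and fin: "finite_measure (lebesgue_on \<Omega>)"
  shows "L2 \<Omega> f"
proof -
  interpret finite_measure "lebesgue_on \<Omega>" by (rule fin)
  have "integrable (lebesgue_on \<Omega>) (\<lambda>x. (f x)\<^sup>2)"
  proof (rule integrable_const_bound[where B = "C\<^sup>2"])
    show "AE x in lebesgue_on \<Omega>. norm ((f x)\<^sup>2) \<le> C\<^sup>2"
      using C by (rule eventually_mono) (simp add: abs_le_square_iff[symmetric])
  qed (use f in simp)
  then show ?thesis using f by (simp add: L2_def)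
qed

lemma H1_grad_diff:
  assumes y: "H1_grad \<Omega> y G" and y': "H1_grad \<Omega> y' G'" and fin: "finite_measure (lebesgue_on \<Omega>)"
  shows "H1_grad \<Omega> (\<lambda>x. y x - y' x) (\<lambda>x. G x - G' x)"
proof -
  have L: "L2 \<Omega> y" "L2 \<Omega> y'" "\<And>i. L2 \<Omega> (\<lambda>x. G x $ i)" "\<And>i. L2 \<Omega> (\<lambda>x. G' x $ i)" and wg: "weak_grad \<Omega> y G" "weak_grad \<Omega> y' G'"
    using y y' by (auto simp: H1_grad_def)
  note I = L2_integrable[OF L(1) fin] L2_integrable[OF L(2) fin] L2_integrable[OF L(3) fin] L2_integrable[OF L(4) fin]
  have "weak_grad \<Omega> (\<lambda>x. y x - y' x) (\<lambda>x. G x - G' x)"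
    unfolding weak_grad_def
  proof (intro allI impI)
    fix \<phi> i assume \<phi>: "test_fun \<Omega> \<phi>"
    have "smooth \<phi>" using \<phi> by (simp add: test_fun_def)
    note cs = csupp_test_fun[OF \<phi>] csupp_partial[OF this csupp_test_fun[OF \<phi>]]
    show "(\<integral>x. (y x - y' x) * partial i \<phi> x \<partial>lebesgue_on \<Omega>) = - (\<integral>x. (G x - G' x) $ i * \<phi> x \<partial>lebesgue_on \<Omega>)"
      using wg \<phi> unfolding weak_grad_def
      by (simp add: left_diff_distrib Bochner_Integration.integral_diff[OF integrable_mult_csupp[OF I(1) cs(2)] integrable_mult_csupp[OF I(2) cs(2)]]
        Bochner_Integration.integral_diff[OF integrable_mult_csupp[OF I(3) cs(1)] integrable_mult_csupp[OF I(4) cs(1)]])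
  qed
  then show ?thesis using L2_diff[OF L(1,2)] L2_diff[OF L(3,4)] by (simp add: H1_grad_def)
qed

section \<open>The arctangent of the state difference as a test function\<close>

lemma arctan_deriv_lipschitz: "\<bar>1 / (1 + x\<^sup>2) - 1 / (1 + y\<^sup>2)\<bar> \<le> 1 * \<bar>x - y\<bar>" for x y :: real
proof -
  have pos: "1 + x\<^sup>2 > 0" "1 + y\<^sup>2 > 0" by (auto intro: add_pos_nonneg)
  have "1 / (1 + x\<^sup>2) - 1 / (1 + y\<^sup>2) = (y - x) * ((y + x) / ((1 + x\<^sup>2) * (1 + y\<^sup>2)))"
    using pos by (simp add: field_simps power2_eq_square)
  moreover have "\<bar>(y + x) / ((1 + x\<^sup>2) * (1 + y\<^sup>2))\<bar> \<le> 1"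
  proof -
    have "0 \<le> (\<bar>x\<bar> - 1)\<^sup>2" "0 \<le> (\<bar>y\<bar> - 1)\<^sup>2" by simp_all
    then have "2 * \<bar>x\<bar> \<le> x\<^sup>2 + 1" "2 * \<bar>y\<bar> \<le> y\<^sup>2 + 1" by (simp_all add: power2_diff)
    moreover have "\<bar>y + x\<bar> \<le> \<bar>y\<bar> + \<bar>x\<bar>" "0 \<le> x\<^sup>2" "0 \<le> y\<^sup>2" by (auto intro: abs_triangle_ineq)
    ultimately have "\<bar>y + x\<bar> \<le> 1 + x\<^sup>2 + y\<^sup>2" by linarith
    also have "\<dots> \<le> (1 + x\<^sup>2) * (1 + y\<^sup>2)" by (simp add: algebra_simps)
    finally show ?thesis using pos by (simp add: abs_divide abs_mult)
  qed
  ultimately have "\<bar>1 / (1 + x\<^sup>2) - 1 / (1 + y\<^sup>2)\<bar> \<le> \<bar>y - x\<bar> * 1"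
    by (simp only: abs_mult) (rule mult_left_mono, auto)
  then show ?thesis by (simp add: abs_minus_commute)
qed

lemma arctan_sq_le: "(arctan w)\<^sup>2 \<le> w * arctan w"
proof (cases "w \<ge> 0")
  case True
  then show ?thesis using arctan_le_self[of w] by (simp add: power2_eq_square mult_right_mono)
next
  case False
  then have "arctan (- w) \<le> - w" "arctan (- w) \<ge> 0" using arctan_le_self[of "- w"] by simp_all
  then have "arctan (- w) * arctan (- w) \<le> (- w) * arctan (- w)" by (rule mult_right_mono)
  then show ?thesis by (simp add: arctan_minus power2_eq_square)
qed

text \<open>Since \<open>W\<close> is 1 + w^2 times \<open>V\<close>, the coefficient form of
  \<open>W\<close> and \<open>V\<close> is that multiple of the form of \<open>V\<close> with
  itself, and ellipticity bounds it below independently of the size of \<open>w\<close>. The other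
  terms are settled by signs: \<open>arctan w\<close> has the sign of \<open>w\<close>, and so has
  the difference of the nonlinear terms, wherever it is not zero.\<close>

lemma state_difference_energy:
  fixes \<Omega> :: "(real^'n) set"
  assumes \<Omega>: "open \<Omega>" "bounded \<Omega>" and ell: "elliptic_op \<Omega> a a0 \<delta>" and d: "nonlin_ok \<Omega> d"
    and S: "state_sol \<Omega> a a0 d u y" "state_sol \<Omega> a a0 d u' y'"
    and u: "L2 \<Omega> u" "L2 \<Omega> u'"
  defines "v \<equiv> \<lambda>x. arctan (y x - y' x)"
  shows "\<exists>V. weak_diff \<Omega> v V \<and> (\<forall>i. L2 \<Omega> (\<lambda>x. V x $ i)) \<and>
      \<delta> * (\<Sum>i\<in>UNIV. \<integral>x. (V x $ i)\<^sup>2 \<partial>lebesgue_on \<Omega>) + (\<integral>x. a0 x * (v x)\<^sup>2 \<partial>lebesgue_on \<Omega>)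
        \<le> (\<integral>x. (u x - u' x) * v x \<partial>lebesgue_on \<Omega>)"
proof -
  have \<Omega>s: "\<Omega> \<in> sets lebesgue" using \<Omega> by auto
  have fin: "finite_measure (lebesgue_on \<Omega>)"
    by (rule finite_measure_lebesgue_on[OF bounded_set_imp_lmeasurable[OF \<Omega>(2) \<Omega>s]])
  interpret finite_measure "lebesgue_on \<Omega>" by (rule fin)
  have cy: "continuous_on (closure \<Omega>) y" "continuous_on (closure \<Omega>) y'"
    using S by (auto simp: state_sol_def)
  obtain G where G: "H1_grad \<Omega> y G" and eqG: "\<And>v V. H1_grad \<Omega> v V \<Longrightarrow>
        (\<integral>x. (\<Sum>i\<in>UNIV. \<Sum>j\<in>UNIV. a i j x * G x $ i * V x $ j) + a0 x * y x * v x + d x (y x) * v x \<partial>lebesgue_on \<Omega>) = (\<integral>x. u x * v x \<partial>lebesgue_on \<Omega>)"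
    using S(1) unfolding state_sol_def by blast
  obtain G' where G': "H1_grad \<Omega> y' G'" and eqG': "\<And>v V. H1_grad \<Omega> v V \<Longrightarrow>
        (\<integral>x. (\<Sum>i\<in>UNIV. \<Sum>j\<in>UNIV. a i j x * G' x $ i * V x $ j) + a0 x * y' x * v x + d x (y' x) * v x \<partial>lebesgue_on \<Omega>) = (\<integral>x. u' x * v x \<partial>lebesgue_on \<Omega>)"
    using S(2) unfolding state_sol_def by blast
  define w where "w x = y x - y' x" for x
  define W where "W x = G x - G' x" for x
  have H1w: "H1_grad \<Omega> w W" unfolding w_def[abs_def] W_def[abs_def] by (rule H1_grad_diff[OF G G' fin])
  have LW: "L2 \<Omega> w" "\<And>i. L2 \<Omega> (\<lambda>x. W x $ i)" using H1w by (auto simp: H1_grad_def)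
  have wd: "weak_diff \<Omega> w W"
    using H1w L2_integrable[OF LW(1) fin] L2_integrable[OF LW(2) fin] \<Omega>(1) by unfold_locales (auto simp: H1_grad_def)
  have cw: "continuous_on \<Omega> w"
    unfolding w_def[abs_def] by (intro continuous_on_diff continuous_on_subset[OF cy(1)] continuous_on_subset[OF cy(2)] closure_subset)
  have meas: "f \<in> borel_measurable (lebesgue_on \<Omega>)" if "continuous_on \<Omega> f" for f :: "real^'n \<Rightarrow> real"
    by (rule continuous_imp_measurable_on_sets_lebesgue[OF that \<Omega>s])
  have vw: "v = (\<lambda>x. arctan (w x))" by (simp add: v_def w_def[abs_def])
  have cv: "continuous_on \<Omega> v" unfolding vw by (intro continuous_intros cw)
  have vB: "\<bar>v x\<bar> \<le> 2" for x
    using arctan_bounded[of "w x"] pi_less_4 unfolding vw by (simp add: abs_le_iff)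
  define T' where "T' x = 1 / (1 + x\<^sup>2)" for x :: real
  define V where "V x = T' (w x) *\<^sub>R W x" for x
  have T'b: "0 < T' x" "T' x \<le> 1" "T' x * (1 + x\<^sup>2) = 1" for x
  proof -
    have "1 + x\<^sup>2 > 0" by (auto intro: add_pos_nonneg)
    then show "0 < T' x" "T' x \<le> 1" "T' x * (1 + x\<^sup>2) = 1" by (auto simp: T'_def)
  qed
  have L2v: "L2 \<Omega> v"
    by (rule L2_bounded[OF meas[OF cv] _ fin, where C = 2]) (simp add: vB)
  have T'm: "(\<lambda>x. T' (w x)) \<in> borel_measurable (lebesgue_on \<Omega>)"
    using meas[OF cw] unfolding T'_def[abs_def] by simp
  have L2V: "L2 \<Omega> (\<lambda>x. V x $ i)" for i
  proof -
    have m: "(\<lambda>x. V x $ i) \<in> borel_measurable (lebesgue_on \<Omega>)"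
      unfolding V_def vector_scaleR_component real_scaleR_def
      by (intro borel_measurable_times T'm L2_measurable LW)
    moreover have "integrable (lebesgue_on \<Omega>) (\<lambda>x. (V x $ i)\<^sup>2)"
    proof (rule Bochner_Integration.integrable_bound[of _ "\<lambda>x. (W x $ i)\<^sup>2"])
      show "AE x in lebesgue_on \<Omega>. norm ((V x $ i)\<^sup>2) \<le> norm ((W x $ i)\<^sup>2)"
      proof (rule AE_I2)
        fix x
        have "(T' (w x))\<^sup>2 * (W x $ i)\<^sup>2 \<le> 1 * (W x $ i)\<^sup>2"
          using T'b[of "w x"] by (intro mult_right_mono) (auto simp: power_le_one)
        then show "norm ((V x $ i)\<^sup>2) \<le> norm ((W x $ i)\<^sup>2)" by (simp add: V_def power_mult_distrib)
      qed
    qed (use m LW(2)[of i] in \<open>auto simp: L2_def\<close>)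
    ultimately show ?thesis by (simp add: L2_def)
  qed
  have wgV: "weak_grad \<Omega> v V"
    unfolding vw V_def[abs_def]
  proof (rule weak_diff.weak_grad_compose[OF wd cw])
    show "(arctan has_real_derivative T' x) (at x)" for x
      using DERIV_arctan[of x] by (simp add: T'_def inverse_eq_divide)
    show "\<bar>T' x - T' y\<bar> \<le> 1 * \<bar>x - y\<bar>" for x y
      unfolding T'_def by (rule arctan_deriv_lipschitz)
    show "integrable (lebesgue_on \<Omega>) (\<lambda>x. arctan (w x))"
      using L2_integrable[OF L2v fin] by (simp add: vw)
  qed
  have H1v: "H1_grad \<Omega> v V" using L2v L2V wgV by (simp add: H1_grad_def)
  have wdv: "weak_diff \<Omega> v V"
    using H1v L2_integrable[OF L2v fin] L2_integrable[OF L2V fin] \<Omega>(1) by unfold_locales (auto simp: H1_grad_def)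
  note E = ell[unfolded elliptic_op_def]
  obtain ca where a0: "a0 \<in> borel_measurable (lebesgue_on \<Omega>)" "AE x in lebesgue_on \<Omega>. \<bar>a0 x\<bar> \<le> ca" "AE x in lebesgue_on \<Omega>. 0 \<le> a0 x"
  proof -
    obtain c where "a0 \<in> borel_measurable (lebesgue_on \<Omega>)" "AE x in lebesgue_on \<Omega>. \<bar>a0 x\<bar> \<le> c"
      using E[THEN conjunct2, THEN conjunct1, unfolded Linf_def] by auto
    then show thesis using that E[THEN conjunct2, THEN conjunct2, THEN conjunct1] by metis
  qed
  have aij: "(a i j) \<in> borel_measurable (lebesgue_on \<Omega>) \<and> (\<exists>C. \<forall>x\<in>\<Omega>. \<bar>a i j x\<bar> \<le> C)" for i j
  proof -
    obtain L where "L-lipschitz_on (closure \<Omega>) (a i j)" using ell unfolding elliptic_op_def by metis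
    then have c: "continuous_on (closure \<Omega>) (a i j)" by (rule lipschitz_on_continuous_on)
    have "compact (closure \<Omega>)" using \<Omega>(2) by (simp add: compact_closure)
    then have "bounded (a i j ` closure \<Omega>)" by (intro compact_imp_bounded compact_continuous_image c)
    then obtain C where "\<forall>t\<in>a i j ` closure \<Omega>. norm t \<le> C" by (auto simp: bounded_iff)
    then have "\<forall>x\<in>\<Omega>. \<bar>a i j x\<bar> \<le> C" using closure_subset[of \<Omega>] by auto
    then show ?thesis using meas[OF continuous_on_subset[OF c closure_subset]] by blast
  qed
  \<comment> \<open>The two equations can be subtracted under one integral only if each left-hand
    side is integrable. The nonlinear term is bounded because a state is continuous on the compact
    closure.\<close>
  have int_term: "integrable (lebesgue_on \<Omega>) (\<lambda>x. (\<Sum>i\<in>UNIV. \<Sum>j\<in>UNIV. a i j x * F x $ i * V x $ j) + a0 x * z x * v x + d x (z x) * v x)"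
    if F: "H1_grad \<Omega> z F" and cz: "continuous_on (closure \<Omega>) z" for z F
  proof -
    have Lz: "L2 \<Omega> z" "\<And>i. L2 \<Omega> (\<lambda>x. F x $ i)" using F by (auto simp: H1_grad_def)
    have t1: "integrable (lebesgue_on \<Omega>) (\<lambda>x. a i j x * F x $ i * V x $ j)" for i j
    proof -
      obtain C where C: "\<forall>x\<in>\<Omega>. \<bar>a i j x\<bar> \<le> C" using aij by blast
      have "integrable (lebesgue_on \<Omega>) (\<lambda>x. (F x $ i * V x $ j) * a i j x)"
        by (rule integrable_mult_bounded[OF L2_mult_integrable[OF Lz(2) L2V], where C = C])
          (use aij C in \<open>auto intro!: AE_I2\<close>)
      then show ?thesis by (simp add: mult_ac)
    qed
    have t2: "integrable (lebesgue_on \<Omega>) (\<lambda>x. a0 x * z x * v x)"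
      using integrable_mult_bounded[OF L2_mult_integrable[OF Lz(1) L2v] a0(1,2)] by (simp add: mult_ac)
    have "bounded (z ` closure \<Omega>)"
      using \<Omega>(2) by (intro compact_imp_bounded compact_continuous_image cz) (simp add: compact_closure)
    then obtain M where M: "M > 0" "\<forall>t\<in>z ` closure \<Omega>. norm t \<le> M" unfolding bounded_pos by blast
    obtain C where C: "AE x in lebesgue_on \<Omega>. \<forall>t. \<bar>t\<bar> \<le> M \<longrightarrow> \<bar>d x t\<bar> \<le> C"
      using nonlin_bounded[OF d less_imp_le[OF M(1)]] by blast
    have zM: "\<bar>z x\<bar> \<le> M" if "x \<in> \<Omega>" for x using M(2) that closure_subset[of \<Omega>] by auto
    have "AE x in lebesgue_on \<Omega>. x \<in> \<Omega>" by (rule AE_I2) simp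
    with C have dC: "AE x in lebesgue_on \<Omega>. \<bar>d x (z x)\<bar> \<le> C"
    proof eventually_elim
      case (elim x)
      then show ?case using zM[of x] by simp
    qed
    have dm: "(\<lambda>x. d x (z x)) \<in> borel_measurable (lebesgue_on \<Omega>)"
    proof (rule caratheodory_measurable[OF _ _ meas[OF continuous_on_subset[OF cz closure_subset]] \<Omega>s])
      show "(\<lambda>x. d x t) \<in> borel_measurable (lebesgue_on \<Omega>)" for t using d by (simp add: nonlin_ok_def)
      show "AE x in lebesgue_on \<Omega>. continuous_on UNIV (d x)" using nonlin_mono[OF d] by (rule eventually_mono) blast
    qed
    have t3: "integrable (lebesgue_on \<Omega>) (\<lambda>x. d x (z x) * v x)"
      using integrable_mult_bounded[OF L2_integrable[OF L2v fin] dm dC] by (simp add: mult.commute)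
    show ?thesis by (intro Bochner_Integration.integrable_add Bochner_Integration.integrable_sum t1 t2 t3)
  qed
  let ?F = "\<lambda>x. (\<Sum>i\<in>UNIV. \<Sum>j\<in>UNIV. a i j x * G x $ i * V x $ j) + a0 x * y x * v x + d x (y x) * v x"
  let ?F' = "\<lambda>x. (\<Sum>i\<in>UNIV. \<Sum>j\<in>UNIV. a i j x * G' x $ i * V x $ j) + a0 x * y' x * v x + d x (y' x) * v x"
  have iF: "integrable (lebesgue_on \<Omega>) ?F" "integrable (lebesgue_on \<Omega>) ?F'"
    by (rule int_term[OF G cy(1)], rule int_term[OF G' cy(2)])
  have iV2: "integrable (lebesgue_on \<Omega>) (\<lambda>x. (V x $ i)\<^sup>2)" for i using L2V[of i] by (simp add: L2_def)
  have iav: "integrable (lebesgue_on \<Omega>) (\<lambda>x. a0 x * (v x)\<^sup>2)"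
    using integrable_mult_bounded[OF L2_mult_integrable[OF L2v L2v] a0(1,2)] by (simp add: power2_eq_square mult_ac)
  have "\<delta> * (\<Sum>i\<in>UNIV. \<integral>x. (V x $ i)\<^sup>2 \<partial>lebesgue_on \<Omega>) + (\<integral>x. a0 x * (v x)\<^sup>2 \<partial>lebesgue_on \<Omega>)
      = (\<integral>x. \<delta> * (\<Sum>i\<in>UNIV. (V x $ i)\<^sup>2) + a0 x * (v x)\<^sup>2 \<partial>lebesgue_on \<Omega>)"
    by (subst Bochner_Integration.integral_add) (auto intro!: integrable_mult_right Bochner_Integration.integrable_sum iV2 iav simp: Bochner_Integration.integral_sum iV2)
  also have "\<dots> \<le> (\<integral>x. ?F x - ?F' x \<partial>lebesgue_on \<Omega>)"
  proof (rule integral_mono_AE)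
    show "integrable (lebesgue_on \<Omega>) (\<lambda>x. \<delta> * (\<Sum>i\<in>UNIV. (V x $ i)\<^sup>2) + a0 x * (v x)\<^sup>2)"
      by (intro Bochner_Integration.integrable_add integrable_mult_right Bochner_Integration.integrable_sum iV2 iav)
    show "integrable (lebesgue_on \<Omega>) (\<lambda>x. ?F x - ?F' x)"
      by (rule Bochner_Integration.integrable_diff[OF iF])
    have "AE x in lebesgue_on \<Omega>. x \<in> \<Omega>" by (rule AE_I2) simp
    with nonlin_mono[OF d] a0(3)
    show "AE x in lebesgue_on \<Omega>. \<delta> * (\<Sum>i\<in>UNIV. (V x $ i)\<^sup>2) + a0 x * (v x)\<^sup>2 \<le> ?F x - ?F' x"
    proof eventually_elim
      case (elim x)
      let ?A = "\<Sum>i\<in>UNIV. \<Sum>j\<in>UNIV. a i j x * V x $ i * V x $ j"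
      have WV: "W x $ i = (1 + (w x)\<^sup>2) * V x $ i" for i
      proof -
        have "(1 + (w x)\<^sup>2) * V x $ i = (T' (w x) * (1 + (w x)\<^sup>2)) * W x $ i"
          unfolding V_def vector_scaleR_component real_scaleR_def by (simp only: mult_ac)
        then show ?thesis by (simp add: T'b(3))
      qed
      have ellx: "\<delta> * (norm (V x))\<^sup>2 \<le> ?A" and \<delta>: "\<delta> > 0"
        using E[THEN conjunct2, THEN conjunct2, THEN conjunct2, THEN conjunct2, THEN conjunct2, rule_format, OF elim(3)]
          E[THEN conjunct2, THEN conjunct2, THEN conjunct2, THEN conjunct2, THEN conjunct1] .
      have nV: "(norm (V x))\<^sup>2 = (\<Sum>i\<in>UNIV. (V x $ i)\<^sup>2)"
        unfolding power2_norm_eq_inner inner_vec_def by (simp add: power2_eq_square)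
      \<comment> \<open>Nonnegativity of the form is what allows the factor 1 + w^2 to be
        inserted.\<close>
      have "0 \<le> ?A" using ellx \<delta> by (meson order_trans zero_le_mult_iff less_imp_le zero_le_power2)
      then have "?A \<le> (1 + (w x)\<^sup>2) * ?A"
        using mult_nonneg_nonneg[OF zero_le_power2[of "w x"]] by (simp add: distrib_right)
      also have "\<dots> = (\<Sum>i\<in>UNIV. \<Sum>j\<in>UNIV. a i j x * W x $ i * V x $ j)"
        by (simp add: WV sum_distrib_left mult_ac)
      also have "\<dots> = (\<Sum>i\<in>UNIV. \<Sum>j\<in>UNIV. a i j x * G x $ i * V x $ j) - (\<Sum>i\<in>UNIV. \<Sum>j\<in>UNIV. a i j x * G' x $ i * V x $ j)"
        by (simp add: W_def sum_subtractf left_diff_distrib right_diff_distrib)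
      finally have 1: "\<delta> * (\<Sum>i\<in>UNIV. (V x $ i)\<^sup>2) \<le> (\<Sum>i\<in>UNIV. \<Sum>j\<in>UNIV. a i j x * G x $ i * V x $ j) - (\<Sum>i\<in>UNIV. \<Sum>j\<in>UNIV. a i j x * G' x $ i * V x $ j)"
        using ellx nV by simp
      have "a0 x * (v x)\<^sup>2 \<le> a0 x * (w x * v x)"
        unfolding vw by (intro mult_left_mono arctan_sq_le elim)
      then have 2: "a0 x * (v x)\<^sup>2 \<le> a0 x * y x * v x - a0 x * y' x * v x"
        by (simp add: w_def algebra_simps)
      have 3: "0 \<le> d x (y x) * v x - d x (y' x) * v x"
      proof (cases "y' x \<le> y x")
        case True
        then have "0 \<le> (d x (y x) - d x (y' x)) * v x"
          using elim(1) by (intro mult_nonneg_nonneg) (auto simp: v_def)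
        then show ?thesis by (simp add: left_diff_distrib)
      next
        case False
        then have "0 \<le> (d x (y x) - d x (y' x)) * v x"
          using elim(1) by (intro mult_nonpos_nonpos) (auto simp: v_def)
        then show ?thesis by (simp add: left_diff_distrib)
      qed
      show ?case using 1 2 3 by linarith
    qed
  qed
  also have "\<dots> = (\<integral>x. u x * v x \<partial>lebesgue_on \<Omega>) - (\<integral>x. u' x * v x \<partial>lebesgue_on \<Omega>)"
    unfolding eqG[OF H1v, symmetric] eqG'[OF H1v, symmetric] by (rule Bochner_Integration.integral_diff[OF iF])
  also have "\<dots> = (\<integral>x. (u x - u' x) * v x \<partial>lebesgue_on \<Omega>)"
    unfolding left_diff_distrib
    by (rule Bochner_Integration.integral_diff[symmetric, OF L2_mult_integrable[OF u(1) L2v] L2_mult_integrable[OF u(2) L2v]])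
  finally show ?thesis using wdv L2V by blast
qed

section \<open>Convergence of the states\<close>

lemma weak_conv_L2_test:
  assumes u: "weak_conv_L2 \<Omega> u u'" and g: "g \<in> borel_measurable (lebesgue_on \<Omega>)" "\<And>x. \<bar>g x\<bar> \<le> 1"
    and fin: "finite_measure (lebesgue_on \<Omega>)"
  shows "(\<lambda>j. \<integral>x. u j x * g x \<partial>lebesgue_on \<Omega>) \<longlonglongrightarrow> (\<integral>x. u' x * g x \<partial>lebesgue_on \<Omega>)"
proof -
  have "L2 \<Omega> g" by (rule L2_bounded[OF g(1) _ fin, where C = 1]) (simp add: g(2))
  then show ?thesis using u unfolding weak_conv_L2_def ip_def by blast
qed

text \<open>The factor \<open>c\<close> serves to obtain both signs from one proof: it is used with
  1 and with -1.\<close>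

lemma weak_limit_upper_bound:
  assumes u: "weak_conv_L2 \<Omega> u u'" and M: "\<And>j. AE x in lebesgue_on \<Omega>. c * u j x \<le> M"
    and fin: "finite_measure (lebesgue_on \<Omega>)"
  shows "AE x in lebesgue_on \<Omega>. c * u' x \<le> M"
proof -
  interpret finite_measure "lebesgue_on \<Omega>" by (rule fin)
  have L: "L2 \<Omega> u'" "\<And>j. L2 \<Omega> (u j)" using u by (auto simp: weak_conv_L2_def)
  note um = L2_measurable[OF L(1)]
  \<comment> \<open>The test function is the indicator of the set where the limit violates the
    bound.\<close>
  define g where "g x = (if c * u' x > M then 1 else 0 :: real)" for x
  have gm: "g \<in> borel_measurable (lebesgue_on \<Omega>)"
    unfolding g_def[abs_def] using um by measurable
  have g1: "\<bar>g x\<bar> \<le> 1" for x by (simp add: g_def)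
  have ig: "integrable (lebesgue_on \<Omega>) g"
    by (rule integrable_const_bound[where B = 1]) (use gm g1 in auto)
  have iug: "integrable (lebesgue_on \<Omega>) (\<lambda>x. w x * g x)" if "L2 \<Omega> w" for w
    by (rule integrable_mult_bounded[OF L2_integrable[OF that fin] gm]) (rule AE_I2, rule g1)
  have "c * (\<integral>x. u' x * g x \<partial>lebesgue_on \<Omega>) \<le> M * (\<integral>x. g x \<partial>lebesgue_on \<Omega>)"
  proof (rule tendsto_upperbound)
    show "(\<lambda>j. c * (\<integral>x. u j x * g x \<partial>lebesgue_on \<Omega>)) \<longlonglongrightarrow> c * (\<integral>x. u' x * g x \<partial>lebesgue_on \<Omega>)"
      by (intro tendsto_mult tendsto_const weak_conv_L2_test[OF u gm g1 fin])
    have "c * (\<integral>x. u j x * g x \<partial>lebesgue_on \<Omega>) \<le> M * (\<integral>x. g x \<partial>lebesgue_on \<Omega>)" for j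
    proof -
      have "(\<integral>x. c * (u j x * g x) \<partial>lebesgue_on \<Omega>) \<le> (\<integral>x. M * g x \<partial>lebesgue_on \<Omega>)"
        by (rule integral_mono_AE[OF integrable_mult_right[OF iug[OF L(2)]] integrable_mult_right[OF ig]])
          (use M[of j] in \<open>auto simp: g_def elim!: eventually_mono\<close>)
      then show ?thesis by simp
    qed
    then show "\<forall>\<^sub>F j in sequentially. c * (\<integral>x. u j x * g x \<partial>lebesgue_on \<Omega>) \<le> M * (\<integral>x. g x \<partial>lebesgue_on \<Omega>)"
      by (intro always_eventually allI)
  qed simp
  note le = this
  \<comment> \<open>The excess over \<open>M\<close> on the violating set is nonnegative, yet its
    integral is at most 0 by the limit; hence it vanishes almost everywhere.\<close>
  have nn: "0 \<le> c * (u' x * g x) - M * g x" for x by (simp add: g_def)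
  have int: "integrable (lebesgue_on \<Omega>) (\<lambda>x. c * (u' x * g x) - M * g x)"
    by (intro Bochner_Integration.integrable_diff integrable_mult_right iug[OF L(1)] ig)
  have "(\<integral>x. c * (u' x * g x) - M * g x \<partial>lebesgue_on \<Omega>) = c * (\<integral>x. u' x * g x \<partial>lebesgue_on \<Omega>) - M * (\<integral>x. g x \<partial>lebesgue_on \<Omega>)"
    by (subst Bochner_Integration.integral_diff[OF integrable_mult_right[OF iug[OF L(1)]] integrable_mult_right[OF ig]]) simp
  moreover have "0 \<le> (\<integral>x. c * (u' x * g x) - M * g x \<partial>lebesgue_on \<Omega>)"
    by (rule Bochner_Integration.integral_nonneg[OF nn])
  ultimately have "(\<integral>x. c * (u' x * g x) - M * g x \<partial>lebesgue_on \<Omega>) = 0"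
    using le by linarith
  then have "AE x in lebesgue_on \<Omega>. c * (u' x * g x) - M * g x = 0"
    using integral_nonneg_eq_0_iff_AE[OF int] nn by simp
  then show ?thesis by (rule eventually_mono) (simp add: g_def split: if_splits)
qed

lemma weak_limit_bounded:
  assumes u: "weak_conv_L2 \<Omega> u u'" and M: "\<And>j. AE x in lebesgue_on \<Omega>. \<bar>u j x\<bar> \<le> M"
    and fin: "finite_measure (lebesgue_on \<Omega>)"
  shows "AE x in lebesgue_on \<Omega>. \<bar>u' x\<bar> \<le> M"
proof -
  have "AE x in lebesgue_on \<Omega>. 1 * u j x \<le> M" "AE x in lebesgue_on \<Omega>. (-1) * u j x \<le> M" for j
    using M[of j] by (auto elim!: eventually_mono)
  from weak_limit_upper_bound[OF u this(1) fin] weak_limit_upper_bound[OF u this(2) fin]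
  show ?thesis by eventually_elim simp
qed

lemma tent_integral_pos:
  fixes \<Omega> :: "'a::euclidean_space set"
  assumes r: "r > 0" and \<Omega>: "open \<Omega>" "ball x r \<subseteq> \<Omega>"
  shows "0 < (\<integral>y. tent x r y \<partial>lebesgue_on \<Omega>)"
proof -
  have \<Omega>s: "\<Omega> \<in> sets lebesgue" using \<Omega> by auto
  have int: "integrable (lebesgue_on \<Omega>) (tent x r)" by (rule csupp_integrable[OF csupp_tent[OF r] \<Omega>s])
  have "(\<integral>y. tent x r y \<partial>lebesgue_on \<Omega>) \<noteq> 0"
  proof
    assume "(\<integral>y. tent x r y \<partial>lebesgue_on \<Omega>) = 0"
    then have "AE y in lebesgue_on \<Omega>. tent x r y = 0"
      using integral_nonneg_eq_0_iff_AE[OF int AE_I2[OF tent_nonneg]] by simp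
    from negligible_of_AE[OF this \<Omega>s] have n: "negligible {y \<in> \<Omega>. tent x r y \<noteq> 0}" .
    have "negligible (ball x r)"
    proof (rule negligible_subset[OF n], rule subsetI)
      fix y assume y: "y \<in> ball x r"
      then show "y \<in> {y \<in> \<Omega>. tent x r y \<noteq> 0}" using tent_pos[OF r, of x y] \<Omega>(2) by auto
    qed
    then show False using open_not_negligible[OF open_ball, of x r] r by simp
  qed
  then show ?thesis
    using Bochner_Integration.integral_nonneg[of "lebesgue_on \<Omega>" "tent x r"] tent_nonneg[of x r] by (simp add: order_less_le)
qed

text \<open>The arctangent makes the test function bounded although the states are not known to be uniformly bounded.\<close>
lemma states_converge_locally:
  fixes \<Omega> :: "(real^'n) set"
  assumes \<Omega>: "open \<Omega>" "bounded \<Omega>" "connected \<Omega>" and ell: "elliptic_op \<Omega> a a0 \<delta>" and d: "nonlin_ok \<Omega> d"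
    and S: "\<And>j. state_sol \<Omega> a a0 d (u j) (y j)" "state_sol \<Omega> a a0 d u' y'"
    and u: "weak_conv_L2 \<Omega> u u'" and M: "\<And>j. AE x in lebesgue_on \<Omega>. \<bar>u j x\<bar> \<le> M" "M > 0" and x: "x \<in> \<Omega>"
  shows "\<exists>r>0. cball x r \<subseteq> \<Omega> \<and> (\<lambda>j. \<integral>t. tent x r t * \<bar>arctan (y j t - y' t)\<bar> \<partial>lebesgue_on \<Omega>) \<longlonglongrightarrow> 0"
proof -
  have \<Omega>s: "\<Omega> \<in> sets lebesgue" using \<Omega> by auto
  have fin: "finite_measure (lebesgue_on \<Omega>)"
    by (rule finite_measure_lebesgue_on[OF bounded_set_imp_lmeasurable[OF \<Omega>(2) \<Omega>s]])
  interpret finite_measure "lebesgue_on \<Omega>" by (rule fin)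
  have L: "L2 \<Omega> u'" "\<And>j. L2 \<Omega> (u j)" using u by (auto simp: weak_conv_L2_def)
  define v where "v j x = arctan (y j x - y' x)" for j x
  define h where "h j x = u j x - u' x" for j x
  define E where "E j = (\<integral>x. h j x * v j x \<partial>lebesgue_on \<Omega>)" for j
  have "\<exists>V. weak_diff \<Omega> (v j) V \<and> (\<forall>i. L2 \<Omega> (\<lambda>x. V x $ i)) \<and>
      \<delta> * (\<Sum>i\<in>UNIV. \<integral>x. (V x $ i)\<^sup>2 \<partial>lebesgue_on \<Omega>) + (\<integral>x. a0 x * (v j x)\<^sup>2 \<partial>lebesgue_on \<Omega>) \<le> E j" for j
    unfolding E_def h_def v_def
    by (rule state_difference_energy[OF \<Omega>(1,2) ell d S(1) S(2) L(2) L(1)])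
  then have "\<forall>j. \<exists>V. weak_diff \<Omega> (v j) V \<and> (\<forall>i. L2 \<Omega> (\<lambda>x. V x $ i)) \<and>
      \<delta> * (\<Sum>i\<in>UNIV. \<integral>x. (V x $ i)\<^sup>2 \<partial>lebesgue_on \<Omega>) + (\<integral>x. a0 x * (v j x)\<^sup>2 \<partial>lebesgue_on \<Omega>) \<le> E j"
    by (rule allI)
  from choice[OF this] obtain V where wd: "\<And>j. weak_diff \<Omega> (v j) (V j)" and L2V: "\<And>j i. L2 \<Omega> (\<lambda>x. V j x $ i)"
    and en: "\<And>j. \<delta> * (\<Sum>i\<in>UNIV. \<integral>x. (V j x $ i)\<^sup>2 \<partial>lebesgue_on \<Omega>) + (\<integral>x. a0 x * (v j x)\<^sup>2 \<partial>lebesgue_on \<Omega>) \<le> E j"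
    by auto
  have cy: "continuous_on \<Omega> (y j)" "continuous_on \<Omega> y'" for j
    using S(1)[of j] S(2) by (auto simp: state_sol_def intro: continuous_on_subset[OF _ closure_subset])
  have cv: "continuous_on \<Omega> (v j)" for j
    unfolding v_def[abs_def] by (intro continuous_intros cy)
  have vB: "\<bar>v j x\<bar> \<le> 2" for j x
    using arctan_bounded[of "y j x - y' x"] pi_less_4 unfolding v_def by (simp add: abs_le_iff)
  have vm: "v j \<in> borel_measurable (lebesgue_on \<Omega>)" for j
    by (rule continuous_imp_measurable_on_sets_lebesgue[OF cv \<Omega>s])
  have L2v: "L2 \<Omega> (v j)" for j
    by (rule L2_bounded[OF vm _ fin, where C = 2]) (simp add: vB)
  note EL = ell[unfolded elliptic_op_def]
  have \<delta>: "\<delta> > 0" using EL[THEN conjunct2, THEN conjunct2, THEN conjunct2, THEN conjunct2, THEN conjunct1] .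
  have a0nz: "\<not> (AE x in lebesgue_on \<Omega>. a0 x = 0)" using EL[THEN conjunct2, THEN conjunct2, THEN conjunct2, THEN conjunct1] .
  have a0nn: "AE x in lebesgue_on \<Omega>. 0 \<le> a0 x" using EL[THEN conjunct2, THEN conjunct2, THEN conjunct1] .
  obtain ca where a0m: "a0 \<in> borel_measurable (lebesgue_on \<Omega>)" and ca: "AE x in lebesgue_on \<Omega>. \<bar>a0 x\<bar> \<le> ca"
    using EL[THEN conjunct2, THEN conjunct1, unfolded Linf_def] by auto
  have a0A: "AE x in lebesgue_on \<Omega>. a0 x \<le> \<bar>ca\<bar>" using ca by (rule eventually_mono) simp
  \<comment> \<open>The limit inherits the pointwise bound, so that \<open>h j\<close> is bounded
    uniformly in \<open>j\<close>, as the pairing lemma requires.\<close>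
  have u'M: "AE x in lebesgue_on \<Omega>. \<bar>u' x\<bar> \<le> M" by (rule weak_limit_bounded[OF u M(1) fin])
  have hm: "h j \<in> borel_measurable (lebesgue_on \<Omega>)" for j
    unfolding h_def[abs_def] by (intro borel_measurable_diff L2_measurable L)
  have hB: "AE x in lebesgue_on \<Omega>. \<bar>h j x\<bar> \<le> 2 * M" for j
    using M(1)[of j] u'M by eventually_elim (simp add: h_def)
  define m where "m = measure (lebesgue_on \<Omega>) (space (lebesgue_on \<Omega>))"
  have iV2: "integrable (lebesgue_on \<Omega>) (\<lambda>x. (V j x $ i)\<^sup>2)" for j i using L2V[of j i] by (simp add: L2_def)
  have iVa: "integrable (lebesgue_on \<Omega>) (\<lambda>x. \<bar>V j x $ i\<bar>)" for j i
    by (rule integrable_abs[OF L2_integrable[OF L2V fin]])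
  have av_nn: "0 \<le> (\<integral>x. a0 x * (v j x)\<^sup>2 \<partial>lebesgue_on \<Omega>)" for j
    by (rule integral_nonneg_AE) (use a0nn in \<open>auto elim!: eventually_mono\<close>)
  have V2_nn: "0 \<le> (\<integral>x. (V j x $ i)\<^sup>2 \<partial>lebesgue_on \<Omega>)" for j i by simp
  have sumV: "\<delta> * (\<Sum>i\<in>UNIV. \<integral>x. (V j x $ i)\<^sup>2 \<partial>lebesgue_on \<Omega>) \<le> E j" for j
    using en[of j] av_nn[of j] by linarith
  have EB: "E j \<le> 2 * M * 2 * m" for j
  proof -
    have "E j \<le> (\<integral>x. 2 * M * 2 \<partial>lebesgue_on \<Omega>)"
      unfolding E_def
    proof (rule integral_mono_AE)
      show "integrable (lebesgue_on \<Omega>) (\<lambda>x. h j x * v j x)"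
        unfolding h_def by (rule L2_mult_integrable[OF L2_diff[OF L(2) L(1)] L2v])
      show "AE x in lebesgue_on \<Omega>. h j x * v j x \<le> 2 * M * 2"
        using hB[of j]
      proof (rule eventually_mono)
        fix x assume h: "\<bar>h j x\<bar> \<le> 2 * M"
        have "h j x * v j x \<le> \<bar>h j x\<bar> * \<bar>v j x\<bar>" by (metis abs_ge_self abs_mult)
        also have "\<dots> \<le> 2 * M * 2" using h vB[of j x] M(2) by (intro mult_mono) auto
        finally show "h j x * v j x \<le> 2 * M * 2" .
      qed
    qed simp
    then show ?thesis by (simp add: m_def mult_ac)
  qed
  \<comment> \<open>The estimate |s| \<le> 1 + s^2 passes from the energy to the L^1 mass at the
    price of the volume \<open>m\<close> for each component.\<close>
  have gB: "grad_mass \<Omega> (V j) \<le> real CARD('n) * m + 2 * M * 2 * m / \<delta>" for j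
  proof -
    have "grad_mass \<Omega> (V j) \<le> (\<Sum>i\<in>UNIV. m + (\<integral>x. (V j x $ i)\<^sup>2 \<partial>lebesgue_on \<Omega>))"
      unfolding grad_mass_def
    proof (rule sum_mono)
      fix i
      have "(\<integral>x. \<bar>V j x $ i\<bar> \<partial>lebesgue_on \<Omega>) \<le> (\<integral>x. 1 + (V j x $ i)\<^sup>2 \<partial>lebesgue_on \<Omega>)"
      proof (rule integral_mono[OF iVa])
        show "integrable (lebesgue_on \<Omega>) (\<lambda>x. 1 + (V j x $ i)\<^sup>2)"
          by (intro Bochner_Integration.integrable_add iV2) simp
        show "\<bar>V j x $ i\<bar> \<le> 1 + (V j x $ i)\<^sup>2" for x
        proof -
          have "0 \<le> (\<bar>V j x $ i\<bar> - 1)\<^sup>2" by simp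
          then have "2 * \<bar>V j x $ i\<bar> \<le> 1 + (V j x $ i)\<^sup>2" by (simp add: power2_diff)
          then show ?thesis by linarith
        qed
      qed
      also have "\<dots> = m + (\<integral>x. (V j x $ i)\<^sup>2 \<partial>lebesgue_on \<Omega>)"
        by (subst Bochner_Integration.integral_add[OF _ iV2]) (simp_all add: m_def)
      finally show "(\<integral>x. \<bar>V j x $ i\<bar> \<partial>lebesgue_on \<Omega>) \<le> m + (\<integral>x. (V j x $ i)\<^sup>2 \<partial>lebesgue_on \<Omega>)" .
    qed
    also have "\<dots> = real CARD('n) * m + (\<Sum>i\<in>UNIV. \<integral>x. (V j x $ i)\<^sup>2 \<partial>lebesgue_on \<Omega>)"
      by (simp add: sum.distrib)
    also have "(\<Sum>i\<in>UNIV. \<integral>x. (V j x $ i)\<^sup>2 \<partial>lebesgue_on \<Omega>) \<le> 2 * M * 2 * m / \<delta>"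
      using order_trans[OF sumV EB, of j] \<delta> by (simp add: pos_le_divide_eq mult.commute)
    finally show ?thesis by simp
  qed
  have E_lim: "E \<longlonglongrightarrow> 0"
    unfolding E_def
  proof (rule pairing_tendsto_0[OF \<Omega>(1,2) wd cv vB _ gB hm hB])
    fix g :: "real^'n \<Rightarrow> real" assume g: "g \<in> borel_measurable (lebesgue_on \<Omega>)" "\<And>x. \<bar>g x\<bar> \<le> 1"
    have i: "integrable (lebesgue_on \<Omega>) (\<lambda>x. z x * g x)" if "L2 \<Omega> z" for z
      by (rule integrable_mult_bounded[OF L2_integrable[OF that fin] g(1)]) (rule AE_I2, rule g(2))
    have "(\<lambda>j. (\<integral>x. u j x * g x \<partial>lebesgue_on \<Omega>) - (\<integral>x. u' x * g x \<partial>lebesgue_on \<Omega>)) \<longlonglongrightarrow> 0"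
      using tendsto_diff[OF weak_conv_L2_test[OF u g fin] tendsto_const[of "\<integral>x. u' x * g x \<partial>lebesgue_on \<Omega>"]] by simp
    then show "(\<lambda>j. \<integral>x. h j x * g x \<partial>lebesgue_on \<Omega>) \<longlonglongrightarrow> 0"
      by (simp add: h_def left_diff_distrib Bochner_Integration.integral_diff[OF i[OF L(2)] i[OF L(1)]])
  qed (use M(2) in auto)
  \<comment> \<open>The weight 1 is written out to match \<open>weighted_L1_of_L2_tendsto_0\<close>,
    which is used with weight 1 here and with weight \<open>a0\<close> below.\<close>
  have V2_lim: "(\<lambda>j. \<integral>x. 1 * (V j x $ i)\<^sup>2 \<partial>lebesgue_on \<Omega>) \<longlonglongrightarrow> 0" for i
  proof (rule tendsto_sandwich[OF always_eventually always_eventually tendsto_const]; (intro allI)?)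
    fix j
    have "(\<integral>x. (V j x $ i)\<^sup>2 \<partial>lebesgue_on \<Omega>) \<le> (\<Sum>i\<in>UNIV. \<integral>x. (V j x $ i)\<^sup>2 \<partial>lebesgue_on \<Omega>)"
      by (rule member_le_sum[where f = "\<lambda>i. \<integral>x. (V j x $ i)\<^sup>2 \<partial>lebesgue_on \<Omega>"]) auto
    also have "\<dots> \<le> E j / \<delta>" using sumV[of j] \<delta> by (simp add: pos_le_divide_eq mult.commute)
    finally show "(\<integral>x. 1 * (V j x $ i)\<^sup>2 \<partial>lebesgue_on \<Omega>) \<le> E j / \<delta>" by simp
  next
    show "(\<lambda>j. E j / \<delta>) \<longlonglongrightarrow> 0" using tendsto_divide[OF E_lim tendsto_const[of \<delta>]] \<delta> by simp
  qed simp
  have V_lim: "(\<lambda>j. \<integral>x. \<bar>V j x $ i\<bar> \<partial>lebesgue_on \<Omega>) \<longlonglongrightarrow> 0" for i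
  proof -
    have "(\<lambda>j. \<integral>x. 1 * \<bar>V j x $ i\<bar> \<partial>lebesgue_on \<Omega>) \<longlonglongrightarrow> 0"
      by (rule weighted_L1_of_L2_tendsto_0[OF _ _ _ _ V2_lim]) (use iV2 iVa in auto)
    then show ?thesis by simp
  qed
  have gm_lim: "(\<lambda>j. grad_mass \<Omega> (V j)) \<longlonglongrightarrow> 0"
    unfolding grad_mass_def using tendsto_sum[of UNIV "\<lambda>i j. \<integral>x. \<bar>V j x $ i\<bar> \<partial>lebesgue_on \<Omega>" "\<lambda>_. 0", OF V_lim] by simp
  have av2_lim: "(\<lambda>j. \<integral>x. a0 x * (v j x)\<^sup>2 \<partial>lebesgue_on \<Omega>) \<longlonglongrightarrow> 0"
  proof (rule tendsto_sandwich[OF always_eventually always_eventually tendsto_const E_lim]; intro allI)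
    fix j
    have "0 \<le> \<delta> * (\<Sum>i\<in>UNIV. \<integral>x. (V j x $ i)\<^sup>2 \<partial>lebesgue_on \<Omega>)"
      using \<delta> V2_nn by (intro mult_nonneg_nonneg sum_nonneg) auto
    then show "(\<integral>x. a0 x * (v j x)\<^sup>2 \<partial>lebesgue_on \<Omega>) \<le> E j" using en[of j] by linarith
  qed (rule av_nn)
  have ia0: "integrable (lebesgue_on \<Omega>) a0"
    by (rule integrable_const_bound[where B = ca]) (use ca a0m in auto)
  have av_lim: "(\<lambda>j. \<integral>x. a0 x * \<bar>v j x\<bar> \<partial>lebesgue_on \<Omega>) \<longlonglongrightarrow> 0"
  proof (rule weighted_L1_of_L2_tendsto_0[OF a0nn ia0 _ _ av2_lim])
    show "integrable (lebesgue_on \<Omega>) (\<lambda>x. a0 x * (v j x)\<^sup>2)" for j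
      using integrable_mult_bounded[OF L2_mult_integrable[OF L2v L2v] a0m ca, of j] by (simp add: power2_eq_square mult_ac)
    show "integrable (lebesgue_on \<Omega>) (\<lambda>x. a0 x * \<bar>v j x\<bar>)" for j
      using integrable_mult_bounded[OF integrable_abs[OF L2_integrable[OF L2v fin]] a0m ca, of j] by (simp add: mult_ac)
  qed
  show ?thesis
    using local_vanishing[OF \<Omega> wd cv vB _ gm_lim a0m a0nn a0A _ a0nz av_lim x] unfolding v_def by simp
qed

text \<open>If the limit exceeded \<open>\<psi>\<close> at an interior point, it would exceed the
  almost feasible \<open>y j\<close> by a fixed amount on a small ball for all large
  \<open>j\<close>, against the local convergence of the arctangents in L^1.\<close>

lemma limit_state_feasible:
  fixes \<Omega> :: "(real^'n) set"
  assumes \<Omega>: "open \<Omega>" "bounded \<Omega>" "connected \<Omega>" and ell: "elliptic_op \<Omega> a a0 \<delta>" and d: "nonlin_ok \<Omega> d"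
    and S: "\<And>j. state_sol \<Omega> a a0 d (u j) (y j)" "state_sol \<Omega> a a0 d u' y'"
    and u: "weak_conv_L2 \<Omega> u u'" and M: "\<And>j. AE x in lebesgue_on \<Omega>. \<bar>u j x\<bar> \<le> M" "M > 0"
    and \<psi>: "continuous_on (closure \<Omega>) \<psi>" and e: "e \<longlonglongrightarrow> 0" and y\<psi>: "\<And>j x. x \<in> closure \<Omega> \<Longrightarrow> y j x \<le> \<psi> x + e j"
    and x: "x \<in> closure \<Omega>"
  shows "y' x \<le> \<psi> x"
proof -
  have \<Omega>s: "\<Omega> \<in> sets lebesgue" using \<Omega> by auto
  have cy: "continuous_on (closure \<Omega>) (y j)" "continuous_on (closure \<Omega>) y'" for j
    using S(1)[of j] S(2) by (auto simp: state_sol_def)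
  have cd: "continuous_on (closure \<Omega>) (\<lambda>x. y' x - \<psi> x)" by (intro continuous_on_diff cy \<psi>)
  have "y' x - \<psi> x \<le> 0" if x: "x \<in> \<Omega>" for x
  proof (rule ccontr)
    assume "\<not> y' x - \<psi> x \<le> 0"
    \<comment> \<open>The excess is split into three: one part is lost by moving away from
      \<open>x\<close>, one to the violation \<open>e j\<close>, and one remains as a lower bound
      for \<open>y' - y j\<close>.\<close>
    define \<eta> where "\<eta> = (y' x - \<psi> x) / 3"
    have \<eta>: "\<eta> > 0" "y' x - \<psi> x = 3 * \<eta>" using \<open>\<not> y' x - \<psi> x \<le> 0\<close> by (auto simp: \<eta>_def)
    obtain r where r: "r > 0" "cball x r \<subseteq> \<Omega>"
      and l: "(\<lambda>j. \<integral>t. tent x r t * \<bar>arctan (y j t - y' t)\<bar> \<partial>lebesgue_on \<Omega>) \<longlonglongrightarrow> 0"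
      using states_converge_locally[OF \<Omega> ell d S u M x] by blast
    have "continuous (at x within closure \<Omega>) (\<lambda>x. y' x - \<psi> x)"
      using cd x closure_subset[of \<Omega>] by (auto simp: continuous_on_eq_continuous_within)
    then obtain q where q: "q > 0" "\<And>t. t \<in> closure \<Omega> \<Longrightarrow> dist t x < q \<Longrightarrow> dist (y' t - \<psi> t) (y' x - \<psi> x) < \<eta>"
      unfolding continuous_within_eps_delta using \<eta>(1) by metis
    \<comment> \<open>Half of \<open>q\<close> keeps even the closed ball strictly within distance
      \<open>q\<close>; the smaller tent still lies below the one of radius
      \<open>r\<close>.\<close>
    define r' where "r' = min r (q / 2)"
    have r': "r' > 0" "r' \<le> r" "r' < q" using r q by (auto simp: r'_def)
    have ball: "ball x r' \<subseteq> \<Omega>" using r(2) r'(2) by auto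
    define c where "c = arctan \<eta> * (\<integral>t. tent x r' t \<partial>lebesgue_on \<Omega>)"
    have c: "c > 0"
      unfolding c_def using tent_integral_pos[OF r'(1) \<Omega>(1) ball] \<eta>(1) by (simp add: zero_less_arctan_iff)
    have "\<forall>\<^sub>F j in sequentially. e j < \<eta>" by (rule order_tendstoD(2)[OF e \<eta>(1)])
    moreover have "\<forall>\<^sub>F j in sequentially. (\<integral>t. tent x r t * \<bar>arctan (y j t - y' t)\<bar> \<partial>lebesgue_on \<Omega>) < c"
      by (rule order_tendstoD(2)[OF l c])
    ultimately have "\<forall>\<^sub>F j in sequentially. e j < \<eta> \<and> (\<integral>t. tent x r t * \<bar>arctan (y j t - y' t)\<bar> \<partial>lebesgue_on \<Omega>) < c"
      by (rule eventually_conj)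
    then obtain j where j: "e j < \<eta>" "(\<integral>t. tent x r t * \<bar>arctan (y j t - y' t)\<bar> \<partial>lebesgue_on \<Omega>) < c"
      using eventually_happens'[OF sequentially_bot] by blast
    have "c = (\<integral>t. arctan \<eta> * tent x r' t \<partial>lebesgue_on \<Omega>)" by (simp add: c_def)
    also have "\<dots> \<le> (\<integral>t. tent x r t * \<bar>arctan (y j t - y' t)\<bar> \<partial>lebesgue_on \<Omega>)"
    proof (rule integral_mono)
      show "integrable (lebesgue_on \<Omega>) (\<lambda>t. arctan \<eta> * tent x r' t)"
        by (rule integrable_mult_right[OF csupp_integrable[OF csupp_tent[OF r'(1)] \<Omega>s]])
      show "integrable (lebesgue_on \<Omega>) (\<lambda>t. tent x r t * \<bar>arctan (y j t - y' t)\<bar>)"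
        by (rule csupp_mult_on[OF csupp_tent[OF r(1)] \<Omega>(1) r(2) _ \<Omega>s])
          (intro continuous_intros continuous_on_subset[OF cy(1)] continuous_on_subset[OF cy(2)] closure_subset)
      show "arctan \<eta> * tent x r' t \<le> tent x r t * \<bar>arctan (y j t - y' t)\<bar>" for t
      proof (cases "t \<in> cball x r'")
        case True
        then have "t \<in> cball x r" and tq: "dist t x < q" using r' by (auto simp: dist_commute)
        then have t: "t \<in> closure \<Omega>" "dist t x < q" using r(2) closure_subset[of \<Omega>] by blast+
        have "y' t - \<psi> t > 2 * \<eta>" using q(2)[OF t] \<eta>(2) by (auto simp: dist_real_def)
        then have "\<eta> \<le> - (y j t - y' t)" using y\<psi>[OF t(1), of j] j(1) by linarith
        then have "arctan \<eta> \<le> - arctan (y j t - y' t)"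
          by (simp only: arctan_minus[symmetric] arctan_le_iff)
        then have "arctan \<eta> \<le> \<bar>arctan (y j t - y' t)\<bar>" by linarith
        then have "tent x r' t * arctan \<eta> \<le> tent x r t * \<bar>arctan (y j t - y' t)\<bar>"
          using \<eta>(1) by (intro mult_mono tent_mono r' tent_nonneg) (auto simp: less_imp_le)
        then show ?thesis by (simp add: mult.commute)
      next
        case False
        then have "tent x r' t = 0" using csupp_tent[OF r'(1), of x] by (simp add: csupp_def)
        then show ?thesis by (simp add: tent_nonneg)
      qed
    qed
    finally show False using j(2) by simp
  qed
  then have "y' x - \<psi> x \<le> 0" by (rule continuous_le_on_closure[OF cd x])
  then show ?thesis by simp
qed

section \<open>The algorithm\<close>

text \<open>A real supremum bounds its set only if the set is bounded above; compactness of the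
  closure and continuity provide this.\<close>

lemma Cnorm_plus_upper:
  assumes "bounded \<Omega>" "continuous_on (closure \<Omega>) y" "continuous_on (closure \<Omega>) \<psi>" "x \<in> closure \<Omega>"
  shows "y x \<le> \<psi> x + Cnorm_plus \<Omega> y \<psi>" "0 \<le> Cnorm_plus \<Omega> y \<psi>"
proof -
  have "compact ((\<lambda>x. max 0 (y x - \<psi> x)) ` closure \<Omega>)"
    by (intro compact_continuous_image continuous_intros assms) (simp add: compact_closure assms)
  then have "bdd_above ((\<lambda>x. max 0 (y x - \<psi> x)) ` closure \<Omega>)"
    by (intro bounded_imp_bdd_above compact_imp_bounded)
  from cSUP_upper[OF assms(4) this]
  show "y x \<le> \<psi> x + Cnorm_plus \<Omega> y \<psi>" "0 \<le> Cnorm_plus \<Omega> y \<psi>"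
    unfolding Cnorm_plus_def by auto
qed

lemma ip_plus_nonneg: "0 \<le> ip_plus \<Omega> f g"
  unfolding ip_plus_def by (rule Bochner_Integration.integral_nonneg) simp

lemma Uad_bounded:
  assumes "Linf \<Omega> ua" "Linf \<Omega> ub"
  shows "\<exists>M>0. \<forall>u\<in>Uad \<Omega> ua ub. AE x in lebesgue_on \<Omega>. \<bar>u x\<bar> \<le> M"
proof -
  obtain A B where A: "AE x in lebesgue_on \<Omega>. \<bar>ua x\<bar> \<le> A" and B: "AE x in lebesgue_on \<Omega>. \<bar>ub x\<bar> \<le> B"
    using assms unfolding Linf_def by blast
  have "AE x in lebesgue_on \<Omega>. \<bar>u x\<bar> \<le> \<bar>A\<bar> + \<bar>B\<bar> + 1" if "u \<in> Uad \<Omega> ua ub" for u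
  proof -
    have "AE x in lebesgue_on \<Omega>. ua x \<le> u x \<and> u x \<le> ub x" using that by (simp add: Uad_def)
    with A B show ?thesis by eventually_elim linarith
  qed
  then show ?thesis by (intro exI[of _ "\<bar>A\<bar> + \<bar>B\<bar> + 1"]) auto
qed

text \<open>Induction over the iterations: an entry \<open>n\<close> is written in the successful
  iteration whose counter equals \<open>n\<close>, so what lies below the counter
  \<open>nc k\<close> has already been written. Initially the counter is 1 and there is no such
  entry.\<close>

lemma ALM_recorded:
  fixes nc :: "nat \<Rightarrow> nat" and Rp :: "nat \<Rightarrow> real"
  assumes run: "ALM_run \<Omega> a a0 d yd \<alpha> ua ub \<psi> \<theta> \<tau> \<rho> \<mu> yb ubar pb nc Rp yp up pp mp"
    and "1 \<le> k" "1 \<le> n" "n < nc k"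
  shows "up n \<in> Uad \<Omega> ua ub \<and> state_sol \<Omega> a a0 d (up n) (yp n) \<and>
     Rp n = R_val \<Omega> \<psi> (yp n) (mp n) \<and> Rp n \<le> \<tau> * Rp (n - 1)"
  using assms(2-)
proof (induction k rule: nat_induct_at_least)
  case base
  then show ?case using run by (simp add: ALM_run_def)
next
  case (Suc k)
  let ?mb = "mu_bar (\<mu> k) (\<rho> k) \<psi> (yb k)"
  have os: "ubar k \<in> Uad \<Omega> ua ub" "state_sol \<Omega> a a0 d (ubar k) (yb k)"
    using run Suc(1) unfolding ALM_run_def opt_system_def by blast+
  have st: "if R_val \<Omega> \<psi> (yb k) ?mb \<le> \<tau> * Rp (nc k - 1) then
           \<mu> (k+1) = ?mb \<and> \<rho> (k+1) = \<rho> k \<and>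
           yp (nc k) = yb k \<and> up (nc k) = ubar k \<and> pp (nc k) = pb k \<and> mp (nc k) = ?mb \<and>
           Rp (nc k) = R_val \<Omega> \<psi> (yb k) ?mb \<and> nc (k+1) = nc k + 1
         else \<mu> (k+1) = \<mu> k \<and> \<rho> (k+1) = \<theta> * \<rho> k \<and> nc (k+1) = nc k"
    using run Suc(1) unfolding ALM_run_def Let_def by blast
  show ?case
  proof (cases "n < nc k")
    case True
    then show ?thesis using Suc by simp
  next
    case False
    \<comment> \<open>The counter rises by at most one, so a new entry below it can only be
      \<open>nc k\<close>, and the step must have been successful.\<close>
    then have s: "R_val \<Omega> \<psi> (yb k) ?mb \<le> \<tau> * Rp (nc k - 1)" and n: "n = nc k"
      using st Suc.prems by (auto split: if_splits)
    then show ?thesis using st os by simp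
  qed
qed

theorem theorem4p7:
  fixes \<Omega> :: "(real^'n) set"
    and a :: "'n \<Rightarrow> 'n \<Rightarrow> real^'n \<Rightarrow> real" and a0 :: "real^'n \<Rightarrow> real" and \<delta> :: real
    and d :: "real^'n \<Rightarrow> real \<Rightarrow> real"
    and yd \<psi> ua ub :: "real^'n \<Rightarrow> real" and \<alpha> \<theta> \<tau> :: real
    and \<rho> :: "nat \<Rightarrow> real" and \<mu> yb ubar pb :: "nat \<Rightarrow> real^'n \<Rightarrow> real"
    and nc :: "nat \<Rightarrow> nat" and Rp :: "nat \<Rightarrow> real" and yp up pp mp :: "nat \<Rightarrow> real^'n \<Rightarrow> real"
    and s :: "nat \<Rightarrow> nat" and ustar ystar :: "real^'n \<Rightarrow> real"
  assumes "admissible_domain \<Omega>"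
    and "elliptic_op \<Omega> a a0 \<delta>"
    and "nonlin_ok \<Omega> d"
    and "L2 \<Omega> yd" and "continuous_on (closure \<Omega>) \<psi>" and "\<alpha> > 0"
    and "Linf \<Omega> ua" and "Linf \<Omega> ub" and "AE x in lebesgue_on \<Omega>. ua x \<le> ub x"
    and run: "ALM_run \<Omega> a a0 d yd \<alpha> ua ub \<psi> \<theta> \<tau> \<rho> \<mu> yb ubar pb nc Rp yp up pp mp"
    and bdd: "\<exists>C. \<forall>k\<ge>1. (1 / \<rho> k) * (\<integral>x. (mu_bar (\<mu> k) (\<rho> k) \<psi> (yb k) x)\<^sup>2 \<partial>lebesgue_on \<Omega>) \<le> C"
    and subseq: "strict_mono s" and "\<forall>j. s j \<ge> 1"
    and recorded: "\<forall>j. \<exists>k\<ge>1. s j < nc k"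
    and wlim: "weak_conv_L2 \<Omega> (\<lambda>j. up (s j)) ustar"
    and ystar: "state_sol \<Omega> a a0 d ustar ystar"
  shows "(\<forall>x\<in>closure \<Omega>. ystar x \<le> \<psi> x) \<and>
         (\<lambda>j. ip_plus \<Omega> (mp (s j)) (\<lambda>x. \<psi> x - yp (s j) x)) \<longlonglongrightarrow> 0"
proof -
  have \<Omega>: "open \<Omega>" "bounded \<Omega>" "connected \<Omega>" "\<Omega> \<noteq> {}"
    using assms(1) unfolding admissible_domain_def by auto
  have rec: "up n \<in> Uad \<Omega> ua ub" "state_sol \<Omega> a a0 d (up n) (yp n)"
     "Rp n = R_val \<Omega> \<psi> (yp n) (mp n)" "Rp n \<le> \<tau> * Rp (n - 1)" if n: "1 \<le> n" for n
  proof -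
    obtain k where "1 \<le> k" "s n < nc k" using recorded by blast
    \<comment> \<open>Recording is assumed along the subsequence only; as \<open>s n\<close> is at
      least \<open>n\<close> and the counter has passed \<open>s n\<close>, entry \<open>n\<close>
      has been recorded as well.\<close>
    moreover have "n \<le> s n" using subseq by (rule strict_mono_imp_increasing)
    ultimately have k: "1 \<le> k" "n < nc k" by auto
    show "up n \<in> Uad \<Omega> ua ub" "state_sol \<Omega> a a0 d (up n) (yp n)"
     "Rp n = R_val \<Omega> \<psi> (yp n) (mp n)" "Rp n \<le> \<tau> * Rp (n - 1)"
      using ALM_recorded[OF run k(1) n k(2)] by auto
  qed
  have \<tau>: "0 < \<tau>" "\<tau> < 1" using run unfolding ALM_run_def by blast+
  have Cn: "y x \<le> \<psi> x + Cnorm_plus \<Omega> y \<psi>" "0 \<le> Cnorm_plus \<Omega> y \<psi>"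
    if "state_sol \<Omega> a a0 d u y" "x \<in> closure \<Omega>" for u y x
    using Cnorm_plus_upper[OF \<Omega>(2) _ assms(5) that(2), of y] that(1) by (auto simp: state_sol_def)
  obtain x0 where x0: "x0 \<in> closure \<Omega>" using \<Omega>(4) closure_subset[of \<Omega>] by blast
  have R_nonneg: "0 \<le> Rp n" if n: "1 \<le> n" for n
    using Cn(2)[OF rec(2)[OF n] x0] ip_plus_nonneg[of \<Omega> "mp n"] rec(3)[OF n] by (simp add: R_val_def)
  \<comment> \<open>The successful steps are renumbered consecutively, so each index gains one
    factor \<open>\<tau>\<close>, however many unsuccessful iterations lie in between.\<close>
  have geometric: "Rp n \<le> \<tau> ^ n * Rp 0" for n
  proof (induction n)
    case (Suc n)
    have "Rp (Suc n) \<le> \<tau> * Rp n" using rec(4)[of "Suc n"] by simp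
    also have "\<dots> \<le> \<tau> * (\<tau> ^ n * Rp 0)" using Suc \<tau>(1) by (intro mult_left_mono) auto
    finally show ?case by simp
  qed simp
  have "(\<lambda>n. \<tau> ^ n * Rp 0) \<longlonglongrightarrow> 0"
    using tendsto_mult[OF LIMSEQ_realpow_zero[of \<tau>] tendsto_const[of "Rp 0"]] \<tau> by simp
  moreover have "\<forall>\<^sub>F n in sequentially. 0 \<le> Rp n"
    using eventually_ge_at_top[of 1] by (rule eventually_mono) (rule R_nonneg)
  ultimately have "Rp \<longlonglongrightarrow> 0"
    by (rule tendsto_sandwich[OF _ always_eventually[OF allI[OF geometric]] tendsto_const, rotated])
  then have Rs: "(\<lambda>j. Rp (s j)) \<longlonglongrightarrow> 0"
    using LIMSEQ_subseq_LIMSEQ[OF _ subseq] by (simp add: o_def)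
  have s1: "1 \<le> s j" for j using assms(13) by simp
  note rs = rec[OF s1]
  \<comment> \<open>Both summands of \<open>R_val\<close> are nonnegative, so each of them is
    bounded by the whole.\<close>
  have R_split: "Cnorm_plus \<Omega> (yp (s j)) \<psi> \<le> Rp (s j)" "ip_plus \<Omega> (mp (s j)) (\<lambda>x. \<psi> x - yp (s j) x) \<le> Rp (s j)" for j
    using rs(3)[of j] Cn(2)[OF rs(2) x0, of j] ip_plus_nonneg[of \<Omega> "mp (s j)" "\<lambda>x. \<psi> x - yp (s j) x"]
    by (simp_all add: R_val_def)
  obtain M where M: "M > 0" "\<And>u. u \<in> Uad \<Omega> ua ub \<Longrightarrow> AE x in lebesgue_on \<Omega>. \<bar>u x\<bar> \<le> M"
    using Uad_bounded[OF assms(7,8)] by blast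
  have "ystar x \<le> \<psi> x" if x: "x \<in> closure \<Omega>" for x
  proof (rule limit_state_feasible[OF \<Omega>(1-3) assms(2,3) rs(2) ystar wlim M(2)[OF rs(1)] M(1) assms(5) Rs _ x])
    show "yp (s j) x \<le> \<psi> x + Rp (s j)" if "x \<in> closure \<Omega>" for j x
      using Cn(1)[OF rs(2) that, of j] R_split(1)[of j] by linarith
  qed
  moreover have "(\<lambda>j. ip_plus \<Omega> (mp (s j)) (\<lambda>x. \<psi> x - yp (s j) x)) \<longlonglongrightarrow> 0"
    by (rule tendsto_sandwich[OF always_eventually always_eventually tendsto_const Rs])
      (use ip_plus_nonneg R_split(2) in auto)
  ultimately show ?thesis by blast
qed

end
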